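(* Let $\lambda\ge0$ with $\lambda\neq1$, and let $M_\lambda=\{\rho^\lambda=0\}$ near $\partial\Delta\times\{0\}$. Fix $0<\alpha<1$. There is a neighborhood $V$ of ${\bm f^0}(\zeta)=(\zeta,0,1,0)$ in the space of maps $\overline\Delta\to\mathbb C^4$ holomorphic on $\Delta$ and of class $\mathcal C^\alpha$ up to $\partial\Delta$ such that the set of lifts ${\bm f}=(f,\tilde f)\in V$ of stationary discs for $M_\lambda$ (i.e. ${\bm f}(\zeta)\in\mathcal NM_\lambda(\zeta)$ for all $\zeta\in\partial\Delta$) is a smooth real submanifold of dimension $8$.
   Context: For $\lambda\ge0$ let $\rho^\lambda(z,w)=|z|^2+|w|^2-\lambda\operatorname{Re}(\bar z^4w^2)-1$, and $\Omega_\lambda=\{\rho^\lambda<0\}$ near $\overline\Delta\times\{0\}$, $\Delta$ the unit disc. For a real hypersurface $M=\{\rho=0\}\subset\mathbb C^n$ and $\zeta\in\partial\Delta$, set $\mathcal NM(\zeta)=\{(z,\tilde z)\in\mathbb C^{2n}: z\in M,\ \tilde z\in\zeta N^*_zM\setminus\{0\}\}$, where $N^*_zM=\mathrm{span}_{\mathbb R}\{\partial\rho(z)\}$, $\partial\rho=(\rho_{z_1},\dots,\rho_{z_n})$. A disc $f:\overline\Delta\to\mathbb C^n$, holomorphic on $\Delta$, continuous on $\overline\Delta$ with $f(\partial\Delta)\subset M$, is stationary for $M$ if it has a lift ${\bm f}=(f,\tilde f):\overline\Delta\to\mathbb C^{2n}$, holomorphic on $\Delta$ and continuous up to the boundary,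 with ${\bm f}(\zeta)\in\mathcal NM(\zeta)$ for all $\zeta\in\partial\Delta$. The disc $f^0(\zeta)=(\zeta,0)$ is stationary with lift ${\bm f^0}=(\zeta,0,1,0)$. *)

theory Defs
  imports "HOL-Analysis.Analysis"
begin

definition rho :: "real \<Rightarrow> complex \<times> complex \<Rightarrow> real" where
  "rho lam p = (cmod (fst p))^2 + (cmod (snd p))^2
               - lam * Re ((cnj (fst p))^4 * (snd p)^2) - 1"

definition wirt1 :: "(complex \<times> complex \<Rightarrow> real) \<Rightarrow> complex \<times> complex \<Rightarrow> complex" where
  "wirt1 r p = (complex_of_real (deriv (\<lambda>t::real. r (fst p + of_real t, snd p)) 0)
               - \<i> * complex_of_real (deriv (\<lambda>t::real. r (fst p + \<i> * of_real t, snd p)) 0)) / 2"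

definition wirt2 :: "(complex \<times> complex \<Rightarrow> real) \<Rightarrow> complex \<times> complex \<Rightarrow> complex" where
  "wirt2 r p = (complex_of_real (deriv (\<lambda>t::real. r (fst p, snd p + of_real t)) 0)
               - \<i> * complex_of_real (deriv (\<lambda>t::real. r (fst p, snd p + \<i> * of_real t)) 0)) / 2"

definition dbar_grad :: "(complex \<times> complex \<Rightarrow> real) \<Rightarrow> complex \<times> complex \<Rightarrow> complex \<times> complex" where
  "dbar_grad r p = (wirt1 r p, wirt2 r p)"

definition NM :: "(complex \<times> complex \<Rightarrow> real) \<Rightarrow> complex \<Rightarrow> (complex^4) set" where
  "NM r \<zeta> = {P. r (P$1, P$2) = 0
              \<and> (\<exists>c::real. (P$3, P$4) = (\<zeta> * of_real c * fst (dbar_grad r (P$1, P$2)),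
                                         \<zeta> * of_real c * snd (dbar_grad r (P$1, P$2))))
              \<and> (P$3, P$4) \<noteq> (0, 0)}"

text \<open>Elements are maps on the closed unit disc, extended by 0 outside it (canonical representative).\<close>
definition Aalpha :: "real \<Rightarrow> (complex \<Rightarrow> complex^4) set" where
  "Aalpha \<alpha> = {F. (\<forall>i. (\<lambda>z. F z $ i) holomorphic_on ball 0 1)
                 \<and> (\<exists>C. \<forall>z\<in>cball 0 1. \<forall>w\<in>cball 0 1. norm (F z - F w) \<le> C * cmod (z - w) powr \<alpha>)
                 \<and> (\<forall>z. z \<notin> cball 0 1 \<longrightarrow> F z = 0)}"

definition hnorm :: "real \<Rightarrow> (complex \<Rightarrow> complex^4) \<Rightarrow> real" where
  "hnorm \<alpha> F = (SUP z\<in>cball 0 1. norm (F z))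
     + (SUP q\<in>{(z, w). z \<in> cball 0 1 \<and> w \<in> cball 0 1 \<and> z \<noteq> w}.
          norm (F (fst q) - F (snd q)) / cmod (fst q - snd q) powr \<alpha>)"

definition hopen :: "real \<Rightarrow> (complex \<Rightarrow> complex^4) set \<Rightarrow> bool" where
  "hopen \<alpha> U \<longleftrightarrow> U \<subseteq> Aalpha \<alpha> \<and>
     (\<forall>F\<in>U. \<exists>e>0. \<forall>G\<in>Aalpha \<alpha>. hnorm \<alpha> (\<lambda>z. G z - F z) < e \<longrightarrow> G \<in> U)"

definition hderiv :: "real \<Rightarrow> ('a::euclidean_space \<Rightarrow> complex \<Rightarrow> complex^4)
                      \<Rightarrow> ('a \<Rightarrow> complex \<Rightarrow> complex^4) \<Rightarrow> 'a \<Rightarrow> bool" where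
  "hderiv \<alpha> \<phi> L x \<longleftrightarrow>
     (\<forall>u v z. L (u + v) z = L u z + L v z) \<and> (\<forall>c u z. L (c *\<^sub>R u) z = c *\<^sub>R L u z)
     \<and> (\<forall>u. L u \<in> Aalpha \<alpha>)
     \<and> ((\<lambda>h. hnorm \<alpha> (\<lambda>z. \<phi> (x + h) z - \<phi> x z - L h z) / norm h) \<longlongrightarrow> 0) (at 0)"

definition hC0 :: "real \<Rightarrow> ('a::euclidean_space \<Rightarrow> complex \<Rightarrow> complex^4) \<Rightarrow> 'a set \<Rightarrow> bool" where
  "hC0 \<alpha> \<phi> W \<longleftrightarrow> (\<forall>x\<in>W. \<phi> x \<in> Aalpha \<alpha>) \<and>
      (\<forall>x\<in>W. \<forall>e>0. \<exists>d>0. \<forall>y\<in>W. norm (y - x) < d \<longrightarrow> hnorm \<alpha> (\<lambda>z. \<phi> y z - \<phi> x z) < e)"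

primrec hCk :: "nat \<Rightarrow> real \<Rightarrow> ('a::euclidean_space \<Rightarrow> complex \<Rightarrow> complex^4) \<Rightarrow> 'a set \<Rightarrow> bool" where
  "hCk 0 \<alpha> \<phi> W \<longleftrightarrow> hC0 \<alpha> \<phi> W"
| "hCk (Suc k) \<alpha> \<phi> W \<longleftrightarrow> hC0 \<alpha> \<phi> W \<and>
      (\<exists>D. (\<forall>x\<in>W. hderiv \<alpha> \<phi> (D x) x) \<and> (\<forall>b\<in>Basis. hCk k \<alpha> (\<lambda>x. D x b) W))"

text \<open>S is a smooth (C^infinity) embedded real submanifold of A^alpha modelled on 'a
  (dimension DIM('a)): locally the image of a smooth immersion that is a homeomorphism onto its image.\<close>
definition hsubmanifold :: "real \<Rightarrow> 'a::euclidean_space itself \<Rightarrow> (complex \<Rightarrow> complex^4) set \<Rightarrow> bool" where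
  "hsubmanifold \<alpha> _ S \<longleftrightarrow> S \<subseteq> Aalpha \<alpha> \<and>
     (\<forall>p\<in>S. \<exists>U W (\<phi> :: 'a \<Rightarrow> complex \<Rightarrow> complex^4).
        hopen \<alpha> U \<and> p \<in> U \<and> open W \<and> (\<forall>k. hCk k \<alpha> \<phi> W)
        \<and> \<phi> ` W = S \<inter> U \<and> inj_on \<phi> W
        \<and> (\<forall>x\<in>W. \<exists>L. hderiv \<alpha> \<phi> L x \<and> inj L)
        \<and> (\<forall>x\<in>W. \<forall>e>0. \<exists>d>0. \<forall>y\<in>W. hnorm \<alpha> (\<lambda>z. \<phi> y z - \<phi> x z) < d \<longrightarrow> norm (y - x) < e))"

definition f0lift :: "complex \<Rightarrow> complex^4" where
  "f0lift \<zeta> = (if \<zeta> \<in> cball 0 1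
      then (\<chi> i. if i = 1 then \<zeta> else if i = 3 then 1 else 0) else 0)"

end

(* On the circle put z = zeta a, w = zeta^2 b, q = r / zeta. The lift condition becomes three equations
   with constant coefficients in (a, b, p, r) near (1, 0, 1, 0): rho = 0, reality of a p + 2 b r (the
   conserved quantity of the circle action (z, w) -> (e^(it) z, e^(2it) w)), and r A = p D, where A and D
   are the rescaled derivatives of rho.

   Existence. Auxiliary unknowns turn the equations into a quadratic system v = kappa x + Q(v, v) in a
   space of Fourier series with polynomially decaying coefficients, where the projections needed to invert
   the linear part are trivially bounded; lambda <> 1 enters in solving (lambda b - cnj b) for the mean of b.
   The solution depends smoothly on the eight real Taylor data x = (z(0), Im z'(0), Re p(0), w(0), w'(0)).

   Uniqueness. Two solutions close to f0 in the sup norm with the same data coincide: the linearised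
   operator is bounded below in L^2 of the circle by the mean value property alone, and the nonlinear
   remainder has small Lipschitz constant. So no boundedness of the conjugation operator on Hoelder spaces
   is needed, and the lifts near f0 form the graph over their Taylor data. *)

theory Submission
  imports Defs "HOL-Complex_Analysis.Complex_Analysis"
begin

(* Formal_Power_Series leaves its own infix $ active, which would make every vector component ambiguous. *)
no_notation fps_nth (infixl \<open>$\<close> 75)

section \<open>Quadratic equations in Banach spaces\<close>

text \<open>Existence and uniqueness live in different spaces, and the Hoelder space lies between
  them. Coefficients of size (1 + |n|)^(-3) form a convolution algebra and sum to Lipschitz maps on
  the closed disc, so the constructed lifts are Hoelder for every exponent below 1. Uniqueness holds
  among merely continuous lifts close to f0, so it covers every Hoelder lift nearby.

  The conserved quantity disposes of the unknown real multiplier c in (p, r) = c (A, D):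
  \<open>r A = p D\<close> only yields a complex c, but a A + 2 b D is real and close to 1, so
  reality of a p + 2 b r forces c to be real.

  The number 8 comes from counting modes. Holomorphy of zeta a, zeta^2 b, p, r / zeta restricts a,
  b, p, r to modes at least -1, -2, 0, 1. Prescribing Re a leaves free the mode -1 and the imaginary
  mean of a (3 real parameters), prescribing Im (a + p) leaves the real mean of p (1), and
  prescribing r - cnj b + lam b leaves the modes -2 and -1 of b (4). For lam = 1 the mean equation
  lam b - cnj b = g has the real constants as kernel and cannot reach real g other than 0, so the
  count breaks down.\<close>

primrec Ck :: "nat \<Rightarrow> ('a::euclidean_space \<Rightarrow> 'b::real_normed_vector) \<Rightarrow> 'a set \<Rightarrow> bool" where
  "Ck 0 f W \<longleftrightarrow> continuous_on W f"
| "Ck (Suc k) f W \<longleftrightarrow> (\<exists>D. (\<forall>x\<in>W. (f has_derivative D x) (at x)) \<and> (\<forall>b\<in>Basis. Ck k (\<lambda>x. D x b) W))"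

lemma Ck_SucD: "Ck (Suc k) f W \<Longrightarrow> Ck k f W"
proof (induction k arbitrary: f)
  case 0
  then show ?case
    by (auto intro!: continuous_at_imp_continuous_on dest: has_derivative_continuous)
next
  case (Suc k)
  from Suc.prems obtain D where D: "\<forall>x\<in>W. (f has_derivative D x) (at x)"
    and "\<forall>b\<in>Basis. Ck (Suc k) (\<lambda>x. D x b) W" by (simp only: Ck.simps(2)[of "Suc k"]) blast
  with Suc.IH have "\<forall>b\<in>Basis. Ck k (\<lambda>x. D x b) W" by blast
  with D show ?case by auto
qed

lemma Ck_const: "Ck k (\<lambda>x. c) W"
proof (induction k arbitrary: c)
  case (Suc k)
  then show ?case by (auto intro!: exI[of _ "\<lambda>x h. 0"])
qed auto

lemma Ck_add:
  assumes "Ck k f W" "Ck k g W"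
  shows "Ck k (\<lambda>x. f x + g x) W"
  using assms
proof (induction k arbitrary: f g)
  case 0
  then show ?case by (auto intro: continuous_intros)
next
  case (Suc k)
  obtain D where D: "\<forall>x\<in>W. (f has_derivative D x) (at x)" "\<forall>b\<in>Basis. Ck k (\<lambda>x. D x b) W"
    using Suc.prems(1) by auto
  obtain E where E: "\<forall>x\<in>W. (g has_derivative E x) (at x)" "\<forall>b\<in>Basis. Ck k (\<lambda>x. E x b) W"
    using Suc.prems(2) by auto
  show ?case
    unfolding Ck.simps
    using D E Suc.IH by (intro exI[of _ "\<lambda>x h. D x h + E x h"]) (auto intro!: has_derivative_add)
qed

lemma Ck_bounded_bilinear:
  assumes T: "bounded_bilinear T" and "Ck k f W" "Ck k g W"
  shows "Ck k (\<lambda>x. T (f x) (g x)) W"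
  using assms(2-)
proof (induction k arbitrary: f g)
  case 0
  then show ?case by (auto intro: bounded_bilinear.continuous_on[OF T])
next
  case (Suc k)
  obtain D where D: "\<forall>x\<in>W. (f has_derivative D x) (at x)" "\<forall>b\<in>Basis. Ck k (\<lambda>x. D x b) W"
    using Suc.prems(1) by auto
  obtain E where E: "\<forall>x\<in>W. (g has_derivative E x) (at x)" "\<forall>b\<in>Basis. Ck k (\<lambda>x. E x b) W"
    using Suc.prems(2) by auto
  have fg: "Ck k f W" "Ck k g W" using Suc.prems Ck_SucD by blast+
  show ?case
    unfolding Ck.simps
    using D E Suc.IH fg
    by (intro exI[of _ "\<lambda>x h. T (f x) (E x h) + T (D x h) (g x)"])
       (auto intro!: bounded_bilinear.FDERIV[OF T] Ck_add)
qed

locale symmetric_bilinear = bounded_bilinear T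
  for T :: "'b::banach \<Rightarrow> 'b \<Rightarrow> 'b" +
  assumes sym: "T u v = T v u"
begin

lemma linear_solution_unique_bound:
  assumes "\<And>u. norm (T a u) \<le> norm u / 2" and "e = r + T a e"
  shows "norm e \<le> 2 * norm r"
proof -
  have "norm e \<le> norm r + norm (T a e)" using assms(2) norm_triangle_ineq by metis
  with assms(1)[of e] show ?thesis by linarith
qed

lemma linear_solution_exists:
  assumes a: "\<And>u. norm (T a u) \<le> norm u / 2"
  shows "\<exists>e. e = c + T a e"
proof -
  have "dist (c + T a x) (c + T a y) \<le> 1/2 * dist x y" for x y
    using a[of "x - y"] by (simp add: dist_norm diff_right)
  then have "\<exists>!x. c + T a x = x" by (intro banach_fix_type[of "1/2"]) auto
  then show ?thesis by metis
qed

definition sol :: "'b \<Rightarrow> 'b \<Rightarrow> 'b" where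
  "sol a c = (SOME e. e = c + T a e)"

lemma sol_eq: "(\<And>u. norm (T a u) \<le> norm u / 2) \<Longrightarrow> sol a c = c + T a (sol a c)"
  unfolding sol_def by (rule someI_ex) (rule linear_solution_exists)

lemma sol_unique:
  assumes "\<And>u. norm (T a u) \<le> norm u / 2" and "e = c + T a e"
  shows "sol a c = e"
proof -
  have "sol a c - e = 0 + T a (sol a c - e)"
    using assms(2) sol_eq[OF assms(1), of c] by (metis add_0 add_diff_cancel_left diff_right)
  from linear_solution_unique_bound[OF assms(1) this] show ?thesis by simp
qed

lemma bounded_linear_sol:
  assumes a: "\<And>u. norm (T a u) \<le> norm u / 2"
  shows "bounded_linear (sol a)"
proof (rule bounded_linear_intro)
  fix x y :: 'b and r :: real
  show "sol a (x + y) = sol a x + sol a y"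
  proof (rule sol_unique[OF a])
    have "sol a x + sol a y = (x + T a (sol a x)) + (y + T a (sol a y))"
      by (intro arg_cong2[where f="(+)"] sol_eq a)
    also have "\<dots> = x + y + T a (sol a x + sol a y)" by (simp add: add_right)
    finally show "sol a x + sol a y = x + y + T a (sol a x + sol a y)" .
  qed
  show "sol a (r *\<^sub>R x) = r *\<^sub>R sol a x"
  proof (rule sol_unique[OF a])
    have "r *\<^sub>R sol a x = r *\<^sub>R (x + T a (sol a x))"
      by (intro arg_cong[where f="scaleR r"] sol_eq a)
    also have "\<dots> = r *\<^sub>R x + T a (r *\<^sub>R sol a x)" by (simp add: scaleR_right scaleR_right_distrib)
    finally show "r *\<^sub>R sol a x = r *\<^sub>R x + T a (r *\<^sub>R sol a x)" .
  qed
  show "norm (sol a x) \<le> norm x * 2"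
    using linear_solution_unique_bound[OF a sol_eq[OF a, of x]] by simp
qed

text \<open>The increment of \<open>\<psi>\<close> solves a linear equation whose coefficient
  \<open>a\<close> does not vary with \<open>y\<close>, so it is the bounded linear map
  \<open>sol a\<close> applied to the increment of \<open>g\<close>; differentiating
  \<open>\<psi>\<close> reduces to differentiating \<open>g\<close>.\<close>

lemma has_derivative_of_remainder:
  assumes a: "\<And>u. norm (T a u) \<le> norm u / 2"
    and g: "(g has_derivative g') (at x)"
    and W: "open W" "x \<in> W"
    and e: "\<And>y. y \<in> W \<Longrightarrow> \<psi> y - \<psi> x = g y - g x + T a (\<psi> y - \<psi> x)"
  shows "(\<psi> has_derivative (\<lambda>h. sol a (g' h))) (at x)"
proof -
  note lin = bounded_linear_sol[OF a]
  have "((\<lambda>y. sol a (g y - g x) + \<psi> x) has_derivative (\<lambda>h. sol a (g' h))) (at x)"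
    by (auto intro!: derivative_eq_intros g bounded_linear.has_derivative[OF lin])
  then show ?thesis
  proof (rule has_derivative_transform_within_open[OF _ W])
    fix y assume "y \<in> W"
    from sol_unique[OF a e[OF this]] show "sol a (g y - g x) + \<psi> x = \<psi> y" by simp
  qed
qed

end

text \<open>Since \<open>g x = 0\<close>, the variation of \<open>f\<close> contributes only a
  product of two small quantities, so continuity of \<open>f\<close> suffices. This serves when
  \<open>f\<close> is the solution itself, whose differentiability is still to be shown.\<close>

lemma (in bounded_bilinear) has_derivative_vanishing:
  fixes f :: "'x::real_normed_vector \<Rightarrow> 'a"
  assumes f: "continuous (at x) f" and g: "(g has_derivative g') (at x)" and "g x = 0"
  shows "((\<lambda>y. prod (f y) (g y)) has_derivative (\<lambda>h. prod (f x) (g' h))) (at x)"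
proof -
  have g': "bounded_linear g'" using g by (rule has_derivative_bounded_linear)
  have bl: "bounded_linear (\<lambda>h. prod (f x) (g' h))"
    using bounded_linear_compose[OF bounded_linear_right g'] by (simp add: o_def)
  obtain K where K: "\<And>a b. norm (prod a b) \<le> norm a * norm b * K" "K > 0" using pos_bounded by blast
  obtain B where B: "\<And>h. norm (g' h) \<le> norm h * B" "B > 0" using bounded_linear.pos_bounded[OF g'] by blast
  have lim1: "((\<lambda>y. norm (g y - g x - g' (y - x)) / norm (y - x)) \<longlongrightarrow> 0) (at x)"
    using g unfolding has_derivative_iff_norm by simp
  have lim2: "((\<lambda>y. norm (f y - f x)) \<longlongrightarrow> 0) (at x)"
    using f unfolding continuous_at by (simp add: LIM_zero_iff tendsto_norm_zero_iff)
  have lim3: "((\<lambda>y. norm (f y)) \<longlongrightarrow> norm (f x)) (at x)"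
    using f unfolding continuous_at by (rule tendsto_norm)
  have "((\<lambda>y. norm (f y) * (norm (g y - g x - g' (y - x)) / norm (y - x)) * K + norm (f y - f x) * B * K) \<longlongrightarrow>
      norm (f x) * 0 * K + 0 * B * K) (at x)"
    by (intro tendsto_intros lim1 lim2 lim3)
  then have lim: "((\<lambda>y. norm (f y) * (norm (g y - g x - g' (y - x)) / norm (y - x)) * K + norm (f y - f x) * B * K) \<longlongrightarrow> 0) (at x)"
    by simp
  have "((\<lambda>y. norm (prod (f y) (g y) - prod (f x) (g x) - prod (f x) (g' (y - x))) / norm (y - x)) \<longlongrightarrow> 0) (at x)"
  proof (rule tendsto_sandwich[OF _ _ tendsto_const lim])
    show "\<forall>\<^sub>F y in at x. norm (prod (f y) (g y) - prod (f x) (g x) - prod (f x) (g' (y - x))) / norm (y - x)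
       \<le> norm (f y) * (norm (g y - g x - g' (y - x)) / norm (y - x)) * K + norm (f y - f x) * B * K"
    proof (rule always_eventually, rule allI)
      fix y
      have "prod (f y) (g y) - prod (f x) (g x) - prod (f x) (g' (y - x))
          = prod (f y) (g y - g x - g' (y - x)) + prod (f y - f x) (g' (y - x))"
        using \<open>g x = 0\<close> by (simp add: diff_left diff_right add_left zero_right)
      then have "norm (prod (f y) (g y) - prod (f x) (g x) - prod (f x) (g' (y - x)))
         \<le> norm (f y) * norm (g y - g x - g' (y - x)) * K + norm (f y - f x) * norm (g' (y - x)) * K"
        by (metis K(1) norm_triangle_mono)
      also have "\<dots> \<le> norm (f y) * norm (g y - g x - g' (y - x)) * K + norm (f y - f x) * (norm (y - x) * B) * K"
        using B K by (intro add_mono mult_right_mono mult_left_mono) auto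
      finally show "norm (prod (f y) (g y) - prod (f x) (g x) - prod (f x) (g' (y - x))) / norm (y - x)
       \<le> norm (f y) * (norm (g y - g x - g' (y - x)) / norm (y - x)) * K + norm (f y - f x) * B * K"
        using B(2) K(2) by (cases "y = x") (auto simp: field_simps)
    qed
  qed auto
  then show ?thesis unfolding has_derivative_iff_norm using bl by simp
qed

context symmetric_bilinear
begin

text \<open>Differentiating \<open>\<psi> = c + T \<phi> \<psi>\<close> gives an equation with the
  same coefficient and the new right-hand side \<open>E x b + T (\<psi> x) (D x b)\<close>, which is
  of class k once \<open>\<psi>\<close> is. Hence the induction keeps \<open>c\<close> and
  \<open>\<psi>\<close> arbitrary.\<close>

lemma Ck_linear_solution:
  assumes W: "open W" and a: "\<And>x u. x \<in> W \<Longrightarrow> norm (T (\<phi> x) u) \<le> norm u / 2"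
    and "Ck k \<phi> W" "Ck k c W" "\<And>x. x \<in> W \<Longrightarrow> \<psi> x = c x + T (\<phi> x) (\<psi> x)"
  shows "Ck k \<psi> W"
  using assms(3-)
proof (induction k arbitrary: c \<psi>)
  case 0
  show ?case
    unfolding Ck.simps continuous_on_eq_continuous_at[OF W] continuous_at
  proof
    fix x assume x: "x \<in> W"
    have eq: "T (\<phi> x) (\<psi> x) = \<psi> x - c x" if "x \<in> W" for x
      using 0(3)[OF that] by (metis add_diff_cancel_left')
    have c: "(c \<longlongrightarrow> c x) (at x)" and p: "(\<phi> \<longlongrightarrow> \<phi> x) (at x)"
      using 0 x W by (auto simp: continuous_on_eq_continuous_at continuous_at)
    have "((\<lambda>y. 2 * norm (c y - c x + T (\<phi> y - \<phi> x) (\<psi> x))) \<longlongrightarrow> 2 * norm (c x - c x + T (\<phi> x - \<phi> x) (\<psi> x))) (at x)"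
      by (intro tendsto_intros tendsto c p)
    then have lim: "((\<lambda>y. 2 * norm (c y - c x + T (\<phi> y - \<phi> x) (\<psi> x))) \<longlongrightarrow> 0) (at x)"
      by (simp add: zero_left)
    have "((\<lambda>y. \<psi> y - \<psi> x) \<longlongrightarrow> 0) (at x)"
    proof (rule Lim_null_comparison[OF _ lim])
      show "\<forall>\<^sub>F y in at x. norm (\<psi> y - \<psi> x) \<le> 2 * norm (c y - c x + T (\<phi> y - \<phi> x) (\<psi> x))"
        using eventually_at_in_open'[OF W x]
      proof eventually_elim
        case (elim y)
        show ?case
        proof (rule linear_solution_unique_bound[OF a[OF elim]])
          \<comment> \<open>The coefficient is taken at \<open>y\<close>, so that the other terms
            contain only the fixed value \<open>\<psi> x\<close>.\<close>
          show "\<psi> y - \<psi> x = c y - c x + T (\<phi> y - \<phi> x) (\<psi> x) + T (\<phi> y) (\<psi> y - \<psi> x)"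
            using eq[OF x] eq[OF elim] by (simp add: diff_left diff_right)
        qed
      qed
    qed
    then show "(\<psi> \<longlongrightarrow> \<psi> x) (at x)" by (simp add: LIM_zero_iff)
  qed
next
  case (Suc k)
  have low: "Ck k \<phi> W" "Ck k c W" using Suc.prems Ck_SucD by blast+
  have psik: "Ck k \<psi> W" using Suc.IH[OF low] Suc.prems(3) by blast
  then have cont: "continuous_on W \<psi>" by (induction k) (use Ck_SucD in auto)
  obtain D where D: "\<And>x. x \<in> W \<Longrightarrow> (\<phi> has_derivative D x) (at x)" "\<And>b. b \<in> Basis \<Longrightarrow> Ck k (\<lambda>x. D x b) W"
    using Suc.prems(1) by auto
  obtain E where E: "\<And>x. x \<in> W \<Longrightarrow> (c has_derivative E x) (at x)" "\<And>b. b \<in> Basis \<Longrightarrow> Ck k (\<lambda>x. E x b) W"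
    using Suc.prems(2) by auto
  have eq: "T (\<phi> x) (\<psi> x) = \<psi> x - c x" if "x \<in> W" for x
    using Suc.prems(3)[OF that] by (metis add_diff_cancel_left')
  define F where "F x h = sol (\<phi> x) (E x h + T (\<psi> x) (D x h))" for x h
  have der: "(\<psi> has_derivative F x) (at x)" if x: "x \<in> W" for x
    unfolding F_def
  proof (rule has_derivative_of_remainder[OF a[OF x] _ W x])
    \<comment> \<open>Now the coefficient is frozen at \<open>x\<close>; the price is the factor
      \<open>\<psi> y\<close>, which multiplies something vanishing at \<open>x\<close>.\<close>
    show "((\<lambda>y. c y + T (\<psi> y) (\<phi> y - \<phi> x)) has_derivative (\<lambda>h. E x h + T (\<psi> x) (D x h))) (at x)"
    proof (intro has_derivative_add E x has_derivative_vanishing)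
      show "continuous (at x) \<psi>" using cont W x by (simp add: continuous_on_eq_continuous_at)
      show "((\<lambda>y. \<phi> y - \<phi> x) has_derivative D x) (at x)"
        using D(1)[OF x] by (auto intro!: derivative_eq_intros)
    qed simp
    fix y assume y: "y \<in> W"
    show "\<psi> y - \<psi> x = c y + T (\<psi> y) (\<phi> y - \<phi> x) - (c x + T (\<psi> x) (\<phi> x - \<phi> x)) + T (\<phi> x) (\<psi> y - \<psi> x)"
      using eq[OF x] eq[OF y] sym[of "\<psi> y"] sym[of "\<psi> x"]
      by (simp add: diff_left diff_right zero_right)
  qed
  have "Ck k (\<lambda>x. F x b) W" if b: "b \<in> Basis" for b
  proof (rule Suc.IH[OF low(1)])
    show "Ck k (\<lambda>x. E x b + T (\<psi> x) (D x b)) W"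
      by (rule Ck_add[OF E(2)[OF b] Ck_bounded_bilinear[OF bounded_bilinear_axioms psik D(2)[OF b]]])
    show "F x b = E x b + T (\<psi> x) (D x b) + T (\<phi> x) (F x b)" if "x \<in> W" for x
      unfolding F_def by (rule sol_eq) (rule a[OF that])
  qed
  with der show ?case by auto
qed

theorem quadratic_solution:
  fixes \<kappa> :: "'a::euclidean_space \<Rightarrow> 'b"
  assumes \<kappa>: "bounded_linear \<kappa>"
  shows "\<exists>W \<phi>. open W \<and> 0 \<in> W \<and> \<phi> 0 = 0 \<and> (\<forall>x\<in>W. \<phi> x = \<kappa> x + T (\<phi> x) (\<phi> x)) \<and> (\<forall>k. Ck k \<phi> W)"
proof -
  obtain K0 where K0: "\<And>a b. norm (T a b) \<le> norm a * norm b * K0" "K0 > 0" using pos_bounded by blast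
  obtain B where B: "\<And>h. norm (\<kappa> h) \<le> norm h * B" "B > 0" using bounded_linear.pos_bounded[OF \<kappa>] by blast
  interpret \<kappa>: bounded_linear \<kappa> by fact
  \<comment> \<open>On the ball of radius \<open>\<rho>\<close> every \<open>T a\<close> has norm at
    most 1/4. So the map from v to \<open>T v v\<close> contracts by 1/2 there, and with
    \<open>\<kappa> x\<close> of norm at most \<open>\<rho> / 2\<close> the ball is mapped into
    itself.\<close>
  define \<rho> where "\<rho> = 1 / (4 * K0)"
  have \<rho>: "\<rho> > 0" "\<rho> * K0 = 1/4" using K0 by (auto simp: \<rho>_def)
  define W where "W = ball (0::'a) (\<rho> / (2 * B))"
  have W: "norm (\<kappa> x) \<le> \<rho> / 2" if "x \<in> W" for x
  proof -
    have "norm x * B \<le> \<rho> / (2 * B) * B" using that B by (intro mult_right_mono) (auto simp: W_def)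
    then show ?thesis using B(1)[of x] B(2) by simp
  qed
  have small: "norm (T a b) \<le> norm b / 4" if "norm a \<le> \<rho>" for a b
  proof -
    have "norm (T a b) \<le> norm a * K0 * norm b" using K0(1)[of a b] by (simp add: mult_ac)
    also have "\<dots> \<le> \<rho> * K0 * norm b" using that K0 by (intro mult_right_mono) auto
    finally show ?thesis using \<rho> by simp
  qed
  have ex: "\<exists>!v. v \<in> cball 0 \<rho> \<and> \<kappa> x + T v v = v" if x: "x \<in> W" for x
  proof -
    have "(\<lambda>v. \<kappa> x + T v v) ` cball 0 \<rho> \<subseteq> cball 0 \<rho>"
    proof safe
      fix v :: 'b assume v: "v \<in> cball 0 \<rho>"
      have "norm (\<kappa> x + T v v) \<le> \<rho>/2 + norm v / 4"
        using W[OF x] small[of v v] v by (intro norm_triangle_mono) auto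
      then show "\<kappa> x + T v v \<in> cball 0 \<rho>" using v \<rho> by auto
    qed
    moreover have "\<forall>u\<in>cball 0 \<rho>. \<forall>v\<in>cball 0 \<rho>. dist (\<kappa> x + T u u) (\<kappa> x + T v v) \<le> 1/2 * dist u v"
    proof (intro ballI)
      fix u v :: 'b assume uv: "u \<in> cball 0 \<rho>" "v \<in> cball 0 \<rho>"
      have "T u u - T v v = T u (u - v) + T v (u - v)" by (simp add: diff_right sym[of v u])
      moreover have "norm (T u (u - v)) \<le> norm (u - v) / 4" "norm (T v (u - v)) \<le> norm (u - v) / 4"
        using small uv by auto
      ultimately have "norm (T u u - T v v) \<le> norm (u - v) / 4 + norm (u - v) / 4"
        by (simp only: norm_triangle_mono)
      then show "dist (\<kappa> x + T u u) (\<kappa> x + T v v) \<le> 1/2 * dist u v" by (simp add: dist_norm)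
    qed
    ultimately show ?thesis using \<rho> Banach_fix[of "cball 0 \<rho>" "1/2" "\<lambda>v. \<kappa> x + T v v"] by (auto simp: complete_eq_closed)
  qed
  define \<phi> where "\<phi> x = (THE v. v \<in> cball 0 \<rho> \<and> \<kappa> x + T v v = v)" for x
  have \<phi>: "norm (\<phi> x) \<le> \<rho>" "\<phi> x = \<kappa> x + T (\<phi> x) (\<phi> x)" if "x \<in> W" for x
    using theI'[OF ex[OF that]] by (auto simp: \<phi>_def)
  have W0: "0 \<in> W" using \<rho> B by (auto simp: W_def)
  have \<phi>0: "\<phi> 0 = 0"
    unfolding \<phi>_def using ex[OF W0] by (rule the1_equality) (use \<rho> in \<open>auto simp: zero_left \<kappa>.zero\<close>)
  have eq: "T (\<phi> x) (\<phi> x) = \<phi> x - \<kappa> x" if "x \<in> W" for x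
    using \<phi>(2)[OF that] by (metis add_diff_cancel_left')
  have oW: "open W" by (simp add: W_def)
  \<comment> \<open>The linearisation of \<open>T v v\<close> at \<open>\<phi> x\<close> is
    \<open>2 *\<^sub>R T (\<phi> x)\<close>, of norm at most 1/2 by the choice of
    \<open>\<rho>\<close>.\<close>
  interpret S: symmetric_bilinear "\<lambda>u v. 2 *\<^sub>R T u v"
  proof (rule symmetric_bilinear.intro)
    show "bounded_bilinear (\<lambda>u v. 2 *\<^sub>R T u v)"
    proof (unfold_locales, goal_cases)
      case 5
      show ?case
        by (intro exI[of _ "2 * K0"]) (use K0 in \<open>auto simp: mult_ac\<close>)
    qed (simp_all add: add_left add_right scaleR_left scaleR_right algebra_simps)
  qed (unfold_locales, simp add: sym)
  have half: "norm (2 *\<^sub>R T (\<phi> x) u) \<le> norm u / 2" if "x \<in> W" for x u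
    using small[OF \<phi>(1)[OF that], of u] by simp
  \<comment> \<open>An a priori Lipschitz bound: it makes
    \<open>T (\<phi> y - \<phi> x) (\<phi> y - \<phi> x)\<close> quadratic in \<open>y - x\<close>,
    so that only \<open>\<kappa>\<close> survives in the derivative of the remainder.\<close>
  have lip: "norm (\<phi> y - \<phi> x) \<le> 2 * (norm (y - x) * B)" if xy: "x \<in> W" "y \<in> W" for x y
  proof -
    have "\<phi> y - \<phi> x = \<kappa> (y - x) + (T (\<phi> y) (\<phi> y - \<phi> x) + T (\<phi> x) (\<phi> y - \<phi> x))"
      using eq[OF xy(1)] eq[OF xy(2)] by (simp add: diff_right sym[of "\<phi> x" "\<phi> y"] \<kappa>.diff)
    then have "norm (\<phi> y - \<phi> x) \<le> norm (\<kappa> (y - x)) + norm (T (\<phi> y) (\<phi> y - \<phi> x) + T (\<phi> x) (\<phi> y - \<phi> x))"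
      by (metis norm_triangle_ineq)
    also have "\<dots> \<le> norm (\<kappa> (y - x)) + (norm (\<phi> y - \<phi> x) / 4 + norm (\<phi> y - \<phi> x) / 4)"
      using small[OF \<phi>(1)[OF xy(1)]] small[OF \<phi>(1)[OF xy(2)]] by (intro add_left_mono norm_triangle_mono) auto
    finally show ?thesis using B(1)[of "y - x"] by simp
  qed
  define D where "D x h = S.sol (\<phi> x) (\<kappa> h)" for x h
  have der: "(\<phi> has_derivative D x) (at x)" if x: "x \<in> W" for x
    unfolding D_def
  proof (rule S.has_derivative_of_remainder[OF half[OF x] _ oW x])
    obtain e where e: "e > 0" "ball x e \<subseteq> W" using oW x by (auto simp: open_contains_ball)
    show "((\<lambda>y. \<kappa> y + T (\<phi> y - \<phi> x) (\<phi> y - \<phi> x)) has_derivative (\<lambda>h. \<kappa> h)) (at x)"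
    proof (rule has_derivativeI_sandwich[OF e(1) \<kappa>])
      show "((\<lambda>y. (2 * B) * (2 * B) * K0 * norm (y - x)) \<longlongrightarrow> 0) (at x)"
        by (auto intro!: tendsto_eq_intros)
      fix y assume y: "y \<noteq> x" "dist y x < e"
      then have "y \<in> W" using e by (auto simp: dist_commute)
      note l = lip[OF x this]
      have "norm (T (\<phi> y - \<phi> x) (\<phi> y - \<phi> x)) \<le> (2 * (norm (y - x) * B)) * (2 * (norm (y - x) * B)) * K0"
        using K0(2) B(2) l by (intro order_trans[OF K0(1)] mult_right_mono mult_mono) auto
      then show "norm (\<kappa> y + T (\<phi> y - \<phi> x) (\<phi> y - \<phi> x) - (\<kappa> x + T (\<phi> x - \<phi> x) (\<phi> x - \<phi> x)) - \<kappa> (y - x)) / norm (y - x)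
          \<le> (2 * B) * (2 * B) * K0 * norm (y - x)"
        using y(1) by (simp add: \<kappa>.diff zero_left field_simps)
    qed
    fix y assume y: "y \<in> W"
    show "\<phi> y - \<phi> x = \<kappa> y + T (\<phi> y - \<phi> x) (\<phi> y - \<phi> x) - (\<kappa> x + T (\<phi> x - \<phi> x) (\<phi> x - \<phi> x)) + 2 *\<^sub>R T (\<phi> x) (\<phi> y - \<phi> x)"
      using eq[OF x] eq[OF y] sym[of "\<phi> x" "\<phi> y"]
      by (simp add: diff_left diff_right zero_left scaleR_2)
  qed
  have cont: "continuous (at x) \<phi>" if "x \<in> W" for x
    using der[OF that] by (rule has_derivative_continuous)
  have "Ck k \<phi> W" for k
  proof (induction k)
    case 0
    then show ?case using cont by (simp add: continuous_at_imp_continuous_on)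
  next
    case (Suc k)
    \<comment> \<open>Bootstrapping: \<open>D x b\<close> solves a linear equation with constant
      right-hand side and a coefficient of class k, hence is of class k itself, and
      \<open>\<phi>\<close> gains one order.\<close>
    have "Ck k (\<lambda>x. D x b) W" for b
    proof (rule S.Ck_linear_solution[OF oW half Suc.IH Ck_const[where c="\<kappa> b"]])
      show "D x b = \<kappa> b + 2 *\<^sub>R T (\<phi> x) (D x b)" if "x \<in> W" for x
        unfolding D_def by (rule S.sol_eq) (rule half[OF that])
    qed
    then show ?case using der by auto
  qed
  with oW W0 \<phi>0 \<phi>(2) show ?thesis by blast
qed

end

section \<open>A Banach space of Fourier series\<close>

(* Needed only because the library proves completeness of bounded continuous functions for metric domains. *)
instantiation int :: metric_space
begin

definition dist_int :: "int \<Rightarrow> int \<Rightarrow> real" where "dist_int m n = \<bar>real_of_int (m - n)\<bar>"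

definition uniformity_int :: "(int \<times> int) filter" where
  "uniformity_int = (INF e\<in>{0 <..}. principal {(m, n). dist m n < e})"

instance
proof
  fix U :: "int set"
  have "\<forall>\<^sub>F (m', n) in (uniformity :: (int \<times> int) filter). m' = m \<longrightarrow> n \<in> U" if "m \<in> U" for m
    unfolding uniformity_int_def
    by (rule eventually_INF1[of 1])
       (use that in \<open>auto simp: eventually_principal dist_int_def simp flip: of_int_diff of_int_abs\<close>)
  then show "open U \<longleftrightarrow> (\<forall>m\<in>U. \<forall>\<^sub>F (m', n) in uniformity. m' = m \<longrightarrow> n \<in> U)"
    by (simp add: open_discrete)
qed (auto simp: dist_int_def uniformity_int_def)

end

instance bcontfun :: (metric_space, banach) banach ..
type_synonym wser = "int \<Rightarrow>\<^sub>C complex"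

text \<open>The third power leaves one factor to spare: even \<open>n / weight n\<close> is
  summable, which makes the series Lipschitz up to the boundary.\<close>

definition weight :: "int \<Rightarrow> real" where "weight n = (1 + \<bar>real_of_int n\<bar>) ^ 3"

lemma weight_ge_1: "weight n \<ge> 1"
  by (simp add: weight_def one_le_power)

lemma weight_pos [simp]: "weight n > 0" "weight n \<noteq> 0" "weight n \<ge> 0"
  using weight_ge_1[of n] by auto

lemma weight_minus [simp]: "weight (- n) = weight n"
  by (simp add: weight_def)

lemma weight_submult: "weight (m + n) \<le> weight m * weight n"
proof -
  have "1 + \<bar>real_of_int (m + n)\<bar> \<le> 1 + \<bar>real_of_int m\<bar> + \<bar>real_of_int n\<bar> + \<bar>real_of_int m\<bar> * \<bar>real_of_int n\<bar>"
    using abs_triangle_ineq[of "real_of_int m" "real_of_int n"]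
      mult_nonneg_nonneg[of "\<bar>real_of_int m\<bar>" "\<bar>real_of_int n\<bar>"] by (simp del: mult_nonneg_nonneg)
  also have "\<dots> = (1 + \<bar>real_of_int m\<bar>) * (1 + \<bar>real_of_int n\<bar>)"
    by (simp add: algebra_simps)
  finally show ?thesis
    unfolding weight_def power_mult_distrib[symmetric] by (intro power_mono) auto
qed

text \<open>The larger of the two bases is at least half the base of \<open>m + k\<close>, which
  costs \<open>2^3 = 8\<close>. Decay at both indices thus becomes decay at their sum times a
  summable kernel, the estimate behind the convolution algebra.\<close>

lemma weight_quasi_subadd: "1 / (weight m * weight k) \<le> 8 * (1 / weight m + 1 / weight k) / weight (m + k)"
proof -
  define x y where "x = 1 + \<bar>real_of_int m\<bar>" and "y = 1 + \<bar>real_of_int k\<bar>"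
  have xy: "x \<ge> 1" "y \<ge> 1" "1 + \<bar>real_of_int (m + k)\<bar> \<le> x + y" by (auto simp: x_def y_def)
  have "weight (m + k) \<le> (x + y) ^ 3" unfolding weight_def using xy by (intro power_mono) auto
  also have "\<dots> \<le> (2 * max x y) ^ 3" using xy by (intro power_mono) auto
  also have "\<dots> = 8 * (max x y) ^ 3" by (simp add: power_mult_distrib)
  also have "\<dots> \<le> 8 * (x ^ 3 + y ^ 3)" using xy by (cases "x \<le> y") auto
  finally have "weight (m + k) \<le> 8 * (weight m + weight k)" by (simp add: weight_def x_def y_def)
  then have "weight (m + k) / (weight m * weight k * weight (m + k)) \<le> 8 * (weight m + weight k) / (weight m * weight k * weight (m + k))"
    by (intro divide_right_mono) auto
  then show ?thesis by (simp add: field_simps)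
qed

lemma inverse_weight_summable: "(\<lambda>n. 1 / weight n) summable_on UNIV"
proof -
  have s: "summable (\<lambda>n. 1 / (1 + real n) ^ 3)"
    using summable_Suc_iff[of "\<lambda>n. inverse (real n ^ 3)"] inverse_power_summable[of 3, where ?'a=real]
    by (simp add: inverse_eq_divide add_ac)
  have "(\<lambda>n::nat. 1 / (1 + real n) ^ 3) summable_on UNIV"
    by (rule norm_summable_imp_summable_on) (use s in simp)
  then have 1: "((\<lambda>n. 1 / weight n) \<circ> int) summable_on UNIV" and 2: "((\<lambda>n. 1 / weight n) \<circ> (\<lambda>n. - int n)) summable_on UNIV"
    by (simp_all add: o_def weight_def)
  have "(\<lambda>n. 1 / weight n) summable_on range int" "(\<lambda>n. 1 / weight n) summable_on range (\<lambda>n. - int n)"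
    using 1 2 by (simp_all add: summable_on_reindex inj_on_def)
  then have "(\<lambda>n. 1 / weight n) summable_on (range int \<union> range (\<lambda>n. - int n))"
    by (rule summable_on_union)
  moreover have "k \<in> range int \<union> range (\<lambda>n. - int n)" for k
    by (cases k rule: int_cases2) auto
  then have "range int \<union> range (\<lambda>n. - int n) = UNIV" by blast
  ultimately show ?thesis by simp
qed

(* An element b stands for the Fourier series with coefficients b n / weight n, so the sup norm of b is the
   weighted sup norm of the coefficients. *)
definition fcoeff :: "wser \<Rightarrow> int \<Rightarrow> complex" where
  "fcoeff b n = b n / of_real (weight n)"

text \<open>Meaningful only if the weighted coefficients are bounded; continuity is automatic on the
  discrete integers.\<close>

definition of_fcoeff :: "(int \<Rightarrow> complex) \<Rightarrow> wser" where
  "of_fcoeff c = Bcontfun (\<lambda>n. of_real (weight n) * c n)"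

lemma norm_fcoeff: "norm (fcoeff b n) \<le> norm b / weight n"
  using norm_bounded[of b n] by (simp add: fcoeff_def norm_divide divide_right_mono)

lemma norm_fcoeff_weight: "norm (fcoeff b n) * weight n \<le> norm b"
  using norm_fcoeff[of b n] by (simp add: field_simps)

lemma fcoeff_add [simp]: "fcoeff (a + b) n = fcoeff a n + fcoeff b n"
  and fcoeff_diff [simp]: "fcoeff (a - b) n = fcoeff a n - fcoeff b n"
  and fcoeff_minus [simp]: "fcoeff (- a) n = - fcoeff a n"
  and fcoeff_zero [simp]: "fcoeff 0 n = 0"
  and fcoeff_scaleR [simp]: "fcoeff (r *\<^sub>R a) n = r *\<^sub>R fcoeff a n"
  by (simp_all add: fcoeff_def add_divide_distrib diff_divide_distrib scaleR_conv_of_real)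

lemma wser_eqI: "(\<And>n. fcoeff a n = fcoeff b n) \<Longrightarrow> a = b"
  by (rule bcontfun_eqI) (simp add: fcoeff_def)

lemma
  assumes "\<And>n. norm (c n) * weight n \<le> B"
  shows fcoeff_of_fcoeff: "fcoeff (of_fcoeff c) n = c n" and norm_of_fcoeff: "norm (of_fcoeff c) \<le> B"
proof -
  have "(\<lambda>n. of_real (weight n) * c n) \<in> bcontfun"
    using assms by (auto simp: bcontfun_def bounded_iff norm_mult mult.commute intro!: exI[of _ B])
  then have *: "apply_bcontfun (of_fcoeff c) n = of_real (weight n) * c n" for n
    by (simp add: of_fcoeff_def Bcontfun_inverse)
  then show "fcoeff (of_fcoeff c) n = c n" by (simp add: fcoeff_def)
  show "norm (of_fcoeff c) \<le> B"
    by (rule norm_bound) (use assms * in \<open>simp add: norm_mult mult.commute\<close>)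
qed

text \<open>Conjugation, multipliers and \<open>solve_twisted\<close> all obtain their coefficient
  formula and boundedness from one weighted coefficient estimate, without reference to the functions
  that the series represent.\<close>

lemma
  assumes B: "\<And>b n. norm (t b n) * weight n \<le> norm b * K"
  shows fcoeff_of_fcoeff_op: "fcoeff (of_fcoeff (t b)) n = t b n"
    and bounded_linear_of_fcoeff: "(\<And>a b n. t (a + b) n = t a n + t b n) \<Longrightarrow> (\<And>r a n. t (r *\<^sub>R a) n = r *\<^sub>R t a n)
      \<Longrightarrow> bounded_linear (\<lambda>b. of_fcoeff (t b))"
proof -
  show fcoeff: "fcoeff (of_fcoeff (t b)) n = t b n" for b n by (rule fcoeff_of_fcoeff[OF B])
  assume "\<And>a b n. t (a + b) n = t a n + t b n" "\<And>r a n. t (r *\<^sub>R a) n = r *\<^sub>R t a n"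
  then show "bounded_linear (\<lambda>b. of_fcoeff (t b))"
    by (intro bounded_linear_intro[of _ K] wser_eqI) (auto simp: fcoeff norm_of_fcoeff[OF B])
qed

text \<open>Conjugation of the values on the unit circle, where \<open>cnj \<zeta>\<close> is the
  inverse of \<open>\<zeta>\<close>; this reflects the index.\<close>

definition cnj_series :: "wser \<Rightarrow> wser" where "cnj_series b = of_fcoeff (\<lambda>n. cnj (fcoeff b (- n)))"

lemma cnj_series_bound: "norm (cnj (fcoeff b (- n))) * weight n \<le> norm b * 1"
  using norm_fcoeff_weight[of b "- n"] by simp

lemma fcoeff_cnj_series [simp]: "fcoeff (cnj_series b) n = cnj (fcoeff b (- n))"
  unfolding cnj_series_def by (rule fcoeff_of_fcoeff_op[OF cnj_series_bound])

lemma bounded_linear_cnj_series: "bounded_linear cnj_series"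
  using bounded_linear_of_fcoeff[OF cnj_series_bound] by (simp add: cnj_series_def[abs_def])

definition multiplier :: "(int \<Rightarrow> complex) \<Rightarrow> wser \<Rightarrow> wser" where "multiplier m b = of_fcoeff (\<lambda>n. m n * fcoeff b n)"

lemma multiplier_bound: "(\<And>n. norm (m n) \<le> K) \<Longrightarrow> norm (m n * fcoeff b n) * weight n \<le> norm b * K"
  using mult_mono'[OF norm_fcoeff_weight[of b n], of "norm (m n)" K] by (simp add: norm_mult mult_ac)

lemma fcoeff_multiplier: "(\<And>n. norm (m n) \<le> K) \<Longrightarrow> fcoeff (multiplier m b) n = m n * fcoeff b n"
  unfolding multiplier_def by (rule fcoeff_of_fcoeff_op[OF multiplier_bound])

lemma bounded_linear_multiplier: assumes "\<And>n. norm (m n) \<le> K" shows "bounded_linear (multiplier m)"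
proof -
  have "bounded_linear (\<lambda>b. of_fcoeff (\<lambda>n. m n * fcoeff b n))"
    by (rule bounded_linear_of_fcoeff[where K=K]) (simp_all add: multiplier_bound assms distrib_left)
  then show ?thesis by (simp add: multiplier_def[abs_def])
qed

definition single_mode :: "int \<Rightarrow> complex \<Rightarrow> wser" where "single_mode k c = of_fcoeff (\<lambda>n. if n = k then c else 0)"

lemma single_mode_bound: "norm (if n = k then c else 0) * weight n \<le> norm c * weight k"
  by simp

lemma fcoeff_single_mode [simp]: "fcoeff (single_mode k c) n = (if n = k then c else 0)"
  unfolding single_mode_def by (rule fcoeff_of_fcoeff[OF single_mode_bound])

definition conv :: "wser \<Rightarrow> wser \<Rightarrow> wser" where
  "conv a b = of_fcoeff (\<lambda>n. \<Sum>\<^sub>\<infinity>m. fcoeff a m * fcoeff b (n - m))"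

text \<open>Replacing \<open>m\<close> by \<open>n - m\<close> preserves the sum of the reciprocal
  weights, so both halves of the kernel contribute equally and 8 becomes 16.\<close>

lemma weight_conv_summable: "(\<lambda>m. 8 * (1 / weight m + 1 / weight (n - m)) / weight n) summable_on UNIV"
  and weight_conv_infsum: "(\<Sum>\<^sub>\<infinity>m. 8 * (1 / weight m + 1 / weight (n - m)) / weight n) = 16 * (\<Sum>\<^sub>\<infinity>m. 1 / weight m) / weight n"
proof -
  have bij: "bij_betw (\<lambda>m. n - m) UNIV (UNIV :: int set)"
    by (rule bij_betwI[of _ _ _ "\<lambda>m. n - m"]) auto
  have s: "(\<lambda>m. 1 / weight (n - m)) summable_on UNIV"
    using summable_on_reindex_bij_betw[OF bij, of "\<lambda>n. 1 / weight n"] inverse_weight_summable by simp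
  have i: "(\<Sum>\<^sub>\<infinity>m. 1 / weight (n - m)) = (\<Sum>\<^sub>\<infinity>m. 1 / weight m)"
    using infsum_reindex_bij_betw[OF bij, of "\<lambda>n. 1 / weight n"] by simp
  have a: "(\<lambda>m. 1 / weight m + 1 / weight (n - m)) summable_on UNIV"
    by (intro summable_on_add inverse_weight_summable s)
  have e: "(\<lambda>m. 8 * (1 / weight m + 1 / weight (n - m)) / weight n) = (\<lambda>m. (8 / weight n) * (1 / weight m + 1 / weight (n - m)))"
    by auto
  show "(\<lambda>m. 8 * (1 / weight m + 1 / weight (n - m)) / weight n) summable_on UNIV"
    unfolding e by (intro summable_on_cmult_right a)
  show "(\<Sum>\<^sub>\<infinity>m. 8 * (1 / weight m + 1 / weight (n - m)) / weight n) = 16 * (\<Sum>\<^sub>\<infinity>m. 1 / weight m) / weight n"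
    unfolding e infsum_cmult_right[OF a] infsum_add[OF inverse_weight_summable s] i by simp
qed

lemma conv_term_bound:
  "norm (fcoeff a m * fcoeff b (n - m)) \<le> norm a * norm b * (8 * (1 / weight m + 1 / weight (n - m)) / weight n)"
proof -
  have "norm (fcoeff a m * fcoeff b (n - m)) \<le> (norm a / weight m) * (norm b / weight (n - m))"
    unfolding norm_mult by (intro mult_mono norm_fcoeff) auto
  also have "\<dots> = norm a * norm b * (1 / (weight m * weight (n - m)))" by simp
  also have "\<dots> \<le> norm a * norm b * (8 * (1 / weight m + 1 / weight (n - m)) / weight n)"
    using weight_quasi_subadd[of m "n - m"] by (intro mult_left_mono) auto
  finally show ?thesis .
qed

lemma conv_abs_summable: "(\<lambda>m. norm (fcoeff a m * fcoeff b (n - m))) summable_on UNIV"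
  by (rule summable_on_comparison_test[OF summable_on_cmult_right[OF weight_conv_summable] conv_term_bound]) auto

lemma conv_summable: "(\<lambda>m. fcoeff a m * fcoeff b (n - m)) summable_on UNIV"
  by (rule abs_summable_summable[OF conv_abs_summable])

lemma conv_bound:
  "norm (\<Sum>\<^sub>\<infinity>m. fcoeff a m * fcoeff b (n - m)) * weight n \<le> norm a * norm b * (16 * (\<Sum>\<^sub>\<infinity>m. 1 / weight m))"
proof -
  have "norm (\<Sum>\<^sub>\<infinity>m. fcoeff a m * fcoeff b (n - m)) \<le> (\<Sum>\<^sub>\<infinity>m. norm a * norm b * (8 * (1 / weight m + 1 / weight (n - m)) / weight n))"
    by (rule norm_infsum_le[OF has_sum_infsum[OF conv_summable] has_sum_infsum[OF summable_on_cmult_right[OF weight_conv_summable]] conv_term_bound])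
  also have "\<dots> = norm a * norm b * (16 * (\<Sum>\<^sub>\<infinity>m. 1 / weight m)) / weight n"
    unfolding infsum_cmult_right[OF weight_conv_summable] weight_conv_infsum by simp
  finally show ?thesis by (simp add: field_simps)
qed

lemma fcoeff_conv: "fcoeff (conv a b) n = (\<Sum>\<^sub>\<infinity>m. fcoeff a m * fcoeff b (n - m))"
  unfolding conv_def by (rule fcoeff_of_fcoeff[OF conv_bound])

lemma bounded_bilinear_conv: "bounded_bilinear conv"
proof (unfold_locales, goal_cases)
  case (1 a a' b)
  show ?case
    by (rule wser_eqI) (simp add: fcoeff_conv distrib_right infsum_add conv_summable)
next
  case (2 a b b')
  show ?case
    by (rule wser_eqI) (simp add: fcoeff_conv distrib_left infsum_add conv_summable)
next
  case (3 r a b)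
  show ?case
    by (rule wser_eqI) (simp add: fcoeff_conv infsum_scaleR_right)
next
  case (4 a r b)
  show ?case
    by (rule wser_eqI) (simp add: fcoeff_conv infsum_scaleR_right)
next
  case 5
  show ?case
    by (intro exI[of _ "16 * (\<Sum>\<^sub>\<infinity>m. 1 / weight m)"] allI) (simp only: conv_def norm_of_fcoeff[OF conv_bound])
qed

section \<open>Evaluation on the unit circle\<close>

definition series_at :: "wser \<Rightarrow> complex \<Rightarrow> complex" where
  "series_at b \<zeta> = (\<Sum>\<^sub>\<infinity>n. fcoeff b n * \<zeta> powi n)"

lemma norm_fcoeff_summable: "(\<lambda>n. norm (fcoeff b n)) summable_on UNIV"
proof (rule summable_on_comparison_test[OF summable_on_cmult_right[OF inverse_weight_summable]])
  show "norm (fcoeff b n) \<le> norm b * (1 / weight n)" for n using norm_fcoeff by simp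
qed auto

context
  fixes \<zeta> :: complex
  assumes \<zeta>: "norm \<zeta> = 1"
begin

lemma norm_powi_circle: "norm (\<zeta> powi n) = 1"
  using \<zeta> by (simp add: norm_power_int)

lemma series_at_abs_summable: "(\<lambda>n. norm (fcoeff b n * \<zeta> powi n)) summable_on UNIV"
  by (simp add: norm_mult norm_powi_circle norm_fcoeff_summable)

lemma series_at_summable: "(\<lambda>n. fcoeff b n * \<zeta> powi n) summable_on UNIV"
  by (rule abs_summable_summable[OF series_at_abs_summable])

lemma series_at_add: "series_at (a + b) \<zeta> = series_at a \<zeta> + series_at b \<zeta>"
  by (simp add: series_at_def distrib_right infsum_add series_at_summable)

lemma series_at_scaleR: "series_at (r *\<^sub>R a) \<zeta> = r *\<^sub>R series_at a \<zeta>"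
  by (simp add: series_at_def infsum_scaleR_right)

lemma series_at_minus: "series_at (- a) \<zeta> = - series_at a \<zeta>"
  using series_at_scaleR[of "-1" a] by simp

lemma series_at_diff: "series_at (a - b) \<zeta> = series_at a \<zeta> - series_at b \<zeta>"
  using series_at_add[of a "- b"] by (simp add: series_at_minus)

lemma series_at_single_mode: "series_at (single_mode k c) \<zeta> = c * \<zeta> powi k"
proof -
  have "series_at (single_mode k c) \<zeta> = (\<Sum>\<^sub>\<infinity>n\<in>{k}. c * \<zeta> powi n)"
    unfolding series_at_def by (rule infsum_cong_neutral) auto
  then show ?thesis by simp
qed

lemma series_at_cnj_series: "series_at (cnj_series b) \<zeta> = cnj (series_at b \<zeta>)"
proof -
  have bij: "bij_betw uminus UNIV (UNIV :: int set)"
    by (rule bij_betwI[of _ _ _ uminus]) auto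
  have "cnj \<zeta> = inverse \<zeta>"
    using \<zeta> complex_norm_square[of \<zeta>] by (intro inverse_unique[symmetric]) simp
  then have c: "cnj (\<zeta> powi n) = \<zeta> powi (- n)" for n
    by (simp add: power_int_minus power_int_inverse)
  have "series_at (cnj_series b) \<zeta> = (\<Sum>\<^sub>\<infinity>n. cnj (fcoeff b (- n) * \<zeta> powi (- n)))"
    by (simp only: series_at_def fcoeff_cnj_series complex_cnj_mult c minus_minus)
  also have "\<dots> = (\<Sum>\<^sub>\<infinity>n. cnj (fcoeff b n * \<zeta> powi n))"
    by (rule infsum_reindex_bij_betw[OF bij, of "\<lambda>n. cnj (fcoeff b n * \<zeta> powi n)"])
  also have "\<dots> = cnj (series_at b \<zeta>)" by (simp only: series_at_def infsum_cnj)
  finally show ?thesis .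
qed

text \<open>Absolute convergence allows the double series to be rearranged along the lines
  \<open>m + k = n\<close>, whose inner sums are the coefficients of \<open>conv\<close>.\<close>

lemma series_at_conv: "series_at (conv a b) \<zeta> = series_at a \<zeta> * series_at b \<zeta>"
proof -
  define f where "f = (\<lambda>(m, k). (fcoeff a m * \<zeta> powi m) * (fcoeff b k * \<zeta> powi k))"
  have "(\<lambda>x. norm (f x)) summable_on UNIV \<times> UNIV"
    by (rule Infinite_Sum.abs_summable_on_Sigma_iff[THEN iffD2]) (simp add: f_def norm_mult abs_mult norm_powi_circle norm_fcoeff_summable
        infsum_cmult_right' summable_on_cmult_right summable_on_cmult_left)
  then have f: "f summable_on UNIV \<times> UNIV" by (rule abs_summable_summable)
  have bij: "bij_betw (\<lambda>(n, m). (m, n - m)) (UNIV \<times> UNIV) (UNIV \<times> UNIV :: (int \<times> int) set)"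
    by (rule bij_betwI[of _ _ _ "\<lambda>(m, k). (m + k, m)"]) auto
  define g where "g = (\<lambda>n m. fcoeff a m * fcoeff b (n - m) * \<zeta> powi n)"
  have z0: "\<zeta> \<noteq> 0" using \<zeta> by auto
  have fg: "f ((\<lambda>(n, m). (m, n - m)) x) = (\<lambda>(n, m). g n m) x" for x
    by (cases x) (simp add: f_def g_def z0 power_int_diff)
  have g: "(\<lambda>(n, m). g n m) summable_on UNIV \<times> UNIV"
    using summable_on_reindex_bij_betw[OF bij, of f] f by (simp only: fg)
  have "series_at a \<zeta> * series_at b \<zeta> = infsum f (UNIV \<times> UNIV)"
  proof -
    have "infsum f (UNIV \<times> UNIV) = (\<Sum>\<^sub>\<infinity>m. \<Sum>\<^sub>\<infinity>k. f (m, k))"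
      using infsum_Sigma'_banach[of "\<lambda>m k. f (m, k)" UNIV "\<lambda>_. UNIV"] f by simp
    also have "\<dots> = (\<Sum>\<^sub>\<infinity>m. (fcoeff a m * \<zeta> powi m) * series_at b \<zeta>)"
      by (simp add: f_def series_at_def infsum_cmult_right')
    also have "\<dots> = series_at a \<zeta> * series_at b \<zeta>"
      by (simp add: series_at_def infsum_cmult_left')
    finally show ?thesis by simp
  qed
  also have "\<dots> = infsum (\<lambda>(n, m). g n m) (UNIV \<times> UNIV)"
    using infsum_reindex_bij_betw[OF bij, of f] by (simp only: fg)
  also have "\<dots> = (\<Sum>\<^sub>\<infinity>n. \<Sum>\<^sub>\<infinity>m. g n m)"
    using infsum_Sigma'_banach[of g UNIV "\<lambda>_. UNIV"] g by simp
  also have "\<dots> = series_at (conv a b) \<zeta>"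
    by (simp add: g_def series_at_def fcoeff_conv infsum_cmult_left')
  finally show ?thesis by simp
qed

end

section \<open>Construction of solutions\<close>

lemma bounded_bilinear_add_fun:
  assumes "bounded_bilinear f" "bounded_bilinear g"
  shows "bounded_bilinear (\<lambda>u v. f u v + g u v)"
proof -
  interpret f: bounded_bilinear f by fact
  interpret g: bounded_bilinear g by fact
  obtain K L where K: "\<And>u v. norm (f u v) \<le> norm u * norm v * K" and L: "\<And>u v. norm (g u v) \<le> norm u * norm v * L"
    using f.bounded g.bounded by metis
  show ?thesis
  proof
    show "\<exists>K. \<forall>u v. norm (f u v + g u v) \<le> norm u * norm v * K"
      using norm_triangle_mono[OF K L] by (intro exI[of _ "K + L"]) (simp add: distrib_left)
  qed (simp_all add: f.add_left f.add_right g.add_left g.add_right f.scaleR_left f.scaleR_right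
      g.scaleR_left g.scaleR_right scaleR_add_right)
qed

lemma bounded_bilinear_compose_linear:
  assumes L: "bounded_linear L" and B: "bounded_bilinear B"
  shows "bounded_bilinear (\<lambda>u v. L (B u v))"
proof -
  interpret L: bounded_linear L by fact
  interpret B: bounded_bilinear B by fact
  obtain K where K: "\<And>u v. norm (B u v) \<le> norm u * norm v * K" using B.bounded by blast
  obtain M where M: "\<And>x. norm (L x) \<le> norm x * M" "M > 0" using L.pos_bounded by blast
  have "norm (L (B u v)) \<le> norm u * norm v * (K * M)" for u v
    using order_trans[OF M(1) mult_right_mono[OF K]] M(2) by (simp add: mult.assoc)
  then show ?thesis
    by unfold_locales (auto simp: B.add_left B.add_right B.scaleR_left B.scaleR_right L.add L.scaleR)
qed

lemma bounded_bilinear_scaleR_fun: "bounded_bilinear f \<Longrightarrow> bounded_bilinear (\<lambda>u v. c *\<^sub>R f u v)"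
  by (rule bounded_bilinear_compose_linear[OF bounded_linear_scaleR_right])

lemma bounded_bilinear_minus_fun: "bounded_bilinear f \<Longrightarrow> bounded_bilinear (\<lambda>u v. - f u v)"
  by (rule bounded_bilinear_compose_linear[OF bounded_linear_minus[OF bounded_linear_ident]])

lemma bounded_bilinear_diff_fun:
  "bounded_bilinear f \<Longrightarrow> bounded_bilinear g \<Longrightarrow> bounded_bilinear (\<lambda>u v. f u v - g u v)"
  using bounded_bilinear_add_fun[OF _ bounded_bilinear_minus_fun] by force

lemma bounded_bilinear_vec:
  fixes B :: "'a::real_normed_vector \<Rightarrow> 'b::real_normed_vector \<Rightarrow> ('c::real_normed_vector)^'n"
  assumes B: "\<And>i. bounded_bilinear (\<lambda>u v. B u v $ i)"
  shows "bounded_bilinear B"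
proof -
  obtain K where K: "\<And>i u v. norm (B u v $ i) \<le> norm u * norm v * K i"
    using bounded_bilinear.bounded[OF B] by metis
  have "norm (B u v) \<le> norm u * norm v * (\<Sum>i\<in>UNIV. K i)" for u v
  proof -
    have "norm (B u v) \<le> (\<Sum>i\<in>UNIV. norm (B u v $ i))" unfolding norm_vec_def by (rule L2_set_le_sum) simp
    also have "\<dots> \<le> (\<Sum>i\<in>UNIV. norm u * norm v * K i)" by (intro sum_mono K)
    finally show ?thesis by (simp add: sum_distrib_left)
  qed
  moreover note bounded_bilinear.add_left[OF B] bounded_bilinear.add_right[OF B]
    bounded_bilinear.scaleR_left[OF B] bounded_bilinear.scaleR_right[OF B]
  ultimately show ?thesis
    by unfold_locales (auto simp: vec_eq_iff)
qed

text \<open>The factor 1/2 on the mean is what inverts real and imaginary parts: with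
  \<open>P = half_proj g\<close> one has \<open>P + cnj_series P = g\<close> if
  \<open>g = cnj_series g\<close>, and \<open>P - cnj_series P = g\<close> if
  \<open>g = - cnj_series g\<close>.\<close>

definition half_proj :: "wser \<Rightarrow> wser" where
  "half_proj = multiplier (\<lambda>n. if n > 0 then 1 else if n = 0 then 1 / 2 else 0)"

definition pos_proj :: "wser \<Rightarrow> wser" where
  "pos_proj = multiplier (\<lambda>n. if n > 0 then 1 else 0)"

lemma fcoeff_half_proj [simp]: "fcoeff (half_proj b) n = (if n > 0 then fcoeff b n else if n = 0 then fcoeff b n / 2 else 0)"
  unfolding half_proj_def by (subst fcoeff_multiplier[where K=1]) auto

lemma fcoeff_pos_proj [simp]: "fcoeff (pos_proj b) n = (if n > 0 then fcoeff b n else 0)"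
  unfolding pos_proj_def by (subst fcoeff_multiplier[where K=1]) auto

lemma bounded_linear_half_proj: "bounded_linear half_proj"
  unfolding half_proj_def by (rule bounded_linear_multiplier[where K=1]) auto

lemma bounded_linear_pos_proj: "bounded_linear pos_proj"
  unfolding pos_proj_def by (rule bounded_linear_multiplier[where K=1]) auto

text \<open>The b-part of the solution of \<open>r - cnj b + lam b = g\<close> with b in modes
  \<open>\<ge> 0\<close> and r in modes \<open>> 0\<close>. Negative modes of g determine
  \<open>- cnj b\<close>, the mean gives \<open>(lam - 1) Re b\<close> and
  \<open>(lam + 1) Im b\<close>, and the positive modes are left to r.\<close>

definition solve_twisted :: "real \<Rightarrow> wser \<Rightarrow> wser" where
  "solve_twisted lam g = of_fcoeff (\<lambda>n. if n > 0 then - cnj (fcoeff g (- n))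
      else if n = 0 then Complex (Re (fcoeff g 0) / (lam - 1)) (Im (fcoeff g 0) / (lam + 1)) else 0)"

text \<open>At an exceptional \<open>lam\<close> the convention \<open>x / 0 = 0\<close> keeps the
  bound true; that the mean equation is really solved is shown in
  \<open>linear_equations\<close>.\<close>

lemma solve_twisted_bound:
  "norm (if n > 0 then - cnj (fcoeff g (- n))
      else if n = 0 then Complex (Re (fcoeff g 0) / (lam - 1)) (Im (fcoeff g 0) / (lam + 1)) else 0) * weight n
    \<le> norm g * (1 + 1 / \<bar>lam - 1\<bar> + 1 / \<bar>lam + 1\<bar>)"
proof (cases "n = 0")
  case True
  have g: "norm (fcoeff g 0) \<le> norm g" using norm_fcoeff_weight[of g 0] by (simp add: weight_def)
  have "norm (Complex (Re (fcoeff g 0) / (lam - 1)) (Im (fcoeff g 0) / (lam + 1)))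
      \<le> \<bar>Re (fcoeff g 0) / (lam - 1)\<bar> + \<bar>Im (fcoeff g 0) / (lam + 1)\<bar>"
    using cmod_le[of "Complex (Re (fcoeff g 0) / (lam - 1)) (Im (fcoeff g 0) / (lam + 1))"] by simp
  also have "\<dots> \<le> norm g / \<bar>lam - 1\<bar> + norm g / \<bar>lam + 1\<bar>"
    unfolding abs_divide
    using abs_Re_le_cmod[of "fcoeff g 0"] abs_Im_le_cmod[of "fcoeff g 0"] g by (intro add_mono divide_right_mono) auto
  also have "\<dots> \<le> norm g * (1 + 1 / \<bar>lam - 1\<bar> + 1 / \<bar>lam + 1\<bar>)"
    by (simp add: distrib_left)
  finally show ?thesis using True by (simp add: weight_def)
next
  case False
  have "norm (if n > 0 then - cnj (fcoeff g (- n)) else 0) * weight n \<le> norm g * 1"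
    using norm_fcoeff_weight[of g "- n"] by simp
  also have "\<dots> \<le> norm g * (1 + 1 / \<bar>lam - 1\<bar> + 1 / \<bar>lam + 1\<bar>)"
    by (intro mult_left_mono) auto
  finally show ?thesis using False by (cases "n > 0") (simp_all add: mult_ac)
qed

lemma fcoeff_solve_twisted [simp]: "fcoeff (solve_twisted lam g) n = (if n > 0 then - cnj (fcoeff g (- n))
      else if n = 0 then Complex (Re (fcoeff g 0) / (lam - 1)) (Im (fcoeff g 0) / (lam + 1)) else 0)"
  unfolding solve_twisted_def by (rule fcoeff_of_fcoeff_op[OF solve_twisted_bound])

lemma bounded_linear_solve_twisted: "bounded_linear (solve_twisted lam)"
proof -
  have "bounded_linear (\<lambda>g. of_fcoeff (\<lambda>n. if n > 0 then - cnj (fcoeff g (- n))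
      else if n = 0 then Complex (Re (fcoeff g 0) / (lam - 1)) (Im (fcoeff g 0) / (lam + 1)) else 0))"
    by (rule bounded_linear_of_fcoeff[OF solve_twisted_bound]) (auto simp: complex_eq_iff add_divide_distrib)
  then show ?thesis by (simp add: solve_twisted_def[abs_def])
qed

(* Indices of the nine unknown circle functions. With a = 1 + v$IA, b = v$IB, p = 1 + v$IP, r = v$IR, the
   auxiliary ones are v$IS = a^2 - 1, v$IE = cnj a^2 b, v$IH = a cnj b, 1 + v$IG = cnj a - 2 lam a^3 cnj b^2 and
   v$ID = cnj b - lam cnj a^4 b; they make every equation quadratic. *)
datatype ix = IA | IB | IP | IR | IS | IE | IH | IG | ID

instance ix :: finite
proof
  have "UNIV = {IA, IB, IP, IR, IS, IE, IH, IG, ID}" using ix.exhaust by blast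
  then show "finite (UNIV :: ix set)" by (metis finite.emptyI finite.insertI)
qed

context
  fixes lam :: real
begin

section \<open>The quadratic system for the Fourier data\<close>

definition QN :: "wser^ix \<Rightarrow> wser^ix \<Rightarrow> wser" where
  "QN u v = conv (u$IA) (cnj_series (v$IA)) + conv (u$IB) (cnj_series (v$IB)) - lam *\<^sub>R conv (u$IE) (v$IE)"

definition QM :: "wser^ix \<Rightarrow> wser^ix \<Rightarrow> wser" where
  "QM u v = conv (u$IA) (v$IP) + 2 *\<^sub>R conv (u$IB) (v$IR)"

text \<open>On solutions this is \<open>lam ((cnj a)^4 - 1) b\<close>: with
  \<open>s = a^2 - 1\<close> and \<open>e = (cnj a)^2 b\<close> one has
  \<open>(cnj a)^4 b = (1 + cnj s) e\<close> and \<open>e = (1 + cnj s) b\<close>.\<close>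

definition QL :: "wser^ix \<Rightarrow> wser^ix \<Rightarrow> wser" where
  "QL u v = lam *\<^sub>R (conv (cnj_series (u$IS)) (v$IB) + conv (cnj_series (u$IS)) (v$IE))"

text \<open>What remains of \<open>r A = p D\<close> once the linear part
  \<open>r - cnj b + lam b\<close> stands alone, with A - 1 and D replaced by the unknowns
  \<open>IG\<close> and \<open>ID\<close>.\<close>

definition QG :: "wser^ix \<Rightarrow> wser^ix \<Rightarrow> wser" where
  "QG u v = conv (u$IP) (v$ID) - conv (u$IR) (v$IG) - QL u v"

(* QA, QB, QP, QR apply a right inverse of the linearised equations to the quadratic terms
   QN, QM, QG; adding cnj before projecting keeps the zeroth coefficient of QA real, so that
   the eight parameters are not disturbed. *)
definition QA :: "wser^ix \<Rightarrow> wser^ix \<Rightarrow> wser" where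
  "QA u v = - (1/2) *\<^sub>R half_proj (QN u v + cnj_series (QN u v))"

definition QB :: "wser^ix \<Rightarrow> wser^ix \<Rightarrow> wser" where
  "QB u v = solve_twisted lam (QG u v)"

definition QP :: "wser^ix \<Rightarrow> wser^ix \<Rightarrow> wser" where
  "QP u v = - pos_proj (QA u v) - half_proj (QM u v - cnj_series (QM u v))"

definition QR :: "wser^ix \<Rightarrow> wser^ix \<Rightarrow> wser" where
  "QR u v = pos_proj (QG u v - lam *\<^sub>R QB u v)"

text \<open>Relations such as \<open>v$IS = 2 v$IA + (v$IA)^2\<close> also contain linear terms.
  There the component is replaced by its own equation K + Q: the Q-part goes in here and the K-part
  into \<open>KT\<close>, so that \<open>QT\<close> is purely bilinear.\<close>

definition QT :: "wser^ix \<Rightarrow> wser^ix \<Rightarrow> wser^ix" where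
  "QT u v = (\<chi> i. case i of
      IA \<Rightarrow> QA u v | IB \<Rightarrow> QB u v | IP \<Rightarrow> QP u v | IR \<Rightarrow> QR u v
    | IS \<Rightarrow> 2 *\<^sub>R QA u v + conv (u$IA) (v$IA)
    | IE \<Rightarrow> QB u v + conv (cnj_series (u$IS)) (v$IB)
    | IH \<Rightarrow> cnj_series (QB u v) + conv (u$IA) (cnj_series (v$IB))
    | IG \<Rightarrow> cnj_series (QA u v) - (2 * lam) *\<^sub>R conv (u$IH) (cnj_series (v$IE))
    | ID \<Rightarrow> cnj_series (QB u v) - lam *\<^sub>R QB u v - QL u v)"

lemmas bounded_linear_cnj_series_nth = bounded_linear_compose[OF bounded_linear_cnj_series bounded_linear_vec_nth]
lemmas conv_nth_nth = bounded_bilinear.comp[OF bounded_bilinear_conv bounded_linear_vec_nth bounded_linear_vec_nth]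
lemmas conv_nth_cnj_series = bounded_bilinear.comp[OF bounded_bilinear_conv bounded_linear_vec_nth bounded_linear_cnj_series_nth]
lemmas conv_cnj_series_nth = bounded_bilinear.comp[OF bounded_bilinear_conv bounded_linear_cnj_series_nth bounded_linear_vec_nth]
lemmas bounded_bilinear_cnj_series_fun = bounded_bilinear_compose_linear[OF bounded_linear_cnj_series]

lemmas bilin_rules = bounded_bilinear_add_fun bounded_bilinear_diff_fun bounded_bilinear_scaleR_fun
  bounded_bilinear_minus_fun conv_nth_nth conv_nth_cnj_series conv_cnj_series_nth bounded_bilinear_cnj_series_fun

lemma bounded_bilinear_QN: "bounded_bilinear QN"
  unfolding QN_def[abs_def] by (intro bilin_rules)

lemma bounded_bilinear_QM: "bounded_bilinear QM"
  unfolding QM_def[abs_def] by (intro bilin_rules)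

lemma bounded_bilinear_QL: "bounded_bilinear QL"
  unfolding QL_def[abs_def] by (intro bilin_rules)

lemma bounded_bilinear_QG: "bounded_bilinear QG"
  unfolding QG_def[abs_def] by (intro bilin_rules bounded_bilinear_QL)

lemma bounded_bilinear_QA: "bounded_bilinear QA"
  unfolding QA_def[abs_def]
  by (intro bounded_bilinear_scaleR_fun bounded_bilinear_compose_linear[OF bounded_linear_half_proj]
      bounded_bilinear_add_fun bounded_bilinear_cnj_series_fun bounded_bilinear_QN)

lemma bounded_bilinear_QB: "bounded_bilinear QB"
  unfolding QB_def[abs_def]
  by (rule bounded_bilinear_compose_linear[OF bounded_linear_solve_twisted bounded_bilinear_QG])

lemma bounded_bilinear_QP: "bounded_bilinear QP"
  unfolding QP_def[abs_def]
  by (intro bounded_bilinear_diff_fun bounded_bilinear_minus_fun bounded_bilinear_cnj_series_fun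
      bounded_bilinear_compose_linear[OF bounded_linear_half_proj]
      bounded_bilinear_compose_linear[OF bounded_linear_pos_proj] bounded_bilinear_QA bounded_bilinear_QM)

lemma bounded_bilinear_QR: "bounded_bilinear QR"
  unfolding QR_def[abs_def]
  by (intro bounded_bilinear_diff_fun bounded_bilinear_scaleR_fun
      bounded_bilinear_compose_linear[OF bounded_linear_pos_proj] bounded_bilinear_QB bounded_bilinear_QG)

lemma bounded_bilinear_QT: "bounded_bilinear QT"
proof (rule bounded_bilinear_vec)
  show "bounded_bilinear (\<lambda>u v. QT u v $ i)" for i
    by (cases i; simp add: QT_def;
        intro bilin_rules bounded_bilinear_QA bounded_bilinear_QB bounded_bilinear_QP bounded_bilinear_QR bounded_bilinear_QL)
qed

(* KA, KP, KB, KR span the eight-dimensional kernel of the linearised equations. *)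
definition KA :: "real^8 \<Rightarrow> wser" where
  "KA x = single_mode (-1) (Complex (x$1) (x$2)) + single_mode 0 (\<i> * of_real (x$3)) - single_mode 1 (cnj (Complex (x$1) (x$2)))"

definition KP :: "real^8 \<Rightarrow> wser" where
  "KP x = single_mode 0 (Complex (x$4) (- x$3)) + single_mode 1 (2 * cnj (Complex (x$1) (x$2)))"

definition KB :: "real^8 \<Rightarrow> wser" where
  "KB x = single_mode (-2) (Complex (x$5) (x$6)) + single_mode (-1) (Complex (x$7) (x$8))
        + single_mode 1 (of_real lam * cnj (Complex (x$7) (x$8))) + single_mode 2 (of_real lam * cnj (Complex (x$5) (x$6)))"

definition KR :: "real^8 \<Rightarrow> wser" where
  "KR x = single_mode 1 (of_real (1 - lam^2) * cnj (Complex (x$7) (x$8)))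
        + single_mode 2 (of_real (1 - lam^2) * cnj (Complex (x$5) (x$6)))"

definition KT :: "real^8 \<Rightarrow> wser^ix" where
  "KT x = (\<chi> i. case i of
      IA \<Rightarrow> KA x | IB \<Rightarrow> KB x | IP \<Rightarrow> KP x | IR \<Rightarrow> KR x
    | IS \<Rightarrow> 2 *\<^sub>R KA x
    | IE \<Rightarrow> KB x
    | IH \<Rightarrow> cnj_series (KB x)
    | IG \<Rightarrow> cnj_series (KA x)
    | ID \<Rightarrow> cnj_series (KB x) - lam *\<^sub>R KB x)"

lemma linear_KT: "linear KT"
proof (rule linearI)
  fix x y :: "real^8" and r :: real
  have "KA (x + y) = KA x + KA y" "KP (x + y) = KP x + KP y" "KB (x + y) = KB x + KB y" "KR (x + y) = KR x + KR y"
    by (rule wser_eqI, simp add: KA_def KP_def KB_def KR_def complex_eq_iff algebra_simps)+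
  then show "KT (x + y) = KT x + KT y"
    unfolding vec_eq_iff
    by (intro allI, case_tac i) (auto simp: KT_def bounded_linear.linear[OF bounded_linear_cnj_series] linear_add
        scaleR_add_right)
  have "KA (r *\<^sub>R x) = r *\<^sub>R KA x" "KP (r *\<^sub>R x) = r *\<^sub>R KP x" "KB (r *\<^sub>R x) = r *\<^sub>R KB x" "KR (r *\<^sub>R x) = r *\<^sub>R KR x"
    by (rule wser_eqI, simp add: KA_def KP_def KB_def KR_def complex_eq_iff algebra_simps)+
  then show "KT (r *\<^sub>R x) = r *\<^sub>R KT x"
    unfolding vec_eq_iff
    by (intro allI, case_tac i) (auto simp: KT_def bounded_linear.linear[OF bounded_linear_cnj_series] linear_scale
        scaleR_diff_right)
qed

text \<open>Reverses the substitution made in \<open>QT\<close>: each K + Q is recognised as a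
  component of \<open>v\<close> again, and the defining relations of the auxiliary unknowns come
  back.\<close>

lemma quadratic_system:
  assumes v: "v = KT x + QT v v"
  shows "v$IS = 2 *\<^sub>R v$IA + conv (v$IA) (v$IA)"
    "v$IE = v$IB + conv (cnj_series (v$IS)) (v$IB)"
    "v$IH = cnj_series (v$IB) + conv (v$IA) (cnj_series (v$IB))"
    "v$IG = cnj_series (v$IA) - (2 * lam) *\<^sub>R conv (v$IH) (cnj_series (v$IE))"
    "v$ID = cnj_series (v$IB) - lam *\<^sub>R v$IB - QL v v"
    "v$IA = KA x + QA v v" "v$IB = KB x + QB v v" "v$IP = KP x + QP v v" "v$IR = KR x + QR v v"
proof -
  have *: "v $ i = KT x $ i + QT v v $ i" for i using v by (metis vector_add_component)
  note cjl = linear_add[OF bounded_linear.linear[OF bounded_linear_cnj_series]]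
  show A: "v$IA = KA x + QA v v" and B: "v$IB = KB x + QB v v"
    and "v$IP = KP x + QP v v" "v$IR = KR x + QR v v"
    using *[of IA] *[of IB] *[of IP] *[of IR] by (simp_all add: KT_def QT_def)
  show "v$IS = 2 *\<^sub>R v$IA + conv (v$IA) (v$IA)"
    using *[of IS] arg_cong[OF A, of "scaleR 2"] by (simp add: KT_def QT_def scaleR_add_right)
  show "v$IE = v$IB + conv (cnj_series (v$IS)) (v$IB)"
    using *[of IE] B by (simp add: KT_def QT_def)
  show "v$IH = cnj_series (v$IB) + conv (v$IA) (cnj_series (v$IB))"
    using *[of IH] arg_cong[OF B, of cnj_series] by (simp add: KT_def QT_def cjl)
  show "v$IG = cnj_series (v$IA) - (2 * lam) *\<^sub>R conv (v$IH) (cnj_series (v$IE))"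
    using *[of IG] arg_cong[OF A, of cnj_series] by (simp add: KT_def QT_def cjl)
  show "v$ID = cnj_series (v$IB) - lam *\<^sub>R v$IB - QL v v"
    using *[of ID] arg_cong[OF B, of cnj_series] arg_cong[OF B, of "scaleR lam"] by (simp add: KT_def QT_def cjl scaleR_add_right)
qed

text \<open>Mode by mode, \<open>KT\<close> solves the homogeneous equations and the Q-terms come
  from a right inverse. The hypotheses on \<open>lam\<close> make both denominators in the mean of b
  nonzero.\<close>

lemma linear_equations:
  assumes v: "v = KT x + QT v v" and lam: "lam \<noteq> 1" "lam \<ge> 0"
  shows "v$IA + cnj_series (v$IA) = - (1/2) *\<^sub>R (QN v v + cnj_series (QN v v))"
    "v$IA + v$IP - cnj_series (v$IA + v$IP) = cnj_series (QM v v) - QM v v"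
    "v$IR - cnj_series (v$IB) + lam *\<^sub>R v$IB = QG v v"
proof -
  note e = quadratic_system(6-9)[OF v]
  have [simp]: "- n = 2 \<longleftrightarrow> n = -2" for n :: int by auto
  have nz: "1 + (lam * lam + lam * 2) > 0" using lam by (intro add_pos_nonneg) auto
  show "v$IA + cnj_series (v$IA) = - (1/2) *\<^sub>R (QN v v + cnj_series (QN v v))"
    unfolding e(1) QA_def by (rule wser_eqI) (auto simp: KA_def complex_eq_iff diff_divide_distrib)
  \<comment> \<open>In the homogeneous part, let c be the mode -1 of a. The mode 1 of a + p must be
    \<open>cnj c\<close>; since a contributes \<open>- cnj c\<close>, \<open>KP\<close> contributes
    \<open>2 cnj c\<close>.\<close>
  show "v$IA + v$IP - cnj_series (v$IA + v$IP) = cnj_series (QM v v) - QM v v"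
    unfolding e(1) e(3) QP_def QA_def by (rule wser_eqI) (auto simp: KA_def KP_def complex_eq_iff)
  \<comment> \<open>In modes -2 and -1 the homogeneous equation forces
    \<open>b_n = lam cnj b_(-n)\<close> for n = 1, 2, and modes 1 and 2 then give
    \<open>r_n = (1 - lam^2) cnj b_(-n)\<close>: these are the coefficients of \<open>KB\<close> and
    \<open>KR\<close>.\<close>
  show "v$IR - cnj_series (v$IB) + lam *\<^sub>R v$IB = QG v v"
    unfolding e(2) e(4) QB_def QR_def using lam nz
    by (intro wser_eqI) (auto simp: KB_def KR_def complex_eq_iff power2_eq_square field_simps)
qed

text \<open>The Q-terms live in nonnegative modes and do not touch the prescribed real or imaginary
  parts of the means, so \<open>x\<close> is read off from the solution. The vanishing of the lower
  modes is what makes zeta a, zeta^2 b, p and r / zeta holomorphic in the disc.\<close>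

lemma coefficient_data:
  assumes v: "v = KT x + QT v v"
  shows "n < -1 \<Longrightarrow> fcoeff (v$IA) n = 0" "n < -2 \<Longrightarrow> fcoeff (v$IB) n = 0"
    "n < 0 \<Longrightarrow> fcoeff (v$IP) n = 0" "n < 1 \<Longrightarrow> fcoeff (v$IR) n = 0"
    "fcoeff (v$IA) (-1) = Complex (x$1) (x$2)" "Im (fcoeff (v$IA) 0) = x$3" "Re (fcoeff (v$IP) 0) = x$4"
    "fcoeff (v$IB) (-2) = Complex (x$5) (x$6)" "fcoeff (v$IB) (-1) = Complex (x$7) (x$8)"
  unfolding quadratic_system(6-9)[OF v] QA_def QB_def QP_def QR_def
  by (auto simp: KA_def KB_def KP_def KR_def complex_eq_iff)

text \<open>Evaluation turns \<open>conv\<close> and \<open>cnj_series\<close> into product and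
  conjugation; eliminating the auxiliary values restores the equations of higher degree.\<close>

lemma circle_equations:
  fixes \<zeta> a b p r :: complex
  assumes v: "v = KT x + QT v v" and lam: "lam \<noteq> 1" "lam \<ge> 0" and \<zeta>: "norm \<zeta> = 1"
  defines "a \<equiv> 1 + series_at (v$IA) \<zeta>" and "b \<equiv> series_at (v$IB) \<zeta>" and "p \<equiv> 1 + series_at (v$IP) \<zeta>" and "r \<equiv> series_at (v$IR) \<zeta>"
  shows "(cmod a)^2 + (cmod b)^2 - lam * Re ((cnj a)^4 * b^2) = 1"
    "Im (a * p + 2 * b * r) = 0"
    "r * (cnj a - 2 * lam * a^3 * (cnj b)^2) = p * (cnj b - lam * (cnj a)^4 * b)"
proof -
  note series_at_simps = series_at_add[OF \<zeta>] series_at_diff[OF \<zeta>] series_at_minus[OF \<zeta>] series_at_scaleR[OF \<zeta>] series_at_cnj_series[OF \<zeta>] series_at_conv[OF \<zeta>]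
  define a' p' s e h A D where d: "a' = series_at (v$IA) \<zeta>" "p' = series_at (v$IP) \<zeta>" "s = series_at (v$IS) \<zeta>"
    "e = series_at (v$IE) \<zeta>" "h = series_at (v$IH) \<zeta>" "A = series_at (v$IG) \<zeta>" "D = series_at (v$ID) \<zeta>"
  note dd = d b_def r_def
  note q = quadratic_system[OF v] and l = linear_equations[OF v lam]
  have s: "s = 2 * a' + a' * a'"
    using arg_cong[OF q(1), of "\<lambda>w. series_at w \<zeta>"] by (simp add: series_at_simps scaleR_conv_of_real flip: dd)
  have e: "e = b + cnj s * b"
    using arg_cong[OF q(2), of "\<lambda>w. series_at w \<zeta>"] by (simp add: series_at_simps scaleR_conv_of_real flip: dd)
  have h: "h = cnj b + a' * cnj b"
    using arg_cong[OF q(3), of "\<lambda>w. series_at w \<zeta>"] by (simp add: series_at_simps scaleR_conv_of_real flip: dd)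
  have A: "A = cnj a' - 2 * lam * (h * cnj e)"
    using arg_cong[OF q(4), of "\<lambda>w. series_at w \<zeta>"] by (simp add: series_at_simps scaleR_conv_of_real flip: dd)
  have D: "D = cnj b - lam * b - lam * (cnj s * b + cnj s * e)"
    using arg_cong[OF q(5), of "\<lambda>w. series_at w \<zeta>"] by (simp add: series_at_simps QL_def scaleR_conv_of_real flip: dd)
  have 1: "a' + cnj a' = - (1/2) * ((a' * cnj a' + b * cnj b - lam * (e * e)) + cnj (a' * cnj a' + b * cnj b - lam * (e * e)))"
    using arg_cong[OF l(1), of "\<lambda>w. series_at w \<zeta>"] by (simp add: series_at_simps QN_def scaleR_conv_of_real flip: dd)
  have 2: "a' + p' - cnj (a' + p') = cnj (a' * p' + 2 * (b * r)) - (a' * p' + 2 * (b * r))"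
    using arg_cong[OF l(2), of "\<lambda>w. series_at w \<zeta>"] by (simp add: series_at_simps QM_def scaleR_conv_of_real flip: dd)
  have 3: "r - cnj b + lam * b = p' * D - r * A - lam * (cnj s * b + cnj s * e)"
    using arg_cong[OF l(3), of "\<lambda>w. series_at w \<zeta>"] by (simp add: series_at_simps QG_def QL_def scaleR_conv_of_real flip: dd)
  have a: "a = 1 + a'" and p: "p = 1 + p'" by (simp_all add: a_def p_def d)
  have sa: "s + 1 = a^2" by (simp add: s a power2_eq_square algebra_simps)
  have sa': "cnj s + 1 = (cnj a)^2" using arg_cong[OF sa, of cnj] by simp
  have e': "e = (cnj a)^2 * b"
  proof -
    have "e = (cnj s + 1) * b" by (simp add: e algebra_simps)
    then show ?thesis by (simp only: sa')
  qed
  have h': "h = a * cnj b" by (simp add: h a algebra_simps)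
  have A': "1 + A = cnj a - 2 * lam * a^3 * (cnj b)^2"
  proof -
    have "1 + A = cnj a - 2 * lam * (h * cnj e)" by (simp add: A a)
    then show ?thesis by (simp add: h' e' power2_eq_square power3_eq_cube)
  qed
  have D': "D = cnj b - lam * (cnj a)^4 * b"
  proof -
    have "D = cnj b - lam * ((cnj s + 1) * e)" by (simp add: D e algebra_simps)
    then show ?thesis by (simp add: sa' e' power4_eq_xxxx power2_eq_square)
  qed
  have "r * (1 + A) = (1 + p') * D" using 3 by (simp add: D algebra_simps)
  then show "r * (cnj a - 2 * lam * a^3 * (cnj b)^2) = p * (cnj b - lam * (cnj a)^4 * b)"
    by (simp only: A' D' p)
  have "Im (a' + p' - cnj (a' + p')) = Im (cnj (a' * p' + 2 * (b * r)) - (a' * p' + 2 * (b * r)))"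
    using 2 by simp
  then show "Im (a * p + 2 * b * r) = 0"
    by (simp add: a p algebra_simps)
  have ee: "e * e = (cnj a)^4 * b^2" by (simp add: e' power4_eq_xxxx power2_eq_square)
  have "Re (a' + cnj a') = Re (- (1/2) * ((a' * cnj a' + b * cnj b - lam * (e * e)) + cnj (a' * cnj a' + b * cnj b - lam * (e * e))))"
    using 1 by simp
  then have "2 * Re a' = - ((cmod a')^2 + (cmod b)^2 - lam * Re (e * e))"
    unfolding cmod_power2 by (simp add: power2_eq_square field_simps)
  moreover have "(cmod a)^2 = 1 + 2 * Re a' + (cmod a')^2"
    unfolding cmod_power2 by (simp add: a power2_eq_square algebra_simps)
  ultimately show "(cmod a)^2 + (cmod b)^2 - lam * Re ((cnj a)^4 * b^2) = 1"
    by (simp only: ee)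
qed

end

section \<open>Uniqueness of solutions with given parameters\<close>

definition disc_alg :: "(complex \<Rightarrow> complex) \<Rightarrow> bool" where
  "disc_alg f \<longleftrightarrow> continuous_on (cball 0 1) f \<and> f holomorphic_on ball 0 1"

lemma disc_alg_add: "disc_alg f \<Longrightarrow> disc_alg g \<Longrightarrow> disc_alg (\<lambda>z. f z + g z)"
  and disc_alg_diff: "disc_alg f \<Longrightarrow> disc_alg g \<Longrightarrow> disc_alg (\<lambda>z. f z - g z)"
  and disc_alg_mult: "disc_alg f \<Longrightarrow> disc_alg g \<Longrightarrow> disc_alg (\<lambda>z. f z * g z)"
  and disc_alg_const: "disc_alg (\<lambda>z. c)"
  and disc_alg_id: "disc_alg (\<lambda>z. z)"
  by (auto simp: disc_alg_def intro!: continuous_intros holomorphic_intros)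

lemma disc_alg_continuous_sphere: "disc_alg f \<Longrightarrow> continuous_on (sphere 0 1) f"
  by (auto simp: disc_alg_def intro: continuous_on_subset)

text \<open>Removable singularity. Dividing a difference of discs passes from z to a and, done
  twice, from w to b; the value at 0 records the next Taylor coefficient.\<close>

lemma disc_alg_divide:
  assumes f: "disc_alg f" and "f 0 = 0"
  obtains g where "disc_alg g" "\<And>z. z \<in> cball 0 1 \<Longrightarrow> f z = z * g z" "g 0 = deriv f 0"
proof -
  define g where "g z = (if z = 0 then deriv f 0 else f z / z)" for z
  have hol: "g holomorphic_on ball 0 1"
    using pole_theorem_0[of f "ball 0 1" 0 g] f \<open>f 0 = 0\<close>
    by (simp add: disc_alg_def g_def pole_lemma)
  have "continuous (at z within cball 0 1) g" if z: "z \<in> cball 0 1" for z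
  proof (cases "z = 0")
    case True
    have "continuous (at z) g"
      using holomorphic_on_imp_continuous_on[OF hol] True by (simp add: continuous_on_eq_continuous_at)
    then show ?thesis by (rule continuous_at_imp_continuous_at_within)
  next
    case False
    have "continuous (at z within cball 0 1) (\<lambda>z. f z / z)"
      using f z False by (intro continuous_intros) (auto simp: disc_alg_def continuous_on_eq_continuous_within)
    then show ?thesis
      by (rule continuous_transform_within[where \<delta>="norm z"]) (use False z in \<open>auto simp: g_def\<close>)
  qed
  then have "disc_alg g" using hol by (simp add: disc_alg_def continuous_on_eq_continuous_within)
  then show ?thesis using that[of g] \<open>f 0 = 0\<close> by (auto simp: g_def)
qed

definition circle_pt :: "real \<Rightarrow> complex" where
  "circle_pt t = exp (2 * of_real pi * \<i> * of_real t)"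

definition circle_mean :: "(complex \<Rightarrow> 'a::euclidean_space) \<Rightarrow> 'a" where
  "circle_mean f = integral {0..1} (\<lambda>t. f (circle_pt t))"

lemma norm_circle_pt [simp]: "cmod (circle_pt t) = 1"
  by (simp add: circle_pt_def norm_exp_eq_Re)

lemma continuous_on_circle_pt: "continuous_on S circle_pt"
  unfolding circle_pt_def[abs_def] by (intro continuous_intros)

lemma circle_pt_surj: "\<zeta> \<in> sphere 0 1 \<Longrightarrow> \<exists>t\<in>{0..1}. \<zeta> = circle_pt t"
proof -
  assume "\<zeta> \<in> sphere 0 1"
  then have "\<zeta> \<in> path_image (circlepath 0 1)" by simp
  then show ?thesis by (auto simp: path_image_def circlepath circle_pt_def)
qed

lemma continuous_on_circle_pt_compose: "continuous_on (sphere 0 1) f \<Longrightarrow> continuous_on S (\<lambda>t. f (circle_pt t))"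
  by (rule continuous_on_compose2[OF _ continuous_on_circle_pt]) auto

context
  fixes f g :: "complex \<Rightarrow> 'a::euclidean_space"
  assumes f: "continuous_on (sphere 0 1) f" and g: "continuous_on (sphere 0 1) g"
begin

lemma circle_mean_add: "circle_mean (\<lambda>z. f z + g z) = circle_mean f + circle_mean g"
  and circle_mean_diff: "circle_mean (\<lambda>z. f z - g z) = circle_mean f - circle_mean g"
  unfolding circle_mean_def
  using integrable_continuous_interval[OF continuous_on_circle_pt_compose[OF f]]
    integrable_continuous_interval[OF continuous_on_circle_pt_compose[OF g]]
  by (auto intro: Henstock_Kurzweil_Integration.integral_add Henstock_Kurzweil_Integration.integral_diff)

end

lemma circle_mean_linear:
  fixes f :: "complex \<Rightarrow> 'a::euclidean_space" and L :: "'a \<Rightarrow> 'b::euclidean_space"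
  assumes f: "continuous_on (sphere 0 1) f" and L: "bounded_linear L"
  shows "circle_mean (\<lambda>z. L (f z)) = L (circle_mean f)"
  unfolding circle_mean_def
  using integral_linear[OF integrable_continuous_interval[OF continuous_on_circle_pt_compose[OF f]] L]
  by (simp add: o_def)

lemma circle_mean_const [simp]: "circle_mean (\<lambda>z. c) = c"
  by (simp add: circle_mean_def)

lemma circle_mean_cong: "(\<And>z. z \<in> sphere 0 1 \<Longrightarrow> f z = g z) \<Longrightarrow> circle_mean f = circle_mean g"
  unfolding circle_mean_def by (rule integral_cong) simp

lemma circle_mean_mono:
  fixes f g :: "complex \<Rightarrow> real"
  assumes "continuous_on (sphere 0 1) f" "continuous_on (sphere 0 1) g" "\<And>z. z \<in> sphere 0 1 \<Longrightarrow> f z \<le> g z"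
  shows "circle_mean f \<le> circle_mean g"
  unfolding circle_mean_def using assms
  by (intro integral_le integrable_continuous_interval continuous_on_circle_pt_compose) simp_all

lemma circle_mean_zero:
  fixes f :: "complex \<Rightarrow> real"
  assumes f: "continuous_on (sphere 0 1) f" "\<And>z. z \<in> sphere 0 1 \<Longrightarrow> f z \<ge> 0" and "circle_mean f \<le> 0" "\<zeta> \<in> sphere 0 1"
  shows "f \<zeta> = 0"
proof -
  have nn: "circle_mean f \<ge> 0" using circle_mean_mono[of "\<lambda>_. 0" f] f by simp
  obtain t where t: "t \<in> {0..1}" "\<zeta> = circle_pt t" using circle_pt_surj assms(4) by blast
  have "(\<forall>t\<in>cbox 0 1. f (circle_pt t) = 0)"
    using integral_eq_0_iff[of 0 1 "\<lambda>t. f (circle_pt t)"] continuous_on_circle_pt_compose[OF f(1)] f(2) nn assms(3)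
    by (auto simp: circle_mean_def)
  then show ?thesis using t by simp
qed

lemma mean_value:
  assumes "disc_alg H"
  shows "circle_mean H = H 0"
proof -
  have "((\<lambda>u. H u / (u - 0)) has_contour_integral (2 * of_real pi * \<i> * H 0)) (circlepath 0 1)"
    by (rule Cauchy_integral_circlepath) (use assms in \<open>auto simp: disc_alg_def\<close>)
  then have "((\<lambda>t. H (circle_pt t) / circle_pt t * (2 * of_real pi * \<i> * circle_pt t)) has_integral (2 * of_real pi * \<i> * H 0)) {0..1}"
    unfolding has_contour_integral_def
    by (rule has_integral_eq[rotated]) (simp add: vector_derivative_circlepath01, simp add: circlepath circle_pt_def)
  then have "((\<lambda>t. (1 / (2 * of_real pi * \<i>)) * (H (circle_pt t) / circle_pt t * (2 * of_real pi * \<i> * circle_pt t))) has_integral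
      ((1 / (2 * of_real pi * \<i>)) * (2 * of_real pi * \<i> * H 0))) {0..1}"
    by (rule has_integral_mult_right)
  then have "((\<lambda>t. H (circle_pt t)) has_integral H 0) {0..1}"
    by (simp add: circle_pt_def)
  then show ?thesis by (simp add: circle_mean_def integral_unique)
qed

lemma circle_mean_Re:
  assumes "continuous_on (sphere 0 1) f"
  shows "circle_mean (\<lambda>z. Re (f z)) = Re (circle_mean f)"
  using circle_mean_linear[OF assms bounded_linear_Re] .

lemma circle_mean_cmult:
  fixes f :: "complex \<Rightarrow> real"
  assumes "continuous_on (sphere 0 1) f"
  shows "circle_mean (\<lambda>z. c * f z) = c * circle_mean f"
  using circle_mean_linear[OF assms bounded_linear_mult_right] .

text \<open>Expand the mean of \<open>|m - m 0|^2\<close>, which is nonnegative; the cross term is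
  evaluated by the mean value property.\<close>

lemma norm_value_le_circle_mean:
  assumes m: "disc_alg m"
  shows "(cmod (m 0))^2 \<le> circle_mean (\<lambda>z. (cmod (m z))^2)"
proof -
  note c = disc_alg_continuous_sphere[OF m]
  have cc: "continuous_on (sphere 0 1) (\<lambda>z. 2 * Re (cnj (m 0) * m z))"
    "continuous_on (sphere 0 1) (\<lambda>z. (cmod (m z))^2)" "continuous_on (sphere 0 1) (\<lambda>z. cnj (m 0) * m z)"
    by (intro continuous_intros c)+
  have m': "circle_mean (\<lambda>z. cnj (m 0) * m z) = cnj (m 0) * m 0"
    by (rule mean_value) (intro disc_alg_mult disc_alg_const m)
  have "0 \<le> circle_mean (\<lambda>z. (cmod (m z - m 0))^2)"
    using circle_mean_mono[of "\<lambda>_. 0" "\<lambda>z. (cmod (m z - m 0))^2"] by (simp add: continuous_intros c)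
  also have "(\<lambda>z. (cmod (m z - m 0))^2) = (\<lambda>z. (cmod (m z))^2 - 2 * Re (cnj (m 0) * m z) + (cmod (m 0))^2)"
    unfolding cmod_power2 by (auto simp: power2_eq_square algebra_simps)
  also have "circle_mean \<dots> = circle_mean (\<lambda>z. (cmod (m z))^2) - 2 * Re (cnj (m 0) * m 0) + (cmod (m 0))^2"
    using cc by (simp add: circle_mean_add circle_mean_diff continuous_on_diff circle_mean_cmult circle_mean_Re m' continuous_on_Re del: times_complex.sel)
  also have "\<dots> = circle_mean (\<lambda>z. (cmod (m z))^2) - (cmod (m 0))^2"
    unfolding cmod_power2 by (simp add: power2_eq_square)
  finally show ?thesis by simp
qed

text \<open>\<open>Re (h^2) = 2 (Re h)^2 - |h|^2\<close> has mean \<open>Re ((h 0)^2)\<close>, which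
  is nonnegative because \<open>h 0\<close> is real. This is the L^2 bound for the conjugate
  function.\<close>

lemma circle_mean_norm_le_Re:
  assumes h: "disc_alg h" and "Im (h 0) = 0"
  shows "circle_mean (\<lambda>z. (cmod (h z))^2) \<le> 2 * circle_mean (\<lambda>z. (Re (h z))^2)"
proof -
  note c = disc_alg_continuous_sphere[OF h]
  have cc: "continuous_on (sphere 0 1) (\<lambda>z. (Re (h z))^2)" "continuous_on (sphere 0 1) (\<lambda>z. h z * h z)"
    "continuous_on (sphere 0 1) (\<lambda>z. (cmod (h z))^2)"
    by (intro continuous_intros c)+
  have "0 \<le> Re (h 0 * h 0)" using assms(2) by simp
  also have "\<dots> = Re (circle_mean (\<lambda>z. h z * h z))"
    using mean_value[OF disc_alg_mult[OF h h]] by simp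
  also have "\<dots> = circle_mean (\<lambda>z. Re (h z * h z))" by (simp only: circle_mean_Re[OF cc(2)])
  also have "(\<lambda>z. Re (h z * h z)) = (\<lambda>z. 2 * (Re (h z))^2 - (cmod (h z))^2)"
    unfolding cmod_power2 by (auto simp: power2_eq_square)
  also have "circle_mean \<dots> = 2 * circle_mean (\<lambda>z. (Re (h z))^2) - circle_mean (\<lambda>z. (cmod (h z))^2)"
    using cc by (simp add: circle_mean_diff continuous_on_mult_left circle_mean_cmult)
  finally show ?thesis by simp
qed

(* The mean of |m - cnj k|^2 differs from that of |m|^2 + |k|^2 only by 2 Re (m 0 * k 0), which is controlled
   by the values at 0; for lam = 1 a real constant m = k gives m - cnj k = 0. *)
lemma circle_mean_antilinear_bound:
  assumes k: "disc_alg k" and m: "disc_alg m" and "m 0 = of_real lam * k 0" and lam: "lam \<ge> 0" "lam \<noteq> 1"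
  shows "(1 - lam)^2 * circle_mean (\<lambda>z. (cmod (m z))^2 + (cmod (k z))^2)
    \<le> (1 + lam^2) * circle_mean (\<lambda>z. (cmod (m z - cnj (k z)))^2)"
proof -
  note c = disc_alg_continuous_sphere[OF k] disc_alg_continuous_sphere[OF m]
  define M where "M = circle_mean (\<lambda>z. (cmod (m z))^2)"
  define K where "K = circle_mean (\<lambda>z. (cmod (k z))^2)"
  have cc: "continuous_on (sphere 0 1) (\<lambda>z. (cmod (m z))^2)" "continuous_on (sphere 0 1) (\<lambda>z. (cmod (k z))^2)"
    "continuous_on (sphere 0 1) (\<lambda>z. m z * k z)"
    by (intro continuous_intros c)+
  have of_fcoeff: "circle_mean (\<lambda>z. m z * k z) = m 0 * k 0"
    by (rule mean_value) (intro disc_alg_mult m k)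
  have MK: "circle_mean (\<lambda>z. (cmod (m z))^2 + (cmod (k z))^2) = M + K"
    by (simp add: M_def K_def circle_mean_add cc)
  have "(\<lambda>z. (cmod (m z - cnj (k z)))^2) = (\<lambda>z. ((cmod (m z))^2 + (cmod (k z))^2) - 2 * Re (m z * k z))"
    unfolding cmod_power2 by (auto simp: power2_eq_square algebra_simps)
  then have G: "circle_mean (\<lambda>z. (cmod (m z - cnj (k z)))^2) = M + K - 2 * Re (m 0 * k 0)"
    using cc by (simp add: circle_mean_diff circle_mean_cmult circle_mean_Re continuous_on_add continuous_on_mult_left
        continuous_on_Re of_fcoeff MK del: times_complex.sel)
  define x where "x = (cmod (k 0))^2"
  have M0: "M \<ge> lam^2 * x" and K0: "K \<ge> x"
    using norm_value_le_circle_mean[OF m] norm_value_le_circle_mean[OF k] assms(3)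
    by (auto simp: M_def K_def x_def norm_mult power_mult_distrib)
  have "Re (m 0 * k 0) \<le> cmod (m 0 * k 0)" by (rule complex_Re_le_cmod)
  also have "\<dots> = lam * x" using assms(3) lam by (simp add: norm_mult x_def power2_eq_square)
  finally have R: "Re (m 0 * k 0) \<le> lam * x" .
  have "(1 - lam)^2 * (M + K) \<le> (1 + lam^2) * (M + K - 2 * (lam * x))"
  proof -
    \<comment> \<open>The surplus is nonnegative because the means \<open>M\<close> and
      \<open>K\<close> dominate the squared values at 0, namely \<open>lam^2 * x\<close> and
      \<open>x\<close>.\<close>
    have "(1 + lam^2) * (M + K - 2 * (lam * x)) - (1 - lam)^2 * (M + K) = 2 * lam * (M + K - (1 + lam^2) * x)"
      by (simp add: power2_eq_square algebra_simps)
    also have "\<dots> \<ge> 0" using M0 K0 lam by (intro mult_nonneg_nonneg) (auto simp: algebra_simps)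
    finally show ?thesis by simp
  qed
  also have "\<dots> \<le> (1 + lam^2) * (M + K - 2 * Re (m 0 * k 0))"
    using R by (intro mult_left_mono) auto
  finally show ?thesis by (simp only: G MK)
qed

(* The Lipschitz constant tends to 0 at the origin. *)
definition flat_at_0 :: "('v::real_normed_vector \<Rightarrow> complex) \<Rightarrow> bool" where
  "flat_at_0 f \<longleftrightarrow> (\<forall>e>0. \<exists>d>0. \<forall>u v. norm u < d \<and> norm v < d \<longrightarrow> norm (f u - f v) \<le> e * norm (u - v))"

text \<open>Functions of first order at 0. A product of two of them is flat, which is how all
  nonlinear terms are treated.\<close>

definition lipschitz_at_0 :: "('v::real_normed_vector \<Rightarrow> complex) \<Rightarrow> bool" where
  "lipschitz_at_0 f \<longleftrightarrow> f 0 = 0 \<and> (\<exists>C d. C > 0 \<and> d > 0 \<and> (\<forall>u v. norm u < d \<and> norm v < d \<longrightarrow> norm (f u - f v) \<le> C * norm (u - v)))"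

lemma lipschitz_at_0I:
  "f 0 = 0 \<Longrightarrow> C > 0 \<Longrightarrow> d > 0 \<Longrightarrow> (\<And>u v. norm u < d \<Longrightarrow> norm v < d \<Longrightarrow> norm (f u - f v) \<le> C * norm (u - v))
    \<Longrightarrow> lipschitz_at_0 f"
  unfolding lipschitz_at_0_def by blast

lemma lipschitz_at_0_bounded_linear:
  assumes "bounded_linear f"
  shows "lipschitz_at_0 f"
proof -
  obtain K where K: "K > 0" "\<And>x. norm (f x) \<le> norm x * K" using bounded_linear.pos_bounded[OF assms] by blast
  then show ?thesis
    using bounded_linear.linear[OF assms]
    by (intro lipschitz_at_0I[of f K 1]) (auto simp: linear_0 linear_diff[symmetric] mult.commute)
qed

lemma lipschitz_at_0_add: assumes "lipschitz_at_0 f" "lipschitz_at_0 g" shows "lipschitz_at_0 (\<lambda>x. f x + g x)"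
proof -
  obtain C d C' d' where C: "C > 0" "d > 0" "\<And>u v. norm u < d \<Longrightarrow> norm v < d \<Longrightarrow> norm (f u - f v) \<le> C * norm (u - v)"
    "C' > 0" "d' > 0" "\<And>u v. norm u < d' \<Longrightarrow> norm v < d' \<Longrightarrow> norm (g u - g v) \<le> C' * norm (u - v)"
    using assms unfolding lipschitz_at_0_def by metis
  have "norm (f u + g u - (f v + g v)) \<le> (C + C') * norm (u - v)" if "norm u < min d d'" "norm v < min d d'" for u v
    using C(3)[of u v] C(6)[of u v] that norm_triangle_ineq[of "f u - f v" "g u - g v"]
    by (simp add: algebra_simps)
  then show ?thesis using assms C
    by (intro lipschitz_at_0I[of _ "C + C'" "min d d'"]) (auto simp: lipschitz_at_0_def)
qed

lemma flat_at_0_add: assumes "flat_at_0 f" "flat_at_0 g" shows "flat_at_0 (\<lambda>x. f x + g x)"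
  unfolding flat_at_0_def
proof (intro allI impI)
  fix e :: real assume e: "e > 0"
  obtain d d' where d: "d > 0" "\<And>u v. norm u < d \<Longrightarrow> norm v < d \<Longrightarrow> norm (f u - f v) \<le> e/2 * norm (u - v)"
    "d' > 0" "\<And>u v. norm u < d' \<Longrightarrow> norm v < d' \<Longrightarrow> norm (g u - g v) \<le> e/2 * norm (u - v)"
    using assms e unfolding flat_at_0_def by (metis half_gt_zero)
  have "norm (f u + g u - (f v + g v)) \<le> e * norm (u - v)" if "norm u < min d d'" "norm v < min d d'" for u v
    using d(2)[of u v] d(4)[of u v] that norm_triangle_ineq[of "f u - f v" "g u - g v"]
    by (simp add: algebra_simps)
  then show "\<exists>d>0. \<forall>u v. norm u < d \<and> norm v < d \<longrightarrow> norm (f u + g u - (f v + g v)) \<le> e * norm (u - v)"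
    using d by (intro exI[of _ "min d d'"]) auto
qed

lemma flat_at_0_mult: assumes f: "lipschitz_at_0 f" and g: "lipschitz_at_0 g" shows "flat_at_0 (\<lambda>x. f x * g x)"
  unfolding flat_at_0_def
proof (intro allI impI)
  fix e :: real assume e: "e > 0"
  obtain C d C' d' where C: "C > 0" "d > 0" "\<And>u v. norm u < d \<Longrightarrow> norm v < d \<Longrightarrow> norm (f u - f v) \<le> C * norm (u - v)"
    "C' > 0" "d' > 0" "\<And>u v. norm u < d' \<Longrightarrow> norm v < d' \<Longrightarrow> norm (g u - g v) \<le> C' * norm (u - v)"
    using f g unfolding lipschitz_at_0_def by metis
  \<comment> \<open>With \<open>e / (2 * C * C')\<close> each of the two terms in the difference of
    products receives half of \<open>e\<close>.\<close>
  define \<delta> where "\<delta> = min (min d d') (e / (2 * C * C'))"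
  have \<delta>: "\<delta> > 0" using C e by (simp add: \<delta>_def)
  have "norm (f u * g u - f v * g v) \<le> e * norm (u - v)" if uv: "norm u < \<delta>" "norm v < \<delta>" for u v
  proof -
    have 1: "norm (f u - f v) \<le> C * norm (u - v)" "norm (g u - g v) \<le> C' * norm (u - v)"
      using C(3,6) uv by (auto simp: \<delta>_def)
    have "norm (f u - f 0) \<le> C * norm (u - 0)" "norm (g v - g 0) \<le> C' * norm (v - 0)"
      using C uv by (intro C; simp add: \<delta>_def)+
    then have "norm (f u) \<le> C * \<delta>" "norm (g v) \<le> C' * \<delta>"
      using f g C uv by (auto simp: lipschitz_at_0_def intro: order_trans mult_left_mono less_imp_le)
    moreover have "C * \<delta> \<le> e / (2 * C')" "C' * \<delta> \<le> e / (2 * C)"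
    proof -
      have "\<delta> \<le> e / (2 * C * C')" by (simp add: \<delta>_def)
      then show "C * \<delta> \<le> e / (2 * C')" "C' * \<delta> \<le> e / (2 * C)" using C by (simp_all add: field_simps)
    qed
    ultimately have 2: "norm (f u) \<le> e / (2 * C')" "norm (g v) \<le> e / (2 * C)" by linarith+
    have "f u * g u - f v * g v = f u * (g u - g v) + (f u - f v) * g v" by (simp add: algebra_simps)
    then have "norm (f u * g u - f v * g v) \<le> norm (f u) * norm (g u - g v) + norm (f u - f v) * norm (g v)"
      by (metis norm_mult norm_triangle_ineq)
    also have "\<dots> \<le> e / (2 * C') * (C' * norm (u - v)) + C * norm (u - v) * (e / (2 * C))"
      using 1 2 e C by (intro add_mono mult_mono) auto
    also have "\<dots> = e * norm (u - v)" using C by (simp add: field_simps)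
    finally show ?thesis .
  qed
  then show "\<exists>d>0. \<forall>u v. norm u < d \<and> norm v < d \<longrightarrow> norm (f u * g u - f v * g v) \<le> e * norm (u - v)"
    using \<delta> by blast
qed

lemma lipschitz_at_0_flat_at_0: assumes "flat_at_0 f" "f 0 = 0" shows "lipschitz_at_0 f"
proof -
  obtain d where d: "d > 0" "\<And>u v. norm u < d \<and> norm v < d \<longrightarrow> norm (f u - f v) \<le> 1 * norm (u - v)"
    using assms(1) unfolding flat_at_0_def by (meson zero_less_one)
  then show ?thesis unfolding lipschitz_at_0_def
    by (intro conjI assms(2) exI[of _ 1] exI[of _ d] allI) (auto simp: d)
qed

lemma lipschitz_at_0_mult: "lipschitz_at_0 f \<Longrightarrow> lipschitz_at_0 g \<Longrightarrow> lipschitz_at_0 (\<lambda>x. f x * g x)"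
  by (rule lipschitz_at_0_flat_at_0[OF flat_at_0_mult]) (auto simp: lipschitz_at_0_def)

lemma lipschitz_at_0_cmult: "lipschitz_at_0 f \<Longrightarrow> lipschitz_at_0 (\<lambda>x. c * f x)"
proof -
  assume f: "lipschitz_at_0 f"
  obtain C d where C: "C > 0" "d > 0" "\<And>u v. norm u < d \<Longrightarrow> norm v < d \<Longrightarrow> norm (f u - f v) \<le> C * norm (u - v)"
    using f unfolding lipschitz_at_0_def by metis
  have "norm (c * f u - c * f v) \<le> ((norm c + 1) * C) * norm (u - v)" if "norm u < d" "norm v < d" for u v
  proof -
    have "norm (c * f u - c * f v) = norm c * norm (f u - f v)" by (simp add: norm_mult flip: right_diff_distrib)
    also have "\<dots> \<le> (norm c + 1) * (C * norm (u - v))" using C that by (intro mult_mono) auto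
    finally show ?thesis by simp
  qed
  then show ?thesis using f C
    by (intro lipschitz_at_0I[of _ "(norm c + 1) * C" d]) (auto simp: lipschitz_at_0_def add_nonneg_pos)
qed

lemma flat_at_0_cmult: "flat_at_0 f \<Longrightarrow> flat_at_0 (\<lambda>x. c * f x)"
  unfolding flat_at_0_def
proof (intro allI impI)
  fix e :: real assume e: "e > 0" and f: "\<forall>e>0. \<exists>d>0. \<forall>u v. norm u < d \<and> norm v < d \<longrightarrow> norm (f u - f v) \<le> e * norm (u - v)"
  have "e / (norm c + 1) > 0" using e by (simp add: add_nonneg_pos)
  with f obtain d where d: "d > 0" "\<And>u v. norm u < d \<and> norm v < d \<Longrightarrow> norm (f u - f v) \<le> e / (norm c + 1) * norm (u - v)"
    by blast
  have "norm (c * f u - c * f v) \<le> e * norm (u - v)" if "norm u < d \<and> norm v < d" for u v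
  proof -
    have "norm (c * f u - c * f v) = norm c * norm (f u - f v)" by (simp add: norm_mult flip: right_diff_distrib)
    also have "\<dots> \<le> (norm c + 1) * (e / (norm c + 1) * norm (u - v))" using d(2)[OF that] by (intro mult_mono) auto
    also have "\<dots> = e * norm (u - v)"
    proof -
      have "norm c + 1 \<noteq> 0" by (smt (verit) norm_ge_zero)
      then show ?thesis by simp
    qed
    finally show ?thesis .
  qed
  with d(1) show "\<exists>d>0. \<forall>u v. norm u < d \<and> norm v < d \<longrightarrow> norm (c * f u - c * f v) \<le> e * norm (u - v)" by blast
qed

text \<open>Handles factors such as \<open>(1 + a)^4\<close>, which do not vanish at 0, by
  subtracting their value 1.\<close>

lemma lipschitz_at_0_power: "lipschitz_at_0 f \<Longrightarrow> lipschitz_at_0 (\<lambda>x. (1 + f x) ^ n - 1)"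
proof (induction n)
  case 0
  then show ?case by (simp add: lipschitz_at_0I[of _ 1 1])
next
  case (Suc n)
  have "(\<lambda>x. (1 + f x) ^ Suc n - 1) = (\<lambda>x. f x * ((1 + f x) ^ n - 1) + (f x + ((1 + f x) ^ n - 1)))"
    by (auto simp: algebra_simps)
  then show ?case using Suc by (simp only: lipschitz_at_0_add lipschitz_at_0_mult)
qed

lemma lipschitz_at_0_one_plus_mult: "lipschitz_at_0 (\<lambda>x. f x - 1) \<Longrightarrow> lipschitz_at_0 g \<Longrightarrow> lipschitz_at_0 (\<lambda>x. f x * g x)"
proof -
  assume "lipschitz_at_0 (\<lambda>x. f x - 1)" "lipschitz_at_0 g"
  then have "lipschitz_at_0 (\<lambda>x. (f x - 1) * g x + g x)" by (intro lipschitz_at_0_add lipschitz_at_0_mult)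
  then show ?thesis by (simp add: algebra_simps)
qed

lemma flat_at_0_diff: "flat_at_0 f \<Longrightarrow> flat_at_0 g \<Longrightarrow> flat_at_0 (\<lambda>x. f x - g x)"
  using flat_at_0_add[OF _ flat_at_0_cmult[of g "-1"]] by simp

lemma lipschitz_at_0_diff: "lipschitz_at_0 f \<Longrightarrow> lipschitz_at_0 g \<Longrightarrow> lipschitz_at_0 (\<lambda>x. f x - g x)"
  using lipschitz_at_0_add[OF _ lipschitz_at_0_cmult[of g "-1"]] by simp

section \<open>The circle equations and their linearisation\<close>

definition stat_eqs :: "real \<Rightarrow> complex \<Rightarrow> complex \<Rightarrow> complex \<Rightarrow> complex \<Rightarrow> bool" where
  "stat_eqs lam a b p r \<longleftrightarrow> (cmod a)^2 + (cmod b)^2 - lam * Re ((cnj a)^4 * b^2) = 1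
    \<and> Im (a * p + 2 * b * r) = 0
    \<and> r * (cnj a - 2 * lam * a^3 * (cnj b)^2) = p * (cnj b - lam * (cnj a)^4 * b)"

context
  fixes lam :: real
begin

text \<open>\<open>N1\<close>, \<open>N2\<close>, \<open>N3\<close> collect the terms of order at
  least two at (1, 0, 1, 0). The equations contain the real part of \<open>N1\<close> and the
  imaginary part of \<open>N2\<close>; the complex polynomial form gives access to the product rule
  for flatness.\<close>

definition N1 :: "complex \<times> complex \<times> complex \<times> complex \<Rightarrow> complex" where
  "N1 = (\<lambda>(a, b, p, r). a * cnj a + b * cnj b - lam * (cnj (1 + a) ^ 4 * b * b))"

definition N2 :: "complex \<times> complex \<times> complex \<times> complex \<Rightarrow> complex" where
  "N2 = (\<lambda>(a, b, p, r). a * p + 2 * (b * r))"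

definition N3 :: "complex \<times> complex \<times> complex \<times> complex \<Rightarrow> complex" where
  "N3 = (\<lambda>(a, b, p, r). r * (cnj a - 2 * lam * ((1 + a)^3 * (cnj b * cnj b)))
       - p * (cnj b - lam * (cnj (1 + a) ^ 4 * b)) + lam * ((cnj (1 + a) ^ 4 - 1) * b))"

lemma stat_eqs_linearized:
  fixes a b p r :: complex
  assumes "stat_eqs lam (1 + a) b (1 + p) r"
  shows "2 * Re a = - Re (N1 (a, b, p, r))" "Im (a + p) = - Im (N2 (a, b, p, r))"
    "r - cnj b + lam * b = - N3 (a, b, p, r)"
proof -
  have "(cmod (1 + a))^2 + (cmod b)^2 - lam * Re (cnj (1 + a) ^ 4 * b^2) = 1"
    using assms by (simp add: stat_eqs_def)
  moreover have "(cmod (1 + a))^2 = 1 + 2 * Re a + (cmod a)^2"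
    unfolding cmod_power2 by (simp add: power2_eq_square algebra_simps)
  moreover have "Re (N1 (a, b, p, r)) = (cmod a)^2 + (cmod b)^2 - lam * Re (cnj (1 + a) ^ 4 * b^2)"
    unfolding N1_def cmod_power2 by (simp add: power2_eq_square mult.assoc del: complex_cnj_add)
  ultimately show "2 * Re a = - Re (N1 (a, b, p, r))" by simp
  show "Im (a + p) = - Im (N2 (a, b, p, r))"
    using assms by (simp add: stat_eqs_def N2_def algebra_simps)
  have "r * (cnj (1 + a) - 2 * lam * (1 + a)^3 * (cnj b)^2) = (1 + p) * (cnj b - lam * cnj (1 + a) ^ 4 * b)"
    using assms by (simp add: stat_eqs_def)
  then show "r - cnj b + lam * b = - N3 (a, b, p, r)"
    by (simp add: N3_def power2_eq_square algebra_simps)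
qed

text \<open>Every term is a product of two factors vanishing at 0, once a power of
  \<open>1 + a\<close> is absorbed into one of them or has its value 1 subtracted.\<close>

lemma flat_at_0_N: "flat_at_0 N1" "flat_at_0 N2" "flat_at_0 N3"
proof -
  have lin: "bounded_linear (\<lambda>u :: complex \<times> complex \<times> complex \<times> complex. fst u)"
    "bounded_linear (\<lambda>u :: complex \<times> complex \<times> complex \<times> complex. fst (snd u))"
    "bounded_linear (\<lambda>u :: complex \<times> complex \<times> complex \<times> complex. fst (snd (snd u)))"
    "bounded_linear (\<lambda>u :: complex \<times> complex \<times> complex \<times> complex. snd (snd (snd u)))"
    by (intro bounded_linear_intros)+
  note c = lipschitz_at_0_bounded_linear[OF lin(1)] lipschitz_at_0_bounded_linear[OF lin(2)]
    lipschitz_at_0_bounded_linear[OF lin(3)] lipschitz_at_0_bounded_linear[OF lin(4)]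
  note cc = lipschitz_at_0_bounded_linear[OF bounded_linear_compose[OF bounded_linear_cnj lin(1)]]
    lipschitz_at_0_bounded_linear[OF bounded_linear_compose[OF bounded_linear_cnj lin(2)]]
  have disc_series: "lipschitz_at_0 (\<lambda>u :: complex \<times> complex \<times> complex \<times> complex. (cnj (1 + fst u)) ^ 4 - 1)" using lipschitz_at_0_power[OF cc(1)] by simp
  note X = lipschitz_at_0_one_plus_mult[OF disc_series c(2)] and Y = lipschitz_at_0_one_plus_mult[OF lipschitz_at_0_power[OF c(1)] lipschitz_at_0_mult[OF cc(2) cc(2)]]
  have "flat_at_0 (\<lambda>u :: complex \<times> complex \<times> complex \<times> complex. lam * ((cnj (1 + fst u)) ^ 4 * fst (snd u) * fst (snd u)))"
    by (rule flat_at_0_cmult[OF flat_at_0_mult[OF X c(2)]])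
  from flat_at_0_diff[OF flat_at_0_add[OF flat_at_0_mult[OF c(1) cc(1)] flat_at_0_mult[OF c(2) cc(2)]] this]
  show "flat_at_0 N1" by (simp add: N1_def case_prod_unfold)
  have "flat_at_0 (\<lambda>u. fst u * fst (snd (snd u)) + 2 * (fst (snd u) * snd (snd (snd u))))"
    by (rule flat_at_0_add[OF flat_at_0_mult[OF c(1) c(3)] flat_at_0_cmult[OF flat_at_0_mult[OF c(2) c(4)]]])
  then show "flat_at_0 N2" by (simp add: N2_def case_prod_unfold)
  have 1: "flat_at_0 (\<lambda>u :: complex \<times> complex \<times> complex \<times> complex. snd (snd (snd u)) * (cnj (fst u) - 2 * lam * ((1 + fst u)^3 * (cnj (fst (snd u)) * cnj (fst (snd u))))))"
    by (rule flat_at_0_mult[OF c(4) lipschitz_at_0_diff[OF cc(1) lipschitz_at_0_cmult[OF Y]]])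
  have 2: "flat_at_0 (\<lambda>u :: complex \<times> complex \<times> complex \<times> complex. fst (snd (snd u)) * (cnj (fst (snd u)) - lam * (cnj (1 + fst u) ^ 4 * fst (snd u))))"
    by (rule flat_at_0_mult[OF c(3) lipschitz_at_0_diff[OF cc(2) lipschitz_at_0_cmult[OF X]]])
  have 3: "flat_at_0 (\<lambda>u :: complex \<times> complex \<times> complex \<times> complex. lam * ((cnj (1 + fst u) ^ 4 - 1) * fst (snd u)))"
    by (rule flat_at_0_cmult[OF flat_at_0_mult[OF disc_series c(2)]])
  from flat_at_0_add[OF flat_at_0_diff[OF 1 2] 3] show "flat_at_0 N3" by (simp add: N3_def case_prod_unfold)
qed

lemma flat_at_0_uniform:
  assumes "e > 0"
  obtains d where "d > 0" "\<And>u v. norm u < d \<Longrightarrow> norm v < d \<Longrightarrow>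
    cmod (N1 u - N1 v) \<le> e * norm (u - v) \<and> cmod (N2 u - N2 v) \<le> e * norm (u - v) \<and> cmod (N3 u - N3 v) \<le> e * norm (u - v)"
proof -
  obtain d1 d2 d3 where d: "d1 > 0" "d2 > 0" "d3 > 0"
    "\<And>u v. norm u < d1 \<and> norm v < d1 \<Longrightarrow> cmod (N1 u - N1 v) \<le> e * norm (u - v)"
    "\<And>u v. norm u < d2 \<and> norm v < d2 \<Longrightarrow> cmod (N2 u - N2 v) \<le> e * norm (u - v)"
    "\<And>u v. norm u < d3 \<and> norm v < d3 \<Longrightarrow> cmod (N3 u - N3 v) \<le> e * norm (u - v)"
    using flat_at_0_N assms unfolding flat_at_0_def by metis
  show thesis
    by (rule that[of "min d1 (min d2 d3)"]) (use d in auto)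
qed

text \<open>\<open>h\<close>, \<open>k\<close>, \<open>p\<close>, \<open>r\<close> stand for
  differences of two solutions. \<open>h\<close> is controlled by its real part and \<open>p\<close>
  by its imaginary part, since \<open>Im (h 0)\<close> and \<open>Re (p 0)\<close> vanish;
  \<open>k\<close> and \<open>r\<close> are controlled through \<open>m = r + lam k\<close>, for
  which \<open>r 0 = 0\<close> gives \<open>m 0 = lam k 0\<close>.\<close>

lemma linear_estimate:
  fixes h k p r :: "complex \<Rightarrow> complex" and s :: "complex \<Rightarrow> real"
  assumes lam: "lam \<ge> 0" "lam \<noteq> 1"
  defines "c \<equiv> 3 + 2 * (1 + lam^2)^2 / (1 - lam)^2"
  assumes alg: "disc_alg h" "disc_alg k" "disc_alg p" "disc_alg r"
    and zero: "Im (h 0) = 0" "Re (p 0) = 0" "r 0 = 0"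
    and e: "e \<ge> 0"
    and cont: "continuous_on (sphere 0 1) s"
    and 1: "\<And>z. z \<in> sphere 0 1 \<Longrightarrow> \<bar>2 * Re (h z)\<bar> \<le> e * sqrt (s z)"
    and 2: "\<And>z. z \<in> sphere 0 1 \<Longrightarrow> \<bar>Im (h z + p z)\<bar> \<le> e * sqrt (s z)"
    and 3: "\<And>z. z \<in> sphere 0 1 \<Longrightarrow> cmod (r z - cnj (k z) + lam * k z) \<le> e * sqrt (s z)"
    and s: "\<And>z. z \<in> sphere 0 1 \<Longrightarrow> s z = (cmod (h z))^2 + (cmod (k z))^2 + (cmod (p z))^2 + (cmod (r z))^2"
  shows "circle_mean s \<le> (10 * c) * e^2 * circle_mean s"
proof -
  note c = alg[THEN disc_alg_continuous_sphere]
  define S where "S = circle_mean s"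
  have s0: "s z \<ge> 0" if "z \<in> sphere 0 1" for z using s[OF that] by simp
  have es: "continuous_on (sphere 0 1) (\<lambda>z. e^2 * s z)" and Es: "circle_mean (\<lambda>z. e^2 * s z) = e^2 * S"
    using cont by (auto simp: S_def circle_mean_cmult intro!: continuous_intros)
  have S0: "S \<ge> 0" using circle_mean_mono[of "\<lambda>_. 0" s] cont s0 by (simp add: S_def)
  have sq: "x^2 \<le> e^2 * s z" if "z \<in> sphere 0 1" "\<bar>x\<bar> \<le> e * sqrt (s z)" for x z
    using power_mono[OF that(2) abs_ge_zero, of 2] s0[OF that(1)] by (simp add: power_mult_distrib)
  define H P M K where "H = circle_mean (\<lambda>z. (cmod (h z))^2)" and "P = circle_mean (\<lambda>z. (cmod (p z))^2)"
    and "M = circle_mean (\<lambda>z. (cmod (r z + lam * k z))^2)" and "K = circle_mean (\<lambda>z. (cmod (k z))^2)"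
  have cn: "continuous_on (sphere 0 1) (\<lambda>z. (cmod (h z))^2)" "continuous_on (sphere 0 1) (\<lambda>z. (cmod (p z))^2)"
     "continuous_on (sphere 0 1) (\<lambda>z. (cmod (k z))^2)" "continuous_on (sphere 0 1) (\<lambda>z. (cmod (r z))^2)"
     "continuous_on (sphere 0 1) (\<lambda>z. (cmod (r z + lam * k z))^2)"
    by (intro continuous_intros c)+
  have "H \<le> 2 * circle_mean (\<lambda>z. (Re (h z))^2)"
    unfolding H_def by (rule circle_mean_norm_le_Re) fact+
  also have "circle_mean (\<lambda>z. (Re (h z))^2) \<le> circle_mean (\<lambda>z. e^2 * s z)"
  proof (rule circle_mean_mono)
    fix z :: complex assume z: "z \<in> sphere 0 1"
    show "(Re (h z))^2 \<le> e^2 * s z" using sq[OF z 1[OF z]] by (simp add: power_mult_distrib) (smt (verit) zero_le_power2)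
  qed (intro continuous_intros c es)+
  finally have H: "H \<le> 2 * (e^2 * S)" by (simp add: Es)
  have "P = circle_mean (\<lambda>z. (cmod (- \<i> * p z))^2)" by (simp add: P_def norm_mult)
  also have "\<dots> \<le> 2 * circle_mean (\<lambda>z. (Re (- \<i> * p z))^2)"
    by (rule circle_mean_norm_le_Re[OF disc_alg_mult[OF disc_alg_const alg(3)]]) (use zero in simp)
  also have "circle_mean (\<lambda>z. (Re (- \<i> * p z))^2) \<le> circle_mean (\<lambda>z. 2 * (e^2 * s z) + 2 * (cmod (h z))^2)"
  proof (rule circle_mean_mono)
    fix z :: complex assume z: "z \<in> sphere 0 1"
    have "(Im (p z))^2 \<le> 2 * (Im (h z + p z))^2 + 2 * (Im (h z))^2"
      using zero_le_power2[of "Im (p z) + 2 * Im (h z)"] by (simp add: power2_eq_square algebra_simps)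
    also have "(Im (h z))^2 \<le> (cmod (h z))^2" by (simp add: cmod_power2)
    finally show "(Re (- \<i> * p z))^2 \<le> 2 * (e^2 * s z) + 2 * (cmod (h z))^2" using sq[OF z 2[OF z]] by simp
  qed (intro continuous_intros c es)+
  also have "\<dots> = 2 * (e^2 * S) + 2 * H"
    using cn es by (simp add: circle_mean_add circle_mean_cmult[OF es] circle_mean_cmult[OF cn(1)] continuous_on_mult_left H_def Es)
  finally have P: "P \<le> 2 * (2 * (e^2 * S) + 2 * H)" by simp
  have MK: "(1 - lam)^2 * (M + K) \<le> (1 + lam^2) * (e^2 * S)"
  proof -
    have "(1 - lam)^2 * circle_mean (\<lambda>z. (cmod (r z + lam * k z))^2 + (cmod (k z))^2)
      \<le> (1 + lam^2) * circle_mean (\<lambda>z. (cmod (r z + lam * k z - cnj (k z)))^2)"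
      by (rule circle_mean_antilinear_bound) (use alg zero lam in \<open>auto intro!: disc_alg_add disc_alg_mult disc_alg_const\<close>)
    also have "circle_mean (\<lambda>z. (cmod (r z + lam * k z - cnj (k z)))^2) \<le> circle_mean (\<lambda>z. e^2 * s z)"
    proof (rule circle_mean_mono)
      fix z :: complex assume z: "z \<in> sphere 0 1"
      have "r z + lam * k z - cnj (k z) = r z - cnj (k z) + lam * k z" by simp
      then show "(cmod (r z + lam * k z - cnj (k z)))^2 \<le> e^2 * s z"
        using sq[OF z, of "cmod (r z + lam * k z - cnj (k z))"] 3[OF z] by (simp only: abs_norm_cancel)
    qed (intro continuous_intros c es)+
    finally show ?thesis by (simp add: Es M_def K_def circle_mean_add cn mult_left_mono)
  qed
  have RR: "circle_mean (\<lambda>z. (cmod (r z))^2) \<le> 2 * M + 2 * lam^2 * K"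
  proof -
    have "circle_mean (\<lambda>z. (cmod (r z))^2) \<le> circle_mean (\<lambda>z. 2 * (cmod (r z + lam * k z))^2 + (2 * lam^2) * (cmod (k z))^2)"
    proof (rule circle_mean_mono)
      fix z
      have "cmod (r z) \<le> cmod (r z + lam * k z) + cmod (lam * k z)"
        using norm_triangle_ineq4[of "r z + lam * k z" "lam * k z"] by simp
      then have "(cmod (r z))^2 \<le> (cmod (r z + lam * k z) + cmod (lam * k z))^2" by (rule power_mono) simp
      also have "\<dots> \<le> 2 * (cmod (r z + lam * k z))^2 + 2 * (cmod (lam * k z))^2"
        using zero_le_power2[of "cmod (r z + lam * k z) - cmod (lam * k z)"] by (simp add: power2_eq_square algebra_simps)
      finally show "(cmod (r z))^2 \<le> 2 * (cmod (r z + lam * k z))^2 + (2 * lam^2) * (cmod (k z))^2"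
        by (simp add: norm_mult power_mult_distrib)
    qed (intro continuous_intros c)+
    also have "\<dots> = 2 * M + 2 * lam^2 * K"
      by (simp add: circle_mean_add continuous_on_mult_left cn circle_mean_cmult M_def K_def)
    finally show ?thesis .
  qed
  have K0: "K \<ge> 0" "M \<ge> 0"
    unfolding K_def M_def using circle_mean_mono[OF continuous_on_const cn(3), of 0] circle_mean_mono[OF continuous_on_const cn(5), of 0] by simp_all
  have "S = H + K + P + circle_mean (\<lambda>z. (cmod (r z))^2)"
  proof -
    have "S = circle_mean (\<lambda>z. (cmod (h z))^2 + (cmod (k z))^2 + (cmod (p z))^2 + (cmod (r z))^2)"
      unfolding S_def by (rule circle_mean_cong) (rule s)
    then show ?thesis by (simp add: circle_mean_add cn continuous_on_add H_def K_def P_def)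
  qed
  also have "\<dots> \<le> 30 * (e^2 * S) + 2 * ((1 + lam^2) * (M + K))"
  proof -
    have "K + (2 * M + 2 * lam^2 * K) \<le> 2 * ((1 + lam^2) * (M + K))"
      using K0 mult_nonneg_nonneg[of "lam^2" M] by (simp add: algebra_simps)
    with RR have *: "K + circle_mean (\<lambda>z. (cmod (r z))^2) \<le> 2 * ((1 + lam^2) * (M + K))" by (rule order_trans[OF add_left_mono])
    \<comment> \<open>The assumptions give 14 E; the rounder 30 = 10 * 3 matches the first summand
      of \<open>c\<close>.\<close>
    have "H + P \<le> 30 * E" if "H \<le> 2 * E" "P \<le> 2 * (2 * E + 2 * H)" "0 \<le> E" for E
      using that by simp
    from this[OF H P mult_nonneg_nonneg[OF zero_le_power2[of e] S0]]
    have "H + P \<le> 30 * (e^2 * S)" .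
    with * show ?thesis by simp
  qed
  also have "\<dots> \<le> 30 * (e^2 * S) + 2 * ((1 + lam^2) * ((1 + lam^2) * (e^2 * S) / (1 - lam)^2))"
    using MK lam by (intro add_left_mono mult_left_mono) (simp_all add: field_simps)
  also have "\<dots> = (30 + 2 * (1 + lam^2)^2 / (1 - lam)^2) * (e^2 * S)"
  proof -
    have "30 * X + 2 * (L * (L * X / Y)) = (30 + 2 * L^2 / Y) * X" for L X Y :: real
      by (simp add: power2_eq_square distrib_right)
    then show ?thesis .
  qed
  also have "\<dots> \<le> (10 * c) * (e^2 * S)"
    using S0 by (intro mult_right_mono) (simp_all add: c_def distrib_left divide_right_mono)
  finally show ?thesis by (simp add: S_def mult_ac)
qed

text \<open>Asks only for continuity up to the circle and closeness to f0 in the sup norm there, so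
  that uniqueness applies to every lift near f0 in the Hoelder norm.\<close>

definition stat_lift :: "real \<Rightarrow> (complex \<Rightarrow> complex) \<Rightarrow> (complex \<Rightarrow> complex) \<Rightarrow> (complex \<Rightarrow> complex) \<Rightarrow> (complex \<Rightarrow> complex) \<Rightarrow> bool"
  where "stat_lift d z w p q \<longleftrightarrow> disc_alg z \<and> disc_alg w \<and> disc_alg p \<and> disc_alg q
    \<and> (\<forall>x. cmod x = 1 \<longrightarrow> stat_eqs lam (cnj x * z x) ((cnj x)^2 * w x) (p x) (x * q x)
        \<and> norm (z x - x, w x, p x - 1, q x) < d)"

text \<open>The linear estimate bounds the mean of the squared difference by half of itself, so the
  solutions agree on the circle; the maximum modulus principle carries equality inside.\<close>

lemma stationary_unique:
  assumes lam: "lam \<ge> 0" "lam \<noteq> 1"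
  shows "\<exists>d>0. \<forall>z w p q z' w' p' q' \<zeta>. stat_lift d z w p q \<longrightarrow> stat_lift d z' w' p' q' \<longrightarrow>
      z 0 = z' 0 \<and> Im (deriv z 0) = Im (deriv z' 0) \<and> w 0 = w' 0 \<and> deriv w 0 = deriv w' 0 \<and> Re (p 0) = Re (p' 0) \<longrightarrow>
      cmod \<zeta> \<le> 1 \<longrightarrow> z \<zeta> = z' \<zeta> \<and> w \<zeta> = w' \<zeta> \<and> p \<zeta> = p' \<zeta> \<and> q \<zeta> = q' \<zeta>"
proof -
  define c where "c = 3 + 2 * (1 + lam^2)^2 / (1 - lam)^2"
  have c: "c > 0" by (simp add: c_def add_pos_nonneg)
  \<comment> \<open>Chosen so that the factor \<open>10 * c * e^2\<close> of the linear estimate is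
    1/2; \<open>d\<close> is a radius on which the nonlinear terms have Lipschitz constant
    \<open>e\<close>.\<close>
  define e where "e = 1 / sqrt (20 * c)"
  have e: "e > 0" "10 * c * e^2 = 1/2" using c by (simp_all add: e_def power_divide)
  obtain d where d: "d > 0" and N: "\<And>u v. norm u < d \<Longrightarrow> norm v < d \<Longrightarrow>
    cmod (N1 u - N1 v) \<le> e * norm (u - v) \<and> cmod (N2 u - N2 v) \<le> e * norm (u - v) \<and> cmod (N3 u - N3 v) \<le> e * norm (u - v)"
    using flat_at_0_uniform[OF e(1)] by blast
  show ?thesis
  proof (intro exI[of _ d] conjI[OF d] allI impI)
    fix z w p q z' w' p' q' \<zeta>
    assume lifts: "stat_lift d z w p q" "stat_lift d z' w' p' q'"
      and zero: "z 0 = z' 0 \<and> Im (deriv z 0) = Im (deriv z' 0) \<and> w 0 = w' 0 \<and> deriv w 0 = deriv w' 0 \<and> Re (p 0) = Re (p' 0)"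
      and \<zeta>: "cmod \<zeta> \<le> 1"
    have alg: "disc_alg z" "disc_alg w" "disc_alg p" "disc_alg q" "disc_alg z'" "disc_alg w'" "disc_alg p'" "disc_alg q'"
      and 0: "z 0 = z' 0" "Im (deriv z 0) = Im (deriv z' 0)" "w 0 = w' 0" "deriv w 0 = deriv w' 0" "Re (p 0) = Re (p' 0)"
      and E: "\<And>x. cmod x = 1 \<Longrightarrow> stat_eqs lam (cnj x * z x) ((cnj x)^2 * w x) (p x) (x * q x)"
      "\<And>x. cmod x = 1 \<Longrightarrow> stat_eqs lam (cnj x * z' x) ((cnj x)^2 * w' x) (p' x) (x * q' x)"
      and small: "\<And>x. cmod x = 1 \<Longrightarrow> norm (z x - x, w x, p x - 1, q x) < d"
      "\<And>x. cmod x = 1 \<Longrightarrow> norm (z' x - x, w' x, p' x - 1, q' x) < d"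
      using lifts zero unfolding stat_lift_def by auto
    have diff_at: "f field_differentiable (at 0)" if "disc_alg f" for f
      using that unfolding disc_alg_def by (meson centre_in_ball holomorphic_on_imp_differentiable_at open_ball zero_less_one)
    have dd: "deriv (\<lambda>x. f x - g x) 0 = deriv f 0 - deriv g 0" if "disc_alg f" "disc_alg g" for f g
      by (intro deriv_diff diff_at that)
    \<comment> \<open>Equal values at 0 allow one division for z; equal values and first derivatives
      allow two for w. On the circle \<open>h\<close> and \<open>k\<close> are the differences of
      the rescaled unknowns a and b.\<close>
    obtain h where h: "disc_alg h" "\<And>x. x \<in> cball 0 1 \<Longrightarrow> z x - z' x = x * h x" "h 0 = deriv (\<lambda>x. z x - z' x) 0"
      using disc_alg_divide[OF disc_alg_diff[OF alg(1) alg(5)]] 0 by auto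
    obtain k1 where k1: "disc_alg k1" "\<And>x. x \<in> cball 0 1 \<Longrightarrow> w x - w' x = x * k1 x" "k1 0 = deriv (\<lambda>x. w x - w' x) 0"
      using disc_alg_divide[OF disc_alg_diff[OF alg(2) alg(6)]] 0 by auto
    have k10: "k1 0 = 0" using k1(3) dd[OF alg(2) alg(6)] 0 by simp
    obtain k where k: "disc_alg k" "\<And>x. x \<in> cball 0 1 \<Longrightarrow> k1 x = x * k x"
      using disc_alg_divide[OF k1(1) k10] by auto
    define P R where "P x = p x - p' x" and "R x = x * (q x - q' x)" for x
    have PR: "disc_alg P" "disc_alg R"
      unfolding P_def R_def by (intro disc_alg_diff disc_alg_mult disc_alg_id alg)+
    define s where "s x = (cmod (h x))^2 + (cmod (k x))^2 + (cmod (P x))^2 + (cmod (R x))^2" for x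
    note cont = disc_alg_continuous_sphere[OF h(1)] disc_alg_continuous_sphere[OF k(1)]
      disc_alg_continuous_sphere[OF PR(1)] disc_alg_continuous_sphere[OF PR(2)]
    have sc: "continuous_on (sphere 0 1) s"
      unfolding s_def[abs_def] by (intro continuous_intros cont)
    define U where "U x = (cnj x * z x - 1, (cnj x)^2 * w x, p x - 1, x * q x)" for x
    define U' where "U' x = (cnj x * z' x - 1, (cnj x)^2 * w' x, p' x - 1, x * q' x)" for x
    have xx: "cnj x * x = 1" if "cmod x = 1" for x using that complex_norm_square[of x] by (simp add: mult.commute)
    have hk: "cnj x * z x - cnj x * z' x = h x" "(cnj x)^2 * w x - (cnj x)^2 * w' x = k x" if x: "cmod x = 1" for x
    proof -
      have "cnj x * z x - cnj x * z' x = cnj x * x * h x"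
        using h(2)[of x] x by (simp flip: right_diff_distrib)
      then show "cnj x * z x - cnj x * z' x = h x" using xx[OF x] by simp
      have "(cnj x)^2 * w x - (cnj x)^2 * w' x = (cnj x * x) * (cnj x * x) * k x"
        using k1(2)[of x] k(2)[of x] x by (simp add: power2_eq_square flip: right_diff_distrib)
      then show "(cnj x)^2 * w x - (cnj x)^2 * w' x = k x" using xx[OF x] by simp
    qed
    have UU: "U x - U' x = (h x, k x, P x, R x)" if x: "cmod x = 1" for x
      using hk[OF x] by (simp add: U_def U'_def P_def R_def algebra_simps)
    have nU: "norm (U x - U' x) = sqrt (s x)" if x: "cmod x = 1" for x
      unfolding UU[OF x] by (simp add: norm_Pair s_def add_ac)
    \<comment> \<open>The rescaling factors are unimodular, so the rescaled unknowns are exactly as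
      far from (1, 0, 1, 0) as the lift is from f0.\<close>
    have norms: "norm (cnj x * a - 1, (cnj x)^2 * b, c, x * r) = norm (a - x, b, c, r)" if x: "cmod x = 1" for x a b c r
    proof -
      have "cnj x * a - 1 = cnj x * (a - x)" using xx[OF x] by (simp add: algebra_simps)
      then show ?thesis using x by (simp add: norm_Pair norm_mult norm_power)
    qed
    have sU: "norm (U x) < d" "norm (U' x) < d" if x: "cmod x = 1" for x
      unfolding U_def U'_def norms[OF x] using small x by auto
    note NN = N[OF sU(1) sU(2)]
    have lin: "2 * Re (h x) = - Re (N1 (U x) - N1 (U' x))" "Im (h x + P x) = - Im (N2 (U x) - N2 (U' x))"
      "R x - cnj (k x) + lam * k x = - (N3 (U x) - N3 (U' x))" if x: "cmod x = 1" for x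
    proof -
      have "stat_eqs lam (1 + (cnj x * z x - 1)) ((cnj x)^2 * w x) (1 + (p x - 1)) (x * q x)"
        "stat_eqs lam (1 + (cnj x * z' x - 1)) ((cnj x)^2 * w' x) (1 + (p' x - 1)) (x * q' x)" using E[OF x] by simp_all
      note l = stat_eqs_linearized[OF this(1), folded U_def] stat_eqs_linearized[OF this(2), folded U'_def]
      show "2 * Re (h x) = - Re (N1 (U x) - N1 (U' x))"
        using l(1,4) arg_cong[OF hk(1)[OF x], of Re] by (simp del: times_complex.sel)
      show "Im (h x + P x) = - Im (N2 (U x) - N2 (U' x))"
        using l(2,5) arg_cong[OF hk(1)[OF x], of Im] by (simp add: P_def del: times_complex.sel)
      have "R x - cnj (k x) + lam * k x = (x * q x - cnj ((cnj x)^2 * w x) + lam * ((cnj x)^2 * w x))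
          - (x * q' x - cnj ((cnj x)^2 * w' x) + lam * ((cnj x)^2 * w' x))"
        unfolding hk(2)[OF x, symmetric] R_def by (simp add: algebra_simps)
      also have "\<dots> = - (N3 (U x) - N3 (U' x))" unfolding l(3) l(6) by simp
      finally show "R x - cnj (k x) + lam * k x = - (N3 (U x) - N3 (U' x))" .
    qed
    have "circle_mean s \<le> (10 * c) * e^2 * circle_mean s"
      unfolding c_def
    proof (rule linear_estimate[OF lam h(1) k(1) PR _ _ _ _ sc])
      show "Im (h 0) = 0" "Re (P 0) = 0" "R 0 = 0"
        using h(3) dd[OF alg(1) alg(5)] 0 by (simp_all add: P_def R_def)
      show "0 \<le> e" using e by simp
      fix x :: complex assume "x \<in> sphere 0 1"
      then have x: "cmod x = 1" by simp
      note n = NN[OF x x, unfolded nU[OF x]]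
      show "\<bar>2 * Re (h x)\<bar> \<le> e * sqrt (s x)"
        unfolding lin(1)[OF x] abs_minus_cancel using n abs_Re_le_cmod order_trans by blast
      show "\<bar>Im (h x + P x)\<bar> \<le> e * sqrt (s x)"
        unfolding lin(2)[OF x] abs_minus_cancel using n abs_Im_le_cmod order_trans by blast
      show "cmod (R x - cnj (k x) + lam * k x) \<le> e * sqrt (s x)"
        unfolding lin(3)[OF x] norm_minus_cancel using n by blast
    qed (simp add: s_def)
    then have "circle_mean s \<le> 0" using e by simp
    then have s0: "s x = 0" if "cmod x = 1" for x
      using circle_mean_zero[OF sc] that by (simp add: s_def)
    have *: "h x = 0 \<and> k x = 0 \<and> P x = 0 \<and> R x = 0" if "cmod x = 1" for x
      using s0[OF that] by (simp add: s_def add_nonneg_eq_0_iff)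
    have bd: "z x = z' x \<and> w x = w' x \<and> p x = p' x \<and> q x = q' x" if x: "cmod x = 1" for x
    proof -
      have "x \<noteq> 0" using x by auto
      then show ?thesis
        using x h(2)[of x] k(2)[of x] k1(2)[of x] * [OF x] by (auto simp: P_def R_def)
    qed
    have max: "f \<zeta> = g \<zeta>" if fg: "disc_alg f" "disc_alg g" "\<And>x. cmod x = 1 \<Longrightarrow> f x = g x" for f g
    proof -
      have "norm (f \<zeta> - g \<zeta>) \<le> 0"
        by (rule maximum_modulus_frontier[of "\<lambda>x. f x - g x" "cball 0 1"])
           (use disc_alg_diff[OF fg(1,2)] fg(3) \<zeta> in \<open>auto simp: disc_alg_def interior_cball\<close>)
      then show ?thesis by simp
    qed
    show "z \<zeta> = z' \<zeta> \<and> w \<zeta> = w' \<zeta> \<and> p \<zeta> = p' \<zeta> \<and> q \<zeta> = q' \<zeta>"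
      using max alg bd by blast
  qed
qed

end

section \<open>From Fourier series to Hoelder maps on the disc\<close>

lemma exhaust_8:
  fixes x :: 8
  shows "x = 1 \<or> x = 2 \<or> x = 3 \<or> x = 4 \<or> x = 5 \<or> x = 6 \<or> x = 7 \<or> x = 8"
proof (induct x)
  case (of_int z)
  then have "0 \<le> z" and "z < 8" by simp_all
  then have "z = 0 \<or> z = 1 \<or> z = 2 \<or> z = 3 \<or> z = 4 \<or> z = 5 \<or> z = 6 \<or> z = 7" by arith
  then show ?case by auto
qed

text \<open>The suprema in \<open>hnorm\<close> control nothing unless the sets are bounded. The
  bounds \<open>A\<close> and \<open>B\<close> guarantee this, and only then does
  \<open>hnorm\<close> dominate pointwise values.\<close>

lemma hnorm_le:
  assumes A: "\<And>z. z \<in> cball 0 1 \<Longrightarrow> norm (F z) \<le> A"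
    and B: "\<And>z w. z \<in> cball 0 1 \<Longrightarrow> w \<in> cball 0 1 \<Longrightarrow> norm (F z - F w) \<le> B * cmod (z - w) powr \<alpha>"
  shows "0 \<le> hnorm \<alpha> F" "hnorm \<alpha> F \<le> A + B" "z \<in> cball 0 1 \<Longrightarrow> norm (F z) \<le> hnorm \<alpha> F"
proof -
  let ?Q = "{(z, w). z \<in> cball 0 1 \<and> w \<in> cball 0 1 \<and> z \<noteq> (w::complex)}"
  let ?q = "\<lambda>q. norm (F (fst q) - F (snd q)) / cmod (fst q - snd q) powr \<alpha>"
  have q: "?q x \<le> B" if "x \<in> ?Q" for x
    using that B[of "fst x" "snd x"] by (auto simp: divide_le_eq)
  have bA: "bdd_above ((\<lambda>z. norm (F z)) ` cball 0 1)" using A by (intro bdd_aboveI2) auto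
  have bQ: "bdd_above (?q ` ?Q)" using q by (intro bdd_aboveI2) auto
  have "(0::complex, 1::complex) \<in> ?Q" by simp
  then have ne: "?Q \<noteq> {}" by blast
  have "(SUP z\<in>cball 0 1. norm (F z)) \<le> A" by (rule cSUP_least) (auto intro: A)
  moreover have "(SUP x\<in>?Q. ?q x) \<le> B" by (rule cSUP_least[OF ne]) (rule q)
  ultimately show "hnorm \<alpha> F \<le> A + B" unfolding hnorm_def by linarith
  have Q0: "0 \<le> (SUP x\<in>?Q. ?q x)"
    by (rule cSUP_upper2[OF bQ \<open>(0, 1) \<in> ?Q\<close>]) simp
  show 1: "norm (F z) \<le> hnorm \<alpha> F" if "z \<in> cball 0 1" for z
    using cSUP_upper[OF that bA] Q0 unfolding hnorm_def by linarith
  show "0 \<le> hnorm \<alpha> F" by (rule order_trans[OF norm_ge_zero 1[of 0]]) simp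
qed

lemma Aalpha_bounds:
  assumes "F \<in> Aalpha \<alpha>" "\<alpha> > 0"
  obtains A B where "\<And>z. z \<in> cball 0 1 \<Longrightarrow> norm (F z) \<le> A"
    "\<And>z w. z \<in> cball 0 1 \<Longrightarrow> w \<in> cball 0 1 \<Longrightarrow> norm (F z - F w) \<le> B * cmod (z - w) powr \<alpha>"
proof -
  obtain C where C: "\<And>z w. z \<in> cball 0 1 \<Longrightarrow> w \<in> cball 0 1 \<Longrightarrow> norm (F z - F w) \<le> C * cmod (z - w) powr \<alpha>"
    using assms unfolding Aalpha_def by blast
  have b: "norm (F z) \<le> norm (F 0) + \<bar>C\<bar>" if z: "z \<in> cball 0 1" for z
  proof -
    have "norm (F z - F 0) \<le> C * cmod z powr \<alpha>" using C[OF z, of 0] by simp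
    also have "\<dots> \<le> \<bar>C\<bar> * 1"
      using z assms(2) by (intro mult_mono powr_le1) auto
    finally show ?thesis using norm_triangle_ineq2[of "F z" "F 0"] by linarith
  qed
  show ?thesis by (rule that[OF b C])
qed

lemma norm_le_hnorm:
  assumes "F \<in> Aalpha \<alpha>" "\<alpha> > 0" "z \<in> cball 0 1"
  shows "norm (F z) \<le> hnorm \<alpha> F"
proof -
  obtain A B where "\<And>z. z \<in> cball 0 1 \<Longrightarrow> norm (F z) \<le> A"
    "\<And>z w. z \<in> cball 0 1 \<Longrightarrow> w \<in> cball 0 1 \<Longrightarrow> norm (F z - F w) \<le> B * cmod (z - w) powr \<alpha>"
    using Aalpha_bounds[OF assms(1,2)] by blast
  then show ?thesis using assms(3) by (rule hnorm_le(3))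
qed

lemma Aalpha_diff:
  assumes "F \<in> Aalpha \<alpha>" "G \<in> Aalpha \<alpha>"
  shows "(\<lambda>z. F z - G z) \<in> Aalpha \<alpha>"
proof -
  obtain C D where C: "\<forall>z\<in>cball 0 1. \<forall>w\<in>cball 0 1. norm (F z - F w) \<le> C * cmod (z - w) powr \<alpha>"
    "\<forall>z\<in>cball 0 1. \<forall>w\<in>cball 0 1. norm (G z - G w) \<le> D * cmod (z - w) powr \<alpha>"
    using assms unfolding Aalpha_def by blast
  have "norm (F z - G z - (F w - G w)) \<le> (C + D) * cmod (z - w) powr \<alpha>" if "z \<in> cball 0 1" "w \<in> cball 0 1" for z w
    using C that norm_triangle_ineq4[of "F z - F w" "G z - G w"] by (fastforce simp: algebra_simps)
  then show ?thesis
    using assms unfolding Aalpha_def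
    by (intro CollectI conjI exI[of _ "C + D"]) (auto intro!: holomorphic_intros)
qed

lemma Aalpha_disc_alg:
  assumes F: "F \<in> Aalpha \<alpha>" and \<alpha>: "\<alpha> > 0"
  shows "disc_alg (\<lambda>z. F z $ i)"
proof -
  obtain C where C: "\<And>z w. z \<in> cball 0 1 \<Longrightarrow> w \<in> cball 0 1 \<Longrightarrow> norm (F z - F w) \<le> C * cmod (z - w) powr \<alpha>"
    using F unfolding Aalpha_def by blast
  have "continuous (at z within cball 0 1) F" if z: "z \<in> cball 0 1" for z
  proof -
    have "((\<lambda>w. cmod (w - z)) \<longlongrightarrow> 0) (at z within cball 0 1)"
      by (auto intro!: tendsto_eq_intros)
    then have "((\<lambda>w. cmod (w - z) powr \<alpha>) \<longlongrightarrow> 0 powr \<alpha>) (at z within cball 0 1)"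
      using \<alpha> by (intro tendsto_powr' tendsto_const) auto
    from tendsto_mult_left[OF this, of C]
    have lim: "((\<lambda>w. C * cmod (w - z) powr \<alpha>) \<longlongrightarrow> 0) (at z within cball 0 1)" by simp
    have "((\<lambda>w. F w - F z) \<longlongrightarrow> 0) (at z within cball 0 1)"
      by (rule Lim_null_comparison[OF _ lim]) (use C z in \<open>auto simp: eventually_at_filter\<close>)
    then show ?thesis by (simp add: continuous_within LIM_zero_iff)
  qed
  then have "continuous_on (cball 0 1) F" by (simp add: continuous_on_eq_continuous_within)
  then have "continuous_on (cball 0 1) (\<lambda>z. F z $ i)"
    by (intro continuous_intros)
  moreover have "(\<lambda>z. F z $ i) holomorphic_on ball 0 1" using F unfolding Aalpha_def by blast
  ultimately show ?thesis by (simp add: disc_alg_def)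
qed

section \<open>Power series on the closed disc\<close>

definition disc_series :: "int \<Rightarrow> wser \<Rightarrow> complex \<Rightarrow> complex" where
  "disc_series s a \<zeta> = (\<Sum>n. fcoeff a (int n - s) * \<zeta> ^ n)"

lemma norm_fcoeff_shift: "norm (fcoeff a (int n - s)) \<le> norm a * weight s * (1 / (1 + real n) ^ 3)"
proof -
  have "(1 + real n) ^ 3 \<le> weight (int n - s) * weight s"
    using weight_submult[of "int n - s" s] by (simp add: weight_def)
  then have "1 / weight (int n - s) \<le> weight s * (1 / (1 + real n) ^ 3)"
    by (simp add: field_simps)
  then have "norm a * (1 / weight (int n - s)) \<le> norm a * (weight s * (1 / (1 + real n) ^ 3))"
    by (rule mult_left_mono) simp
  then show ?thesis using norm_fcoeff[of a "int n - s"] by (simp add: mult_ac)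
qed

definition invsq_sum :: real where "invsq_sum = (\<Sum>n. 1 / (1 + real n) ^ 2)"

lemma summable_invsq: "summable (\<lambda>n. 1 / (1 + real n) ^ 2)"
  using summable_Suc_iff[of "\<lambda>n. inverse (real n ^ 2)"] inverse_power_summable[of 2, where ?'a=real]
  by (simp add: inverse_eq_divide add_ac)

lemma invcube_le: "1 / (1 + real n) ^ 3 \<le> 1 / (1 + real n) ^ 2" "1 / (1 + real n) ^ 3 * n \<le> 1 / (1 + real n) ^ 2"
proof -
  have "(1 + real n) ^ 3 = (1 + real n) * (1 + real n) ^ 2" by (simp add: power3_eq_cube power2_eq_square)
  then have *: "1 / (1 + real n) ^ 3 * (1 + real n) = 1 / (1 + real n) ^ 2" by simp
  have "1 / (1 + real n) ^ 3 * x \<le> 1 / (1 + real n) ^ 3 * (1 + real n)" if "x \<le> 1 + real n" for x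
    using that by (intro mult_left_mono) auto
  from this[of 1] this[of n]
  show "1 / (1 + real n) ^ 3 \<le> 1 / (1 + real n) ^ 2" "1 / (1 + real n) ^ 3 * n \<le> 1 / (1 + real n) ^ 2"
    unfolding * by simp_all
qed

lemma disc_series_term_bound: "cmod \<zeta> \<le> 1 \<Longrightarrow> norm (fcoeff a (int n - s) * \<zeta> ^ n) \<le> norm a * weight s * (1 / (1 + real n) ^ 2)"
proof -
  assume "cmod \<zeta> \<le> 1"
  then have "norm (fcoeff a (int n - s) * \<zeta> ^ n) \<le> (norm a * weight s * (1 / (1 + real n) ^ 2)) * 1"
    unfolding norm_mult norm_power
    by (intro mult_mono order_trans[OF norm_fcoeff_shift] mult_left_mono invcube_le power_le_one) auto
  then show ?thesis by simp
qed

lemma disc_series_abs_summable: "cmod \<zeta> \<le> 1 \<Longrightarrow> summable (\<lambda>n. norm (fcoeff a (int n - s) * \<zeta> ^ n))"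
proof (rule summable_comparison_test'[OF summable_mult[OF summable_invsq, of "norm a * weight s"], of 0])
  assume \<zeta>: "cmod \<zeta> \<le> 1"
  show "norm (norm (fcoeff a (int n - s) * \<zeta> ^ n)) \<le> norm a * weight s * (1 / (1 + real n)^2)" for n
    using disc_series_term_bound[OF \<zeta>] by (simp only: real_norm_def abs_norm_cancel)
qed

lemma disc_series_summable: "cmod \<zeta> \<le> 1 \<Longrightarrow> summable (\<lambda>n. fcoeff a (int n - s) * \<zeta> ^ n)"
  by (rule summable_norm_cancel[OF disc_series_abs_summable])

lemma norm_disc_series_le: "cmod \<zeta> \<le> 1 \<Longrightarrow> norm (disc_series s a \<zeta>) \<le> norm a * (weight s * invsq_sum)"
proof -
  assume \<zeta>: "cmod \<zeta> \<le> 1"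
  have "norm (disc_series s a \<zeta>) \<le> (\<Sum>n. norm a * weight s * (1 / (1 + real n) ^ 2))"
    unfolding disc_series_def by (rule norm_suminf_le[OF disc_series_term_bound[OF \<zeta>] summable_mult[OF summable_invsq]])
  also have "\<dots> = norm a * (weight s * invsq_sum)"
    unfolding invsq_sum_def by (subst suminf_mult[OF summable_invsq]) simp
  finally show ?thesis .
qed

text \<open>\<open>|z^n - w^n| \<le> n |z - w|\<close> on the closed disc, and the cubic decay of
  the coefficients absorbs the factor n.\<close>

lemma disc_series_lipschitz:
  assumes "cmod z \<le> 1" "cmod w \<le> 1"
  shows "norm (disc_series s a z - disc_series s a w) \<le> norm a * (weight s * invsq_sum) * cmod (z - w)"
proof -
  have b: "norm (fcoeff a (int n - s) * z ^ n - fcoeff a (int n - s) * w ^ n) \<le> norm a * weight s * cmod (z - w) * (1 / (1 + real n) ^ 2)" for n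
  proof -
    have "norm (fcoeff a (int n - s) * z ^ n - fcoeff a (int n - s) * w ^ n) = norm (fcoeff a (int n - s)) * norm (z ^ n - w ^ n)"
      by (simp add: norm_mult flip: right_diff_distrib)
    also have "\<dots> \<le> (norm a * weight s * (1 / (1 + real n) ^ 3)) * (n * cmod (z - w))"
      using assms by (intro mult_mono norm_fcoeff_shift norm_power_diff) auto
    also have "\<dots> = (norm a * weight s * cmod (z - w)) * (1 / (1 + real n) ^ 3 * n)" by simp
    also have "\<dots> \<le> (norm a * weight s * cmod (z - w)) * (1 / (1 + real n) ^ 2)"
      by (intro mult_left_mono invcube_le) auto
    finally show ?thesis .
  qed
  have "disc_series s a z - disc_series s a w = (\<Sum>n. fcoeff a (int n - s) * z ^ n - fcoeff a (int n - s) * w ^ n)"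
    unfolding disc_series_def using assms by (intro suminf_diff disc_series_summable)
  also have "norm \<dots> \<le> (\<Sum>n. norm a * weight s * cmod (z - w) * (1 / (1 + real n) ^ 2))"
    by (rule norm_suminf_le[OF b summable_mult[OF summable_invsq]])
  also have "\<dots> = norm a * (weight s * invsq_sum) * cmod (z - w)"
    unfolding invsq_sum_def by (subst suminf_mult[OF summable_invsq]) simp
  finally show ?thesis .
qed

lemma disc_series_add: "cmod \<zeta> \<le> 1 \<Longrightarrow> disc_series s (a + b) \<zeta> = disc_series s a \<zeta> + disc_series s b \<zeta>"
  unfolding disc_series_def by (subst suminf_add[OF disc_series_summable disc_series_summable]) (auto simp: distrib_right)

lemma disc_series_scaleR: "cmod \<zeta> \<le> 1 \<Longrightarrow> disc_series s (r *\<^sub>R a) \<zeta> = r *\<^sub>R disc_series s a \<zeta>"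
  unfolding disc_series_def by (subst suminf_scaleR_right[OF disc_series_summable]) auto

lemma disc_series_0: "disc_series s a 0 = fcoeff a (- s)"
  unfolding disc_series_def by (simp add: powser_zero)

lemma disc_series_shift: "cmod \<zeta> \<le> 1 \<Longrightarrow> disc_series s a \<zeta> = fcoeff a (- s) + \<zeta> * disc_series (s - 1) a \<zeta>"
proof -
  assume \<zeta>: "cmod \<zeta> \<le> 1"
  have "disc_series s a \<zeta> - fcoeff a (- s) = (\<Sum>n. fcoeff a (int (Suc n) - s) * \<zeta> ^ Suc n)"
    unfolding disc_series_def using suminf_split_head[OF disc_series_summable[OF \<zeta>], of a s] by simp
  also have "\<dots> = (\<Sum>n. \<zeta> * (fcoeff a (int n - (s - 1)) * \<zeta> ^ n))"
    by (intro suminf_cong) (simp add: algebra_simps)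
  also have "\<dots> = \<zeta> * disc_series (s - 1) a \<zeta>"
    unfolding disc_series_def by (rule suminf_mult[OF disc_series_summable[OF \<zeta>]])
  finally show ?thesis by (simp add: algebra_simps)
qed

lemma continuous_on_disc_series: "continuous_on (cball 0 1) (disc_series s a)"
proof -
  have "(norm a * (weight s * invsq_sum))-lipschitz_on (cball 0 1) (disc_series s a)"
  proof (rule lipschitz_onI)
    have "0 \<le> norm (disc_series s a 0)" by simp
    also have "\<dots> \<le> norm a * (weight s * invsq_sum)" by (rule norm_disc_series_le) simp
    finally show "0 \<le> norm a * (weight s * invsq_sum)" .
  qed (use disc_series_lipschitz in \<open>auto simp: dist_norm\<close>)
  then show ?thesis by (rule lipschitz_on_continuous_on)
qed

lemma holomorphic_disc_series: "disc_series s a holomorphic_on ball 0 1"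
proof (rule power_series_holomorphic)
  fix w :: complex assume "w \<in> ball 0 1"
  then show "(\<lambda>n. fcoeff a (int n - s) * (w - 0) ^ n) sums disc_series s a w"
    unfolding disc_series_def using disc_series_summable[of w a s] by (simp add: summable_sums)
qed

text \<open>By \<open>disc_series_shift\<close> the difference quotient at 0 is the series with
  shift \<open>s - 1\<close>, which is continuous there.\<close>

lemma deriv_disc_series: "deriv (disc_series s a) 0 = fcoeff a (1 - s)"
proof (rule DERIV_imp_deriv)
  have "isCont (disc_series (s - 1) a) 0"
    using continuous_on_interior[OF continuous_on_disc_series, of 0] by (simp add: interior_cball)
  then have "(disc_series (s - 1) a \<longlongrightarrow> fcoeff a (1 - s)) (at 0)"
    by (simp add: isCont_def disc_series_0)
  then have "((\<lambda>z. (disc_series s a z - disc_series s a 0) / (z - 0)) \<longlongrightarrow> fcoeff a (1 - s)) (at 0)"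
  proof (rule Lim_transform_eventually)
    have "\<forall>\<^sub>F z in at (0::complex). z \<in> ball 0 1" by (intro eventually_at_in_open') auto
    moreover have "\<forall>\<^sub>F z in at (0::complex). z \<noteq> 0" by (simp add: eventually_at_filter)
    ultimately show "\<forall>\<^sub>F z in at 0. disc_series (s - 1) a z = (disc_series s a z - disc_series s a 0) / (z - 0)"
      by eventually_elim (simp add: disc_series_shift[of _ s a] disc_series_0)
  qed
  then show "(disc_series s a has_field_derivative fcoeff a (1 - s)) (at 0)"
    by (simp add: has_field_derivative_iff)
qed

text \<open>\<open>disc_series s\<close> discards the modes below \<open>- s\<close>, so the
  agreement with the Fourier series multiplied by \<open>\<zeta> powi s\<close> needs these modes to
  vanish.\<close>

lemma disc_series_circle:
  assumes \<zeta>: "cmod \<zeta> = 1" and supp: "\<And>n. n < - s \<Longrightarrow> fcoeff a n = 0"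
  shows "disc_series s a \<zeta> = \<zeta> powi s * series_at a \<zeta>"
proof -
  have z0: "\<zeta> \<noteq> 0" using \<zeta> by auto
  have inj: "inj (\<lambda>n. int n - s)" by (auto simp: inj_on_def)
  have ran: "range (\<lambda>n. int n - s) = {- s..}"
  proof safe
    fix x assume "x \<ge> - s"
    then show "x \<in> range (\<lambda>n. int n - s)" by (intro range_eqI[of _ _ "nat (x + s)"]) simp
  qed simp
  have "series_at a \<zeta> = (\<Sum>\<^sub>\<infinity>n\<in>{- s..}. fcoeff a n * \<zeta> powi n)"
    unfolding series_at_def by (rule infsum_cong_neutral) (auto simp: supp)
  also have "\<dots> = (\<Sum>\<^sub>\<infinity>n. fcoeff a (int n - s) * \<zeta> powi (int n - s))"
    using infsum_reindex[OF inj, of "\<lambda>n. fcoeff a n * \<zeta> powi n"] by (simp add: ran o_def)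
  finally have "\<zeta> powi s * series_at a \<zeta> = (\<Sum>\<^sub>\<infinity>n. \<zeta> powi s * (fcoeff a (int n - s) * \<zeta> powi (int n - s)))"
    by (simp add: infsum_cmult_right')
  also have "\<dots> = (\<Sum>\<^sub>\<infinity>n. fcoeff a (int n - s) * \<zeta> ^ n)"
    using z0 by (intro infsum_cong) (simp add: power_int_diff)
  also have "\<dots> = disc_series s a \<zeta>"
  proof -
    have \<zeta>': "cmod \<zeta> \<le> 1" using \<zeta> by simp
    show ?thesis unfolding disc_series_def
      by (rule infsumI[OF norm_summable_imp_has_sum[OF disc_series_abs_summable[OF \<zeta>'] summable_sums[OF disc_series_summable[OF \<zeta>']]]])
  qed
  finally show ?thesis by simp
qed

section \<open>The bounded linear map from Fourier data to Hoelder discs\<close>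

definition disc_map :: "wser^ix \<Rightarrow> complex \<Rightarrow> complex^4" where
  "disc_map v \<zeta> = (if \<zeta> \<in> cball 0 1 then (\<chi> i. if i = 1 then disc_series 1 (v$IA) \<zeta> else if i = 2 then disc_series 2 (v$IB) \<zeta>
     else if i = 3 then disc_series 0 (v$IP) \<zeta> else disc_series (-1) (v$IR) \<zeta>) else 0)"

lemma disc_map_nth:
  assumes "cmod \<zeta> \<le> 1"
  shows "disc_map v \<zeta> $ 1 = disc_series 1 (v$IA) \<zeta>" "disc_map v \<zeta> $ 2 = disc_series 2 (v$IB) \<zeta>"
    "disc_map v \<zeta> $ 3 = disc_series 0 (v$IP) \<zeta>" "disc_map v \<zeta> $ 4 = disc_series (-1) (v$IR) \<zeta>"
  using assms by (simp_all add: disc_map_def)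

text \<open>Four components, and 2 is the shift of largest weight among 1, 2, 0, -1.\<close>

definition disc_map_bound :: real where "disc_map_bound = 4 * (weight 2 * invsq_sum)"

lemma invsq_sum_nonneg: "invsq_sum \<ge> 0"
  unfolding invsq_sum_def by (rule suminf_nonneg[OF summable_invsq]) simp

lemma disc_map_add: "disc_map (u + v) z = disc_map u z + disc_map v z"
  by (auto simp: disc_map_def vec_eq_iff disc_series_add)

lemma disc_map_scaleR: "disc_map (c *\<^sub>R v) z = c *\<^sub>R disc_map v z"
  by (auto simp: disc_map_def vec_eq_iff disc_series_scaleR)

lemma disc_map_diff: "disc_map (u - v) z = disc_map u z - disc_map v z"
  using disc_map_add[of u "- v" z] disc_map_scaleR[of "-1" v z] by simp

lemma norm_disc_map_aux:
  assumes "\<And>i. norm ((x :: complex^4) $ i) \<le> B" shows "norm x \<le> 4 * B"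
proof -
  have "norm x \<le> (\<Sum>i\<in>UNIV. norm (x $ i))" unfolding norm_vec_def by (rule L2_set_le_sum) simp
  also have "\<dots> \<le> (\<Sum>i\<in>(UNIV::4 set). B)" by (intro sum_mono assms)
  finally show ?thesis by simp
qed

lemma weight_shift_mono: "weight s * invsq_sum \<le> weight 2 * invsq_sum" if "s \<in> {-1, 0, 1, 2}"
  using that invsq_sum_nonneg by (intro mult_right_mono) (auto simp: weight_def)

lemma norm_disc_map_le: "norm (disc_map v z) \<le> norm v * disc_map_bound"
proof (cases "cmod z \<le> 1")
  case True
  have *: "norm (disc_series s (v$j) z) \<le> norm v * (weight 2 * invsq_sum)" if "s \<in> {-1, 0, 1, 2}" for s j
    using norm_disc_series_le[OF True, of s "v$j"] mult_mono[OF Finite_Cartesian_Product.norm_nth_le[of v j] weight_shift_mono[OF that]] invsq_sum_nonneg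
    by (meson order_trans norm_ge_zero mult_nonneg_nonneg weight_pos(3))
  have "norm (disc_map v z) \<le> 4 * (norm v * (weight 2 * invsq_sum))"
    by (rule norm_disc_map_aux) (use True in \<open>auto simp: disc_map_def intro: *\<close>)
  then show ?thesis by (simp add: disc_map_bound_def)
qed (use invsq_sum_nonneg in \<open>auto simp: disc_map_def disc_map_bound_def\<close>)

lemma disc_map_lipschitz:
  assumes "z \<in> cball 0 1" "w \<in> cball 0 1"
  shows "norm (disc_map v z - disc_map v w) \<le> norm v * disc_map_bound * cmod (z - w)"
proof -
  have zw: "cmod z \<le> 1" "cmod w \<le> 1" using assms by auto
  have *: "norm (disc_series s (v$j) z - disc_series s (v$j) w) \<le> norm v * (weight 2 * invsq_sum) * cmod (z - w)" if "s \<in> {-1, 0, 1, 2}" for s j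
    using disc_series_lipschitz[OF zw, of s "v$j"] mult_right_mono[OF mult_mono[OF Finite_Cartesian_Product.norm_nth_le[of v j] weight_shift_mono[OF that]], of "cmod (z - w)"] invsq_sum_nonneg
    by (meson order_trans norm_ge_zero mult_nonneg_nonneg weight_pos(3))
  have "norm (disc_map v z - disc_map v w) \<le> 4 * (norm v * (weight 2 * invsq_sum) * cmod (z - w))"
    by (rule norm_disc_map_aux) (use zw in \<open>auto simp: disc_map_def intro: *\<close>)
  then show ?thesis by (simp add: disc_map_bound_def mult_ac)
qed

context
  fixes \<alpha> :: real
  assumes \<alpha>: "0 < \<alpha>" "\<alpha> < 1"
begin

text \<open>Points of the disc have distance at most 2, so passing from Lipschitz to Hoelder costs
  at most the factor \<open>2 powr (1 - \<alpha>) \<le> 2\<close>.\<close>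

lemma disc_map_hoelder:
  assumes "z \<in> cball 0 1" "w \<in> cball 0 1"
  shows "norm (disc_map v z - disc_map v w) \<le> (norm v * disc_map_bound * 2) * cmod (z - w) powr \<alpha>"
proof -
  have d: "cmod (z - w) \<le> 2" using assms norm_triangle_ineq4[of z w] by simp
  have "cmod (z - w) = cmod (z - w) powr (1 - \<alpha>) * cmod (z - w) powr \<alpha>"
    by (simp flip: powr_add)
  also have "\<dots> \<le> 2 * cmod (z - w) powr \<alpha>"
  proof (rule mult_right_mono)
    have "cmod (z - w) powr (1 - \<alpha>) \<le> 2 powr (1 - \<alpha>)" using d \<alpha> by (intro powr_mono2) auto
    also have "\<dots> \<le> 2 powr 1" using \<alpha> by (intro powr_mono) auto
    finally show "cmod (z - w) powr (1 - \<alpha>) \<le> 2" by simp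
  qed simp
  finally have "norm v * disc_map_bound * cmod (z - w) \<le> norm v * disc_map_bound * (2 * cmod (z - w) powr \<alpha>)"
    using invsq_sum_nonneg by (intro mult_left_mono) (auto simp: disc_map_bound_def)
  with disc_map_lipschitz[OF assms, of v] show ?thesis by (simp add: mult_ac)
qed

lemma disc_map_in_Aalpha: "disc_map v \<in> Aalpha \<alpha>"
proof -
  have "(\<lambda>z. disc_map v z $ i) holomorphic_on ball 0 1" for i
  proof -
    have "(\<lambda>z. if i = 1 then disc_series 1 (v$IA) z else if i = 2 then disc_series 2 (v$IB) z
     else if i = 3 then disc_series 0 (v$IP) z else disc_series (-1) (v$IR) z) holomorphic_on ball 0 1"
      using holomorphic_disc_series by (cases "i = 1"; cases "i = 2"; cases "i = 3"; simp)
    then show ?thesis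
      by (rule holomorphic_transform) (simp add: disc_map_def)
  qed
  then show ?thesis
    unfolding Aalpha_def using disc_map_hoelder
    by (intro CollectI conjI exI[of _ "norm v * disc_map_bound * 2"] allI ballI impI) (auto simp: disc_map_def)
qed

lemma hnorm_disc_map: "0 \<le> hnorm \<alpha> (disc_map v)" "hnorm \<alpha> (disc_map v) \<le> norm v * (disc_map_bound * 3)"
  using hnorm_le[of "disc_map v" "norm v * disc_map_bound" "norm v * disc_map_bound * 2" \<alpha>, OF norm_disc_map_le disc_map_hoelder]
  by (auto simp: algebra_simps)

lemma hC0_disc_map:
  assumes "continuous_on W g"
  shows "hC0 \<alpha> (\<lambda>x. disc_map (g x)) W"
  unfolding hC0_def
proof (intro conjI ballI allI impI)
  fix x and e :: real assume x: "x \<in> W" and e: "e > 0"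
  define K where "K = disc_map_bound * 3 + 1"
  have K: "K > 0" "disc_map_bound * 3 \<le> K" using invsq_sum_nonneg by (simp_all add: K_def disc_map_bound_def add_nonneg_pos)
  obtain d where d: "d > 0" "\<And>y. y \<in> W \<Longrightarrow> dist y x < d \<Longrightarrow> dist (g y) (g x) < e / K"
    using assms x divide_pos_pos[OF e K(1)] unfolding continuous_on_iff by blast
  have "hnorm \<alpha> (\<lambda>z. disc_map (g y) z - disc_map (g x) z) < e" if y: "y \<in> W" "norm (y - x) < d" for y
  proof -
    have "hnorm \<alpha> (\<lambda>z. disc_map (g y) z - disc_map (g x) z) = hnorm \<alpha> (disc_map (g y - g x))"
      by (simp flip: disc_map_diff)
    also have "\<dots> \<le> norm (g y - g x) * K"
      using hnorm_disc_map(2)[of "g y - g x"] mult_left_mono[OF K(2), of "norm (g y - g x)"] by simp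
    also have "\<dots> < e" using d(2)[OF y(1)] y(2) K by (simp add: dist_norm field_simps)
    finally show ?thesis .
  qed
  with d(1) show "\<exists>d>0. \<forall>y\<in>W. norm (y - x) < d \<longrightarrow> hnorm \<alpha> (\<lambda>z. disc_map (g y) z - disc_map (g x) z) < e" by blast
qed (rule disc_map_in_Aalpha)

text \<open>\<open>disc_map\<close> is linear and bounded into the Hoelder space, so the remainder
  of the composite is the image of the remainder of \<open>g\<close>.\<close>

lemma hderiv_disc_map:
  assumes g: "(g has_derivative g') (at x)"
  shows "hderiv \<alpha> (\<lambda>x. disc_map (g x)) (\<lambda>h. disc_map (g' h)) x"
  unfolding hderiv_def
proof (intro conjI allI)
  interpret g': bounded_linear g' using g by (rule has_derivative_bounded_linear)
  show "disc_map (g' (u + v)) z = disc_map (g' u) z + disc_map (g' v) z" for u v z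
    by (simp add: g'.add disc_map_add)
  show "disc_map (g' (c *\<^sub>R u)) z = c *\<^sub>R disc_map (g' u) z" for c u z
    by (simp add: g'.scaleR disc_map_scaleR)
  show "disc_map (g' u) \<in> Aalpha \<alpha>" for u by (rule disc_map_in_Aalpha)
  have "((\<lambda>h. norm (g (x + h) - g x - g' h) / norm h) \<longlongrightarrow> 0) (at 0)"
    using g by (simp add: has_derivative_at)
  then have lim: "((\<lambda>h. (norm (g (x + h) - g x - g' h) / norm h) * (disc_map_bound * 3)) \<longlongrightarrow> 0) (at 0)"
    by (rule tendsto_mult_left_zero)
  have eq: "(\<lambda>z. disc_map (g (x + h)) z - disc_map (g x) z - disc_map (g' h) z) = disc_map (g (x + h) - g x - g' h)" for h
    by (simp add: fun_eq_iff disc_map_diff)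
  show "((\<lambda>h. hnorm \<alpha> (\<lambda>z. disc_map (g (x + h)) z - disc_map (g x) z - disc_map (g' h) z) / norm h) \<longlongrightarrow> 0) (at 0)"
    unfolding eq
  proof (rule tendsto_sandwich[OF _ _ tendsto_const lim])
    show "\<forall>\<^sub>F h in at 0. 0 \<le> hnorm \<alpha> (disc_map (g (x + h) - g x - g' h)) / norm h"
      by (simp add: hnorm_disc_map)
    show "\<forall>\<^sub>F h in at 0. hnorm \<alpha> (disc_map (g (x + h) - g x - g' h)) / norm h
        \<le> norm (g (x + h) - g x - g' h) / norm h * (disc_map_bound * 3)"
      using divide_right_mono[OF hnorm_disc_map(2) norm_ge_zero] by (intro always_eventually allI) simp
  qed
qed

text \<open>\<open>Ck\<close> has the recursive shape of \<open>hCk\<close>, so each induction step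
  only moves a derivative through the linear map \<open>disc_map\<close>.\<close>

lemma hCk_disc_map: "Ck k g W \<Longrightarrow> hCk k \<alpha> (\<lambda>x. disc_map (g x)) W"
proof (induction k arbitrary: g)
  case 0
  then show ?case by (simp add: hC0_disc_map)
next
  case (Suc k)
  have "Ck 0 g W" using Suc.prems by (induction k) (use Ck_SucD in blast)+
  then have "hC0 \<alpha> (\<lambda>x. disc_map (g x)) W" by (simp add: hC0_disc_map)
  moreover obtain D where D: "\<forall>x\<in>W. (g has_derivative D x) (at x)" "\<forall>b\<in>Basis. Ck k (\<lambda>x. D x b) W"
    using Suc.prems by auto
  ultimately show ?case
    unfolding hCk.simps
    using Suc.IH by (intro conjI exI[of _ "\<lambda>x h. disc_map (D x h)"]) (auto intro!: hderiv_disc_map)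
qed

end

section \<open>Membership in the conormal fibration\<close>

lemma has_real_derivative_Re:
  assumes "(f has_field_derivative f') (at 0)"
  shows "((\<lambda>t::real. Re (f (of_real t))) has_real_derivative Re f') (at 0)"
proof -
  have "((\<lambda>t::real. f (of_real t)) has_vector_derivative f') (at 0)"
    using assms by (intro has_vector_derivative_real_field) simp
  from bounded_linear.has_vector_derivative[OF bounded_linear_Re this]
  show ?thesis by (simp add: has_real_derivative_iff_has_vector_derivative)
qed

lemma has_real_derivative_cmod_power2:
  "((\<lambda>t::real. (cmod (z + d * of_real t))^2) has_real_derivative 2 * Re (cnj d * z)) (at 0)"
  unfolding cmod_power2 by (auto intro!: derivative_eq_intros simp: algebra_simps)

text \<open>The derivative of \<open>rho\<close> along \<open>d\<close> is twice the real part of d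
  times the Wirtinger derivative, so combining \<open>d = 1\<close> with \<open>d = \<i>\<close>
  returns that derivative.\<close>

lemma wirt_rho:
  fixes z w :: complex and lam :: real
  shows
  "wirt1 (rho lam) (z, w) = cnj z - 2 * lam * z^3 * (cnj w)^2"
  "wirt2 (rho lam) (z, w) = cnj w - lam * (cnj z)^4 * w"
proof -
  have d1: "((\<lambda>t. rho lam (z + d * of_real t, w)) has_real_derivative
      2 * Re (cnj d * z) + 0 - lam * Re (4 * (cnj z)^3 * cnj d * w^2) - 0) (at 0)" for d
    unfolding rho_def fst_conv snd_conv
  proof (intro DERIV_diff DERIV_add DERIV_const DERIV_cmult has_real_derivative_cmod_power2)
    have "((\<lambda>u. (cnj z + cnj d * u)^4 * w^2) has_field_derivative 4 * (cnj z)^3 * cnj d * w^2) (at 0)"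
      by (auto intro!: derivative_eq_intros)
    from has_real_derivative_Re[OF this]
    show "((\<lambda>t. Re ((cnj (z + d * of_real t))^4 * w^2)) has_real_derivative Re (4 * (cnj z)^3 * cnj d * w^2)) (at 0)"
      by simp
  qed
  have d2: "((\<lambda>t. rho lam (z, w + d * of_real t)) has_real_derivative
      0 + 2 * Re (cnj d * w) - lam * Re ((cnj z)^4 * (2 * w * d)) - 0) (at 0)" for d
    unfolding rho_def fst_conv snd_conv
  proof (intro DERIV_diff DERIV_add DERIV_const DERIV_cmult has_real_derivative_cmod_power2)
    have "((\<lambda>u. (cnj z)^4 * (w + d * u)^2) has_field_derivative (cnj z)^4 * (2 * w * d)) (at 0)"
      by (auto intro!: derivative_eq_intros)
    from has_real_derivative_Re[OF this]
    show "((\<lambda>t. Re ((cnj z)^4 * (w + d * of_real t)^2)) has_real_derivative Re ((cnj z)^4 * (2 * w * d))) (at 0)"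
      by simp
  qed
  have e1: "(complex_of_real (2 * Re (cnj 1 * z)) - \<i> * complex_of_real (2 * Re (cnj \<i> * z))) / 2 = cnj z" for z :: complex
    by (simp add: complex_eq_iff)
  have e2: "(complex_of_real (lam * Re (2 * cnj u)) - \<i> * complex_of_real (lam * Re (2 * cnj (\<i> * u)))) / 2 = lam * u" for u :: complex
    by (simp add: complex_eq_iff)
  have "wirt1 (rho lam) (z, w) = (complex_of_real (2 * Re (cnj 1 * z) - lam * Re (4 * (cnj z)^3 * cnj 1 * w^2))
     - \<i> * complex_of_real (2 * Re (cnj \<i> * z) - lam * Re (4 * (cnj z)^3 * cnj \<i> * w^2))) / 2"
    using DERIV_imp_deriv[OF d1[of 1]] DERIV_imp_deriv[OF d1[of \<i>]] by (simp add: wirt1_def)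
  also have "\<dots> = (complex_of_real (2 * Re (cnj 1 * z)) - \<i> * complex_of_real (2 * Re (cnj \<i> * z))) / 2
     - (complex_of_real (lam * Re (2 * cnj (2 * z^3 * (cnj w)^2)))
        - \<i> * complex_of_real (lam * Re (2 * cnj (\<i> * (2 * z^3 * (cnj w)^2))))) / 2"
    by (simp add: complex_eq_iff field_simps)
  finally have "wirt1 (rho lam) (z, w) = cnj z - lam * (2 * z^3 * (cnj w)^2)"
    by (simp only: e1 e2)
  then show "wirt1 (rho lam) (z, w) = cnj z - 2 * lam * z^3 * (cnj w)^2"
    by simp
  have "wirt2 (rho lam) (z, w) = (complex_of_real (2 * Re (cnj 1 * w) - lam * Re ((cnj z)^4 * (2 * w * 1)))
     - \<i> * complex_of_real (2 * Re (cnj \<i> * w) - lam * Re ((cnj z)^4 * (2 * w * \<i>)))) / 2"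
    using DERIV_imp_deriv[OF d2[of 1]] DERIV_imp_deriv[OF d2[of \<i>]] by (simp add: wirt2_def)
  also have "\<dots> = cnj w - lam * (cnj z)^4 * w"
    by (simp add: complex_eq_iff field_simps)
  finally show "wirt2 (rho lam) (z, w) = cnj w - lam * (cnj z)^4 * w" .
qed

text \<open>For unimodular \<open>\<zeta>\<close>, \<open>rho\<close> is invariant under (z, w) to
  (zeta z, zeta^2 w), so its derivatives scale by the inverse factors. The factor
  \<open>\<zeta>\<close> in \<open>NM\<close> and the choice \<open>r = \<zeta> * P$4\<close> cancel
  these, leaving constant coefficients.\<close>

lemma mem_NM_iff:
  fixes \<zeta> a b p r :: complex and P :: "complex^4"
  assumes \<zeta>: "cmod \<zeta> = 1"
  defines "a \<equiv> cnj \<zeta> * P$1" and "b \<equiv> (cnj \<zeta>)^2 * P$2" and "p \<equiv> P$3" and "r \<equiv> \<zeta> * P$4"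
  shows "P \<in> NM (rho lam) \<zeta> \<longleftrightarrow>
    (cmod a)^2 + (cmod b)^2 - lam * Re ((cnj a)^4 * b^2) = 1 \<and>
    (\<exists>c::real. p = c * (cnj a - 2 * lam * a^3 * (cnj b)^2) \<and> r = c * (cnj b - lam * (cnj a)^4 * b)) \<and>
    (p \<noteq> 0 \<or> r \<noteq> 0)"
proof -
  have z0: "\<zeta> \<noteq> 0" and zz: "\<zeta> * cnj \<zeta> = 1" using \<zeta> complex_norm_square[of \<zeta>] by auto
  have zi: "cnj \<zeta> = inverse \<zeta>" using zz by (intro inverse_unique[symmetric])
  have P: "P$1 = \<zeta> * a" "P$2 = \<zeta>^2 * b" "P$3 = p" "P$4 = inverse \<zeta> * r"
    using z0 by (simp_all add: a_def b_def p_def r_def zi field_simps)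
  have "(cnj (P$1))^4 * (P$2)^2 = (cnj a)^4 * b^2"
    using z0 by (simp add: P zi field_simps)
  then have 1: "rho lam (P$1, P$2) = (cmod a)^2 + (cmod b)^2 - lam * Re ((cnj a)^4 * b^2) - 1"
    using \<zeta> by (simp add: rho_def) (simp add: P norm_mult norm_power)
  have 2: "\<zeta> * c * fst (dbar_grad (rho lam) (P$1, P$2)) = c * (cnj a - 2 * lam * a^3 * (cnj b)^2)" for c
    unfolding dbar_grad_def wirt_rho fst_conv P using z0
    by (simp add: zi field_simps power2_eq_square power3_eq_cube)
  have 3: "inverse \<zeta> * r = \<zeta> * c * snd (dbar_grad (rho lam) (P$1, P$2)) \<longleftrightarrow> r = c * (cnj b - lam * (cnj a)^4 * b)" for c
  proof -
    have e: "\<zeta> * c * snd (dbar_grad (rho lam) (P$1, P$2)) = inverse \<zeta> * (c * (cnj b - lam * (cnj a)^4 * b))"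
      unfolding dbar_grad_def wirt_rho snd_conv P using z0
      by (simp add: zi field_simps power2_eq_square power4_eq_xxxx)
    show ?thesis unfolding e using z0 by simp
  qed
  show ?thesis
    unfolding NM_def mem_Collect_eq 1 2 prod.inject P(3,4) 3 using z0 by auto
qed

text \<open>With a real multiplier c, \<open>a p + 2 b r\<close> is c times
  \<open>a A + 2 b D\<close>, which is real because \<open>rho\<close> is constant along the circle
  action: the terms \<open>y\<close> and \<open>cnj y\<close> pair up.\<close>

lemma NM_imp_stat_eqs:
  assumes "P \<in> NM (rho lam) \<zeta>" and \<zeta>: "cmod \<zeta> = 1"
  shows "stat_eqs lam (cnj \<zeta> * P$1) ((cnj \<zeta>)^2 * P$2) (P$3) (\<zeta> * P$4)"
proof -
  define a b where "a = cnj \<zeta> * P$1" and "b = (cnj \<zeta>)^2 * P$2"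
  obtain c :: real where c: "P$3 = c * (cnj a - 2 * lam * a^3 * (cnj b)^2)" "\<zeta> * P$4 = c * (cnj b - lam * (cnj a)^4 * b)"
    and 1: "(cmod a)^2 + (cmod b)^2 - lam * Re ((cnj a)^4 * b^2) = 1"
    using assms mem_NM_iff[OF \<zeta>, of P lam] by (auto simp: a_def b_def)
  define y where "y = a^4 * (cnj b)^2"
  have y: "cnj y = (cnj a)^4 * b^2" by (simp add: y_def)
  have "a * (P$3) + 2 * b * (\<zeta> * P$4) = c * (a * cnj a + 2 * (b * cnj b) - 2 * lam * (y + cnj y))"
    unfolding c y by (simp add: y_def algebra_simps power2_eq_square power3_eq_cube power4_eq_xxxx)
  then have "Im (a * (P$3) + 2 * b * (\<zeta> * P$4)) = 0" by simp
  with 1 show ?thesis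
    unfolding stat_eqs_def a_def[symmetric] b_def[symmetric] by (simp add: c mult_ac)
qed

text \<open>Near f0 the multiplier can be recovered: \<open>A \<noteq> 0\<close> gives a complex
  \<open>t = p / A\<close>, and reality of \<open>a p + 2 b r\<close> makes it real because
  \<open>a A + 2 b D\<close> is real and nonzero.\<close>

lemma stat_eqs_imp_NM:
  obtains d where "d > 0" "\<And>\<zeta> P. \<lbrakk>cmod \<zeta> = 1; norm (P$1 - \<zeta>, P$2, P$3 - 1, P$4) < d;
    stat_eqs lam (cnj \<zeta> * P$1) ((cnj \<zeta>)^2 * P$2) (P$3) (\<zeta> * P$4)\<rbrakk> \<Longrightarrow> P \<in> NM (rho lam) \<zeta>"
proof -
  define A where "A a b = cnj a - 2 * lam * a^3 * (cnj b)^2" for a b :: complex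
  define D where "D a b = cnj b - lam * (cnj a)^4 * b" for a b :: complex
  \<comment> \<open>Collects the three quantities that must not vanish; at the origin all of them
    equal 1, so a single radius serves.\<close>
  define f :: "complex \<times> complex \<times> complex \<Rightarrow> complex \<times> complex \<times> complex"
    where "f = (\<lambda>(a, b, p). (A (1 + a) b, (1 + a) * A (1 + a) b + 2 * b * D (1 + a) b, 1 + p))"
  have "isCont f (0 :: complex \<times> complex \<times> complex)"
    unfolding f_def A_def D_def case_prod_unfold by (intro continuous_intros)
  moreover have f0: "f 0 = (1, 1, 1)" by (simp add: f_def A_def D_def zero_prod_def)
  ultimately obtain d where d: "d > 0" "\<And>u. norm u < d \<Longrightarrow> dist (f u) (1, 1, 1) < 1"
    unfolding continuous_at_eps_delta by (metis dist_0_norm dist_commute zero_less_one)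
  have near: "A (1 + a) b \<noteq> 0 \<and> Re ((1 + a) * A (1 + a) b + 2 * b * D (1 + a) b) \<noteq> 0 \<and> 1 + p \<noteq> 0"
    if "norm (a, b, p) < d" for a b p :: complex
  proof -
    have l: "dist (f (a, b, p)) (1, 1, 1) < 1" using d(2)[OF that] .
    have *: "dist x 1 < 1" "dist y 1 < 1" "dist z 1 < 1" if "dist (x, y, z) (1, 1, 1 :: complex) < 1" for x y z :: complex
      using dist_fst_le[of "(x, y, z)" "(1, 1, 1)"] dist_snd_le[of "(x, y, z)" "(1, 1, 1)"]
        dist_fst_le[of "(y, z)" "(1, 1)"] dist_snd_le[of "(y, z)" "(1, 1)"] that by auto
    have nz: "Re x \<noteq> 0" if "dist x (1 :: complex) < 1" for x
      using that abs_Re_le_cmod[of "x - 1"] by (auto simp: dist_norm)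
    show ?thesis
      using *[OF l[unfolded f_def prod.case]] nz[of "A (1 + a) b"] nz[of "1 + p"] nz by fastforce
  qed
  show thesis
  proof (rule that[OF d(1)])
    fix \<zeta> :: complex and P :: "complex^4"
    assume \<zeta>: "cmod \<zeta> = 1" and nP: "norm (P$1 - \<zeta>, P$2, P$3 - 1, P$4) < d"
      and eq: "stat_eqs lam (cnj \<zeta> * P$1) ((cnj \<zeta>)^2 * P$2) (P$3) (\<zeta> * P$4)"
    define a b p r where abpr: "a = cnj \<zeta> * P$1" "b = (cnj \<zeta>)^2 * P$2" "p = P$3" "r = \<zeta> * P$4"
    have "a - 1 = cnj \<zeta> * (P$1 - \<zeta>)"
      using \<zeta> complex_norm_square[of \<zeta>] by (simp add: abpr algebra_simps)
    then have "cmod (a - 1) = cmod (P$1 - \<zeta>)" "cmod b = cmod (P$2)" using \<zeta> by (simp_all add: norm_mult norm_power abpr)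
    then have "norm (a - 1, b, p - 1) \<le> norm (P$1 - \<zeta>, P$2, P$3 - 1, P$4)"
      by (simp add: norm_Pair abpr)
    then have "norm (a - 1, b, p - 1) < d" using nP by linarith
    from near[OF this] have nz: "A a b \<noteq> 0" "Re (a * A a b + 2 * b * D a b) \<noteq> 0" "p \<noteq> 0" by auto
    have e: "(cmod a)^2 + (cmod b)^2 - lam * Re ((cnj a)^4 * b^2) = 1"
      "Im (a * p + 2 * b * r) = 0" "r * A a b = p * D a b"
      using eq unfolding stat_eqs_def abpr[symmetric] A_def D_def by auto
    define t where "t = p / A a b"
    have p: "p = t * A a b" and r: "r = t * D a b" using nz e(3) by (simp_all add: t_def field_simps)
    define y where "y = a^4 * (cnj b)^2"
    have y: "cnj y = (cnj a)^4 * b^2" by (simp add: y_def)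
    have "a * A a b + 2 * b * D a b = a * cnj a + 2 * (b * cnj b) - 2 * lam * (y + cnj y)"
      unfolding y by (simp add: A_def D_def y_def algebra_simps power2_eq_square power3_eq_cube power4_eq_xxxx)
    then have im: "Im (a * A a b + 2 * b * D a b) = 0" by simp
    have "a * p + 2 * b * r = t * (a * A a b + 2 * b * D a b)" by (simp add: p r algebra_simps)
    then have "Im t * Re (a * A a b + 2 * b * D a b) = 0"
      using e(2) im by (metis add.commute add_0 mult_zero_right times_complex.simps(2))
    then have "t = of_real (Re t)" using nz by (simp add: complex_eq_iff)
    then have "\<exists>c::real. p = c * A a b \<and> r = c * D a b" using p r by metis
    then show "P \<in> NM (rho lam) \<zeta>"
      using mem_NM_iff[OF \<zeta>, of P lam] e(1) nz(3) by (simp add: A_def D_def flip: abpr)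
  qed
qed

section \<open>The parametrised family of lifts\<close>

definition params :: "(complex \<Rightarrow> complex^4) \<Rightarrow> real^8" where
  "params F = (\<chi> i. if i = 1 then Re (F 0 $ 1) else if i = 2 then Im (F 0 $ 1)
    else if i = 3 then Im (deriv (\<lambda>z. F z $ 1) 0) else if i = 4 then Re (F 0 $ 3)
    else if i = 5 then Re (F 0 $ 2) else if i = 6 then Im (F 0 $ 2)
    else if i = 7 then Re (deriv (\<lambda>z. F z $ 2) 0) else Im (deriv (\<lambda>z. F z $ 2) 0))"

text \<open>The Taylor data on the Fourier side: since z = zeta a and w = zeta^2 b, orders 0 and 1
  sit at the modes -1, 0 of a and -2, -1 of b.\<close>

definition params_fcoeff :: "wser^ix \<Rightarrow> real^8" where
  "params_fcoeff v = (\<chi> i. if i = 1 then Re (fcoeff (v$IA) (-1)) else if i = 2 then Im (fcoeff (v$IA) (-1))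
    else if i = 3 then Im (fcoeff (v$IA) 0) else if i = 4 then Re (fcoeff (v$IP) 0)
    else if i = 5 then Re (fcoeff (v$IB) (-2)) else if i = 6 then Im (fcoeff (v$IB) (-2))
    else if i = 7 then Re (fcoeff (v$IB) (-1)) else Im (fcoeff (v$IB) (-1)))"

lemma norm_vec8_le:
  assumes "\<And>i. \<bar>(x :: real^8) $ i\<bar> \<le> B" shows "norm x \<le> 8 * B"
proof -
  have "norm x \<le> (\<Sum>i\<in>UNIV. \<bar>x $ i\<bar>)" by (rule norm_le_l1_cart)
  also have "\<dots> \<le> (\<Sum>i\<in>(UNIV::8 set). B)" by (intro sum_mono assms)
  finally show ?thesis by simp
qed

lemma bounded_linear_params_fcoeff: "bounded_linear params_fcoeff"
proof (rule bounded_linear_intro[of _ 8])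
  fix v :: "wser^ix"
  have "norm (fcoeff (v$j) n) \<le> norm v" for j n
  proof -
    have "norm (fcoeff (v$j) n) * 1 \<le> norm (fcoeff (v$j) n) * weight n" by (intro mult_left_mono weight_ge_1) auto
    also have "\<dots> \<le> norm (v$j)" by (rule norm_fcoeff_weight)
    also have "\<dots> \<le> norm v" by (rule Finite_Cartesian_Product.norm_nth_le)
    finally show ?thesis by simp
  qed
  then have "\<bar>Re (fcoeff (v$j) n)\<bar> \<le> norm v" "\<bar>Im (fcoeff (v$j) n)\<bar> \<le> norm v" for j n
    using abs_Re_le_cmod abs_Im_le_cmod order_trans by blast+
  then have "norm (params_fcoeff v) \<le> 8 * norm v"
    by (intro norm_vec8_le) (simp add: params_fcoeff_def)
  then show "norm (params_fcoeff v) \<le> norm v * 8" by simp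
qed (simp_all add: params_fcoeff_def vec_eq_iff)

lemma params_disc_map: "params (disc_map v) = params_fcoeff v"
proof -
  have series_at: "\<forall>\<^sub>F z in nhds (0::complex). z \<in> ball 0 1" by (intro eventually_nhds_in_open) auto
  have "deriv (\<lambda>z. disc_map v z $ 1) 0 = deriv (disc_series 1 (v$IA)) 0"
    by (rule deriv_cong_ev) (use series_at in \<open>auto elim!: eventually_mono simp: disc_map_nth\<close>)
  moreover have "deriv (\<lambda>z. disc_map v z $ 2) 0 = deriv (disc_series 2 (v$IB)) 0"
    by (rule deriv_cong_ev) (use series_at in \<open>auto elim!: eventually_mono simp: disc_map_nth\<close>)
  ultimately show ?thesis
    unfolding params_def params_fcoeff_def by (simp add: deriv_disc_series disc_map_nth disc_series_0 cong: if_cong)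
qed

text \<open>Derivatives at 0 are bounded by the sup norm through the Cauchy inequality on the unit
  disc, and 8 counts the components. Both the openness of the neighborhood and the continuity of the
  inverse chart rest on this.\<close>

lemma params_lipschitz:
  assumes F: "F \<in> Aalpha \<alpha>" and G: "G \<in> Aalpha \<alpha>" and \<alpha>: "\<alpha> > 0"
    and e: "\<And>z. z \<in> cball 0 1 \<Longrightarrow> norm (F z - G z) \<le> e"
  shows "norm (params F - params G) \<le> 8 * e"
proof (rule norm_vec8_le)
  note alg = Aalpha_disc_alg[OF F \<alpha>] Aalpha_disc_alg[OF G \<alpha>]
  have c: "cmod (F z $ i - G z $ i) \<le> e" if "z \<in> cball 0 1" for z i
    using Finite_Cartesian_Product.norm_nth_le[of "F z - G z" i] e[OF that] by simp
  have d: "cmod (deriv (\<lambda>z. F z $ i) 0 - deriv (\<lambda>z. G z $ i) 0) \<le> e" for i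
  proof -
    have "(\<lambda>z. F z $ i) field_differentiable (at 0)" "(\<lambda>z. G z $ i) field_differentiable (at 0)"
      using alg[of i] unfolding disc_alg_def
      by (meson centre_in_ball holomorphic_on_imp_differentiable_at open_ball zero_less_one)+
    then have "deriv (\<lambda>z. F z $ i) 0 - deriv (\<lambda>z. G z $ i) 0 = deriv (\<lambda>z. F z $ i - G z $ i) 0"
      by simp
    also have "cmod \<dots> \<le> fact 1 * e / 1 ^ 1"
    proof -
      have "cmod ((deriv ^^ 1) (\<lambda>z. F z $ i - G z $ i) 0) \<le> fact 1 * e / 1 ^ 1"
        by (rule Cauchy_inequality) (use disc_alg_diff[OF alg(1)[of i] alg(2)[of i]] c in \<open>auto simp: disc_alg_def\<close>)
      then show ?thesis by simp
    qed
    finally show ?thesis by simp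
  qed
  have "\<bar>Re (F 0 $ i) - Re (G 0 $ i)\<bar> \<le> e" "\<bar>Im (F 0 $ i) - Im (G 0 $ i)\<bar> \<le> e"
    "\<bar>Re (deriv (\<lambda>z. F z $ i) 0) - Re (deriv (\<lambda>z. G z $ i) 0)\<bar> \<le> e"
    "\<bar>Im (deriv (\<lambda>z. F z $ i) 0) - Im (deriv (\<lambda>z. G z $ i) 0)\<bar> \<le> e" for i
    using abs_Re_le_cmod[of "F 0 $ i - G 0 $ i"] abs_Im_le_cmod[of "F 0 $ i - G 0 $ i"] c[of 0 i]
      abs_Re_le_cmod[of "deriv (\<lambda>z. F z $ i) 0 - deriv (\<lambda>z. G z $ i) 0"]
      abs_Im_le_cmod[of "deriv (\<lambda>z. F z $ i) 0 - deriv (\<lambda>z. G z $ i) 0"] d[of i] by auto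
  then show "\<bar>(params F - params G) $ i\<bar> \<le> e" for i
    by (simp add: params_def)
qed

definition base :: "wser^ix" where
  "base = (\<chi> i. case i of IA \<Rightarrow> single_mode 0 1 | IP \<Rightarrow> single_mode 0 1 | _ \<Rightarrow> 0)"

lemma disc_series_single_mode: "k = int m - s \<Longrightarrow> disc_series s (single_mode k c) \<zeta> = c * \<zeta> ^ m"
proof -
  assume k: "k = int m - s"
  have "(\<lambda>n. fcoeff (single_mode k c) (int n - s) * \<zeta> ^ n) = (\<lambda>n. if n = m then c * \<zeta> ^ n else 0)"
    by (auto simp: k)
  then show ?thesis
    unfolding disc_series_def using sums_unique[OF sums_single[of m "\<lambda>n. c * \<zeta> ^ n"]] by simp
qed

lemma disc_map_base: "disc_map base = f0lift"
proof
  fix \<zeta>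
  have "disc_series 1 (single_mode 0 1) \<zeta> = \<zeta>" "disc_series 0 (single_mode 0 1) \<zeta> = 1"
    using disc_series_single_mode[of 0 1 1 1 \<zeta>] disc_series_single_mode[of 0 0 0 1 \<zeta>] by simp_all
  moreover have "disc_series s 0 \<zeta> = 0" for s by (simp add: disc_series_def)
  ultimately show "disc_map base \<zeta> = f0lift \<zeta>"
    by (auto simp: disc_map_def f0lift_def base_def vec_eq_iff)
qed

lemma f0lift_nth:
  assumes "cmod \<zeta> \<le> 1"
  shows "f0lift \<zeta> $ 1 = \<zeta>" "f0lift \<zeta> $ 2 = 0" "f0lift \<zeta> $ 3 = 1" "f0lift \<zeta> $ 4 = 0"
  using assms by (simp_all add: f0lift_def)

lemma norm_diff_f0lift:
  assumes "cmod \<zeta> = 1"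
  shows "norm (P$1 - \<zeta>, P$2, P$3 - 1, P$4) = norm (P - f0lift \<zeta>)"
  using assms by (simp add: norm_Pair norm_vec_def L2_set_def sum_4 f0lift_nth add_ac)

lemma disc_map_solution_stat_eqs:
  assumes v: "v = KT lam x + QT lam v v" and lam: "lam \<noteq> 1" "lam \<ge> 0" and \<zeta>: "cmod \<zeta> = 1"
  defines "P \<equiv> disc_map (base + v) \<zeta>"
  shows "stat_eqs lam (cnj \<zeta> * P$1) ((cnj \<zeta>)^2 * P$2) (P$3) (\<zeta> * P$4)"
proof -
  have zz: "cnj \<zeta> * \<zeta> = 1" using \<zeta> complex_norm_square[of \<zeta>] by (simp add: mult.commute)
  have z0: "\<zeta> \<noteq> 0" and \<zeta>': "cmod \<zeta> \<le> 1" using \<zeta> by auto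
  note sup = coefficient_data(1-4)[OF v]
  have ev0: "series_at 0 \<zeta> = 0" by (simp add: series_at_def)
  have e1: "series_at (single_mode 0 1) \<zeta> = 1" by (simp add: series_at_single_mode[OF \<zeta>])
  have "P$1 = \<zeta> powi 1 * series_at ((base + v)$IA) \<zeta>"
    unfolding P_def disc_map_nth[OF \<zeta>'] by (rule disc_series_circle[OF \<zeta>]) (simp add: base_def sup)
  then have 1: "P$1 = \<zeta> * (1 + series_at (v$IA) \<zeta>)" by (simp add: base_def series_at_add[OF \<zeta>] e1)
  have "P$2 = \<zeta> powi 2 * series_at ((base + v)$IB) \<zeta>"
    unfolding P_def disc_map_nth[OF \<zeta>'] by (rule disc_series_circle[OF \<zeta>]) (simp add: base_def sup)
  then have 2: "P$2 = \<zeta>^2 * series_at (v$IB) \<zeta>" by (simp add: base_def)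
  have "P$3 = \<zeta> powi 0 * series_at ((base + v)$IP) \<zeta>"
    unfolding P_def disc_map_nth[OF \<zeta>'] by (rule disc_series_circle[OF \<zeta>]) (simp add: base_def sup)
  then have 3: "P$3 = 1 + series_at (v$IP) \<zeta>" by (simp add: base_def series_at_add[OF \<zeta>] e1)
  have "P$4 = \<zeta> powi (-1) * series_at ((base + v)$IR) \<zeta>"
    unfolding P_def disc_map_nth[OF \<zeta>'] by (rule disc_series_circle[OF \<zeta>]) (simp add: base_def sup)
  then have 4: "\<zeta> * P$4 = series_at (v$IR) \<zeta>" using z0 by (simp add: base_def power_int_minus)
  have "cnj \<zeta> * P$1 = 1 + series_at (v$IA) \<zeta>" unfolding 1 mult.assoc[symmetric] zz by simp
  moreover have "(cnj \<zeta>)^2 * P$2 = series_at (v$IB) \<zeta>"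
    unfolding 2 mult.assoc[symmetric] power_mult_distrib[symmetric] zz by simp
  ultimately show ?thesis
    unfolding stat_eqs_def 3 4 using circle_equations[OF v lam \<zeta>] by simp
qed

lemma solution_family:
  assumes lam: "lam \<noteq> 1" "lam \<ge> 0"
  obtains W \<phi> where "open W" "0 \<in> W" "\<phi> 0 = 0" "\<And>k. Ck k \<phi> W" "\<And>x. x \<in> W \<Longrightarrow> params_fcoeff (\<phi> x) = x"
    "\<And>x \<zeta>. x \<in> W \<Longrightarrow> cmod \<zeta> = 1 \<Longrightarrow> stat_eqs lam (cnj \<zeta> * disc_map (base + \<phi> x) \<zeta> $ 1)
      ((cnj \<zeta>)^2 * disc_map (base + \<phi> x) \<zeta> $ 2) (disc_map (base + \<phi> x) \<zeta> $ 3) (\<zeta> * disc_map (base + \<phi> x) \<zeta> $ 4)"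
proof -
  define T where "T u v = (1/2) *\<^sub>R (QT lam u v + QT lam v u)" for u v
  have "bounded_bilinear T"
    unfolding T_def[abs_def]
    by (intro bounded_bilinear_scaleR_fun bounded_bilinear_add_fun bounded_bilinear_QT
        bounded_bilinear.flip[OF bounded_bilinear_QT])
  then interpret symmetric_bilinear T
    by (rule symmetric_bilinear.intro) (unfold_locales, simp add: T_def add.commute)
  obtain W and \<phi> :: "real^8 \<Rightarrow> wser^ix" where W: "open W" "0 \<in> W" "\<phi> 0 = 0"
    and \<phi>: "\<And>x. x \<in> W \<Longrightarrow> \<phi> x = KT lam x + T (\<phi> x) (\<phi> x)" and C: "\<And>k. Ck k \<phi> W"
    using quadratic_solution[OF linear_conv_bounded_linear[THEN iffD1, OF linear_KT[of lam]]] by auto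
  have "T v v = QT lam v v" for v unfolding T_def by (simp flip: scaleR_2)
  with \<phi> have v: "\<phi> x = KT lam x + QT lam (\<phi> x) (\<phi> x)" if "x \<in> W" for x using that by metis
  have params: "params_fcoeff (\<phi> x) = x" if "x \<in> W" for x
    unfolding vec_eq_iff
  proof
    fix i :: 8
    show "params_fcoeff (\<phi> x) $ i = x $ i"
      using exhaust_8[of i] coefficient_data(5-9)[OF v[OF that]] by (auto simp: params_fcoeff_def)
  qed
  show thesis
    by (rule that[OF W C params]) (use disc_map_solution_stat_eqs[OF v lam] in auto)
qed

theorem theorem3p1:
  fixes lam \<alpha> :: real
  assumes "lam \<ge> 0" and "lam \<noteq> 1" and "0 < \<alpha>" and "\<alpha> < 1"
  shows "\<exists>V. hopen \<alpha> V \<and> f0lift \<in> V \<and>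
           hsubmanifold \<alpha> TYPE(real^8)
             {F \<in> V. \<forall>\<zeta>\<in>sphere 0 1. F \<zeta> \<in> NM (rho lam) \<zeta>}"
proof -
  note \<alpha> = \<open>0 < \<alpha>\<close> \<open>\<alpha> < 1\<close>
  obtain d1 where d1: "d1 > 0" and unique: "\<forall>z w p q z' w' p' q' \<zeta>. stat_lift lam d1 z w p q \<longrightarrow> stat_lift lam d1 z' w' p' q' \<longrightarrow>
      z 0 = z' 0 \<and> Im (deriv z 0) = Im (deriv z' 0) \<and> w 0 = w' 0 \<and> deriv w 0 = deriv w' 0 \<and> Re (p 0) = Re (p' 0) \<longrightarrow>
      cmod \<zeta> \<le> 1 \<longrightarrow> z \<zeta> = z' \<zeta> \<and> w \<zeta> = w' \<zeta> \<and> p \<zeta> = p' \<zeta> \<and> q \<zeta> = q' \<zeta>"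
    using stationary_unique[OF assms(1,2)] by blast
  obtain d2 where d2: "d2 > 0" and NM: "\<And>\<zeta> P. \<lbrakk>cmod \<zeta> = 1; norm (P$1 - \<zeta>, P$2, P$3 - 1, P$4) < d2;
    stat_eqs lam (cnj \<zeta> * P$1) ((cnj \<zeta>)^2 * P$2) (P$3) (\<zeta> * P$4)\<rbrakk> \<Longrightarrow> P \<in> NM (rho lam) \<zeta>"
    by (rule stat_eqs_imp_NM) (rule that)
  obtain W0 and \<phi> :: "real^8 \<Rightarrow> wser^ix" where W0: "open W0" "0 \<in> W0" "\<phi> 0 = 0" and C: "\<And>k. Ck k \<phi> W0"
    and params: "\<And>x. x \<in> W0 \<Longrightarrow> params_fcoeff (\<phi> x) = x"
    and eqs: "\<And>x \<zeta>. x \<in> W0 \<Longrightarrow> cmod \<zeta> = 1 \<Longrightarrow> stat_eqs lam (cnj \<zeta> * disc_map (base + \<phi> x) \<zeta> $ 1)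
      ((cnj \<zeta>)^2 * disc_map (base + \<phi> x) \<zeta> $ 2) (disc_map (base + \<phi> x) \<zeta> $ 3) (\<zeta> * disc_map (base + \<phi> x) \<zeta> $ 4)"
    by (rule solution_family[OF assms(2,1)]) (rule that)
  \<comment> \<open>Within \<open>d1\<close> uniqueness holds, and within \<open>d2\<close> the
    circle equations imply membership in \<open>NM\<close>.\<close>
  define \<epsilon> where "\<epsilon> = min d1 d2"
  have \<epsilon>: "\<epsilon> > 0" using d1 d2 by (simp add: \<epsilon>_def)
  have tb: "disc_map_bound \<ge> 0" using invsq_sum_nonneg by (simp add: disc_map_bound_def)
  have "continuous_on W0 \<phi>" using C[of 0] by simp
  then have "continuous (at 0) \<phi>" using W0 by (simp add: continuous_on_eq_continuous_at)
  then have "continuous (at 0) (\<lambda>x. norm (\<phi> x) * disc_map_bound)" by (intro continuous_intros)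
  then obtain \<delta>1 where \<delta>1: "\<delta>1 > 0" "\<And>x. norm x < \<delta>1 \<Longrightarrow> norm (\<phi> x) * disc_map_bound < \<epsilon>"
    unfolding continuous_at_eps_delta using \<epsilon> tb W0(3) by force
  obtain \<delta>2 where \<delta>2: "\<delta>2 > 0" "ball 0 \<delta>2 \<subseteq> W0" using W0 by (auto simp: open_contains_ball)
  define W where "W = ball (0::real^8) (min \<delta>1 \<delta>2)"
  have W: "open W" "W \<subseteq> W0" "0 \<in> W" "\<And>x. x \<in> W \<Longrightarrow> norm (\<phi> x) * disc_map_bound < \<epsilon>"
    using \<delta>1 \<delta>2 by (auto simp: W_def)
  define \<Phi> where "\<Phi> x = disc_map (base + \<phi> x)" for x
  have \<Phi>A: "\<Phi> x \<in> Aalpha \<alpha>" for x unfolding \<Phi>_def by (rule disc_map_in_Aalpha[OF \<alpha>])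
  have f0A: "f0lift \<in> Aalpha \<alpha>" unfolding disc_map_base[symmetric] by (rule disc_map_in_Aalpha[OF \<alpha>])
  define \<pi> where "\<pi> F = params F - params f0lift" for F
  have \<pi>\<Phi>: "\<pi> (\<Phi> x) = x" if "x \<in> W0" for x
    using params[OF that] bounded_linear.linear[OF bounded_linear_params_fcoeff]
    by (simp add: \<pi>_def \<Phi>_def params_disc_map linear_add flip: disc_map_base)
  \<comment> \<open>A uniform \<open>e < \<epsilon>\<close> leaves room for perturbations, and
    restricting \<open>\<pi> F\<close> to \<open>W\<close> makes \<open>\<Phi>\<close> reach every
    lift in \<open>V\<close>.\<close>
  define V where "V = {F \<in> Aalpha \<alpha>. (\<exists>e<\<epsilon>. \<forall>z\<in>cball 0 1. norm (F z - f0lift z) \<le> e) \<and> \<pi> F \<in> W}"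
  have openV: "hopen \<alpha> V"
    unfolding hopen_def
  proof (intro conjI ballI)
    fix F assume "F \<in> V"
    then obtain e where F: "F \<in> Aalpha \<alpha>" "e < \<epsilon>" "\<And>z. z \<in> cball 0 1 \<Longrightarrow> norm (F z - f0lift z) \<le> e" "\<pi> F \<in> W"
      by (auto simp: V_def)
    obtain r where r: "r > 0" "ball (\<pi> F) r \<subseteq> W" using W(1) F(4) by (auto simp: open_contains_ball)
    \<comment> \<open>Half of the slack goes to the sup norm; \<open>r / 9\<close> gives
      \<open>8 * d < r\<close>, with the 8 of \<open>params_lipschitz\<close>.\<close>
    define d where "d = min ((\<epsilon> - e) / 2) (r / 9)"
    have d: "d > 0" "e + d < \<epsilon>" "8 * d < r" using F(2) r(1) by (auto simp: d_def min_def field_simps)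
    have "G \<in> V" if G: "G \<in> Aalpha \<alpha>" "hnorm \<alpha> (\<lambda>z. G z - F z) < d" for G
    proof -
      have GF: "norm (G z - F z) \<le> d" if "z \<in> cball 0 1" for z
        using norm_le_hnorm[OF Aalpha_diff[OF G(1) F(1)] \<alpha>(1) that] G(2) by simp
      have "norm (G z - f0lift z) \<le> e + d" if "z \<in> cball 0 1" for z
        using norm_triangle_ineq[of "G z - F z" "F z - f0lift z"] GF[OF that] F(3)[OF that] by simp
      moreover have "norm (params G - params F) \<le> 8 * d" by (rule params_lipschitz[OF G(1) F(1) \<alpha>(1) GF])
      then have "\<pi> G \<in> W" using r(2) d(3) by (auto simp: \<pi>_def dist_norm norm_minus_commute subset_iff)
      ultimately show ?thesis using G(1) d(2) by (auto simp: V_def)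
    qed
    with d(1) show "\<exists>e>0. \<forall>G\<in>Aalpha \<alpha>. hnorm \<alpha> (\<lambda>z. G z - F z) < e \<longrightarrow> G \<in> V" by blast
  qed (auto simp: V_def)
  have f0V: "f0lift \<in> V"
    using f0A W(3) \<epsilon> by (auto simp: V_def \<pi>_def)
  define S where "S = {F \<in> V. \<forall>\<zeta>\<in>sphere 0 1. F \<zeta> \<in> NM (rho lam) \<zeta>}"
  have \<Phi>V: "\<Phi> x \<in> V" if x: "x \<in> W" for x
  proof -
    have "norm (\<Phi> x z - f0lift z) \<le> norm (\<phi> x) * disc_map_bound" for z
      using norm_disc_map_le[of "\<phi> x" z] by (simp add: \<Phi>_def disc_map_add disc_map_base)
    then show ?thesis using \<Phi>A[of x] W(4)[OF x] \<pi>\<Phi>[of x] x W(2) by (auto simp: V_def)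
  qed
  have small: "norm (F \<zeta> $ 1 - \<zeta>, F \<zeta> $ 2, F \<zeta> $ 3 - 1, F \<zeta> $ 4) < \<epsilon>" if "F \<in> V" "cmod \<zeta> = 1" for F \<zeta>
  proof -
    obtain e where e: "e < \<epsilon>" "\<forall>z\<in>cball 0 1. norm (F z - f0lift z) \<le> e"
      using \<open>F \<in> V\<close> unfolding V_def by blast
    have "norm (F \<zeta> - f0lift \<zeta>) \<le> e" using e(2) that(2) by simp
    with e(1) show ?thesis unfolding norm_diff_f0lift[OF that(2)] by linarith
  qed
  have \<Phi>S: "\<Phi> x \<in> S" if x: "x \<in> W" for x
  proof -
    have "\<Phi> x \<zeta> \<in> NM (rho lam) \<zeta>" if "cmod \<zeta> = 1" for \<zeta>
      using small[OF \<Phi>V[OF x] that] eqs[of x \<zeta>] x W(2) that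
      by (intro NM) (auto simp: \<Phi>_def \<epsilon>_def)
    then show ?thesis using \<Phi>V[OF x] by (simp add: S_def)
  qed
  \<comment> \<open>\<open>F\<close> and \<open>\<Phi> (\<pi> F)\<close> are lifts near f0 with the
    same eight parameters, so uniqueness identifies them on the closed disc; outside it both are 0
    by the convention in \<open>Aalpha\<close>.\<close>
  have S\<Phi>: "F = \<Phi> (\<pi> F)" if F: "F \<in> S" for F
  proof -
    have FV: "F \<in> V" and FA: "F \<in> Aalpha \<alpha>" and x: "\<pi> F \<in> W" using F by (auto simp: S_def V_def)
    define G where "G = \<Phi> (\<pi> F)"
    have G: "G \<in> S" "G \<in> V" "G \<in> Aalpha \<alpha>" using \<Phi>S[OF x] \<Phi>V[OF x] \<Phi>A by (auto simp: G_def)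
    have "\<pi> G = \<pi> F" unfolding G_def using x W(2) by (intro \<pi>\<Phi>) auto
    then have pFG: "params F $ i = params G $ i" for i by (simp add: \<pi>_def)
    have data: "F 0 $ 1 = G 0 $ 1" "Im (deriv (\<lambda>z. F z $ 1) 0) = Im (deriv (\<lambda>z. G z $ 1) 0)"
      "F 0 $ 2 = G 0 $ 2" "deriv (\<lambda>z. F z $ 2) 0 = deriv (\<lambda>z. G z $ 2) 0" "Re (F 0 $ 3) = Re (G 0 $ 3)"
      using pFG[of 1] pFG[of 2] pFG[of 3] pFG[of 4] pFG[of 5] pFG[of 6] pFG[of 7] pFG[of 8]
      by (simp_all add: params_def complex_eq_iff)
    have lift: "stat_lift lam d1 (\<lambda>z. H z $ 1) (\<lambda>z. H z $ 2) (\<lambda>z. H z $ 3) (\<lambda>z. H z $ 4)"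
      if "H \<in> S" "H \<in> V" "H \<in> Aalpha \<alpha>" for H
      unfolding stat_lift_def using that small[of H] NM_imp_stat_eqs[of "H x" lam x for x]
      by (auto simp: S_def \<epsilon>_def intro: Aalpha_disc_alg[OF _ \<alpha>(1)])
    have eq: "F \<zeta> $ 1 = G \<zeta> $ 1 \<and> F \<zeta> $ 2 = G \<zeta> $ 2 \<and> F \<zeta> $ 3 = G \<zeta> $ 3 \<and> F \<zeta> $ 4 = G \<zeta> $ 4" if "cmod \<zeta> \<le> 1" for \<zeta>
      using unique[rule_format, OF lift[OF F FV FA] lift[OF G], of \<zeta>] data that by blast
    have "F \<zeta> = G \<zeta>" for \<zeta>
    proof (cases "cmod \<zeta> \<le> 1")
      case True
      from eq[OF this] show ?thesis by (simp add: vec_eq_iff forall_4)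
    next
      case False
      then show ?thesis using FA G(3) by (simp add: Aalpha_def)
    qed
    then show ?thesis by (auto simp: G_def)
  qed
  have image: "\<Phi> ` W = S \<inter> V"
  proof
    show "S \<inter> V \<subseteq> \<Phi> ` W"
    proof
      fix F assume "F \<in> S \<inter> V"
      then show "F \<in> \<Phi> ` W" using S\<Phi>[of F] by (auto simp: V_def intro: image_eqI[of _ _ "\<pi> F"])
    qed
  qed (use \<Phi>S \<Phi>V in auto)
  have smooth: "hCk k \<alpha> \<Phi> W" for k
  proof -
    have mono: "Ck k g W" if "Ck k g W0" for k and g :: "real^8 \<Rightarrow> wser^ix"
      using that
    proof (induction k arbitrary: g)
      case 0
      then show ?case using W(2) by (auto intro: continuous_on_subset)
    next
      case (Suc k)
      then show ?case using W(2) unfolding Ck.simps by blast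
    qed
    show ?thesis
      unfolding \<Phi>_def[abs_def]
      by (intro hCk_disc_map[OF \<alpha>] Ck_add[OF Ck_const] mono C)
  qed
  \<comment> \<open>\<open>params_fcoeff\<close> inverts \<open>\<phi>\<close> from the left, hence
    also its derivative; so \<open>params\<close> is a left inverse of the derivative of
    \<open>\<Phi>\<close>.\<close>
  have immersion: "\<exists>L. hderiv \<alpha> \<Phi> L x \<and> inj L" if x: "x \<in> W" for x
  proof -
    have x0: "x \<in> W0" using x W(2) by auto
    obtain D where D: "(\<phi> has_derivative D) (at x)" using C[of "Suc 0"] x0 by auto
    have "((\<lambda>x. params_fcoeff (\<phi> x)) has_derivative (\<lambda>h. params_fcoeff (D h))) (at x)"
      by (rule bounded_linear.has_derivative[OF bounded_linear_params_fcoeff D])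
    moreover have "((\<lambda>x. params_fcoeff (\<phi> x)) has_derivative (\<lambda>h. h)) (at x)"
      by (rule has_derivative_transform_within_open[OF has_derivative_ident W0(1) x0]) (simp add: params)
    ultimately have id: "params_fcoeff (D h) = h" for h using has_derivative_unique by metis
    have "((\<lambda>x. base + \<phi> x) has_derivative D) (at x)"
      using has_derivative_add[OF has_derivative_const D] by simp
    then have "hderiv \<alpha> \<Phi> (\<lambda>h. disc_map (D h)) x"
      unfolding \<Phi>_def[abs_def] by (rule hderiv_disc_map[OF \<alpha>])
    moreover have "inj (\<lambda>h. disc_map (D h))"
      by (rule inj_on_inverseI[of _ params]) (simp add: params_disc_map id)
    ultimately show ?thesis by blast
  qed
  have inverse: "\<exists>d>0. \<forall>y\<in>W. hnorm \<alpha> (\<lambda>z. \<Phi> y z - \<Phi> x z) < d \<longrightarrow> norm (y - x) < e"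
    if x: "x \<in> W" and e: "e > 0" for x e
  proof (intro exI conjI ballI impI)
    show "e / 8 > 0" using e by simp
    fix y assume y: "y \<in> W" and h: "hnorm \<alpha> (\<lambda>z. \<Phi> y z - \<Phi> x z) < e / 8"
    have "norm (params (\<Phi> y) - params (\<Phi> x)) \<le> 8 * hnorm \<alpha> (\<lambda>z. \<Phi> y z - \<Phi> x z)"
      by (rule params_lipschitz[OF \<Phi>A \<Phi>A \<alpha>(1) norm_le_hnorm[OF Aalpha_diff[OF \<Phi>A \<Phi>A] \<alpha>(1)]])
    moreover have "params (\<Phi> y) - params (\<Phi> x) = \<pi> (\<Phi> y) - \<pi> (\<Phi> x)" by (simp add: \<pi>_def)
    moreover have "\<dots> = y - x"
      using \<pi>\<Phi>[OF subsetD[OF W(2) x]] \<pi>\<Phi>[OF subsetD[OF W(2) y]] by (simp only:)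
    ultimately show "norm (y - x) < e" using h by simp
  qed
  have inj: "inj_on \<Phi> W" by (rule inj_on_inverseI[of _ \<pi>]) (use \<pi>\<Phi> W(2) in auto)
  have "hsubmanifold \<alpha> TYPE(real^8) S"
    unfolding hsubmanifold_def
  proof (intro conjI ballI)
    show "S \<subseteq> Aalpha \<alpha>" by (auto simp: S_def V_def)
    fix F assume "F \<in> S"
    then have "F \<in> V" by (simp add: S_def)
    then show "\<exists>U W (\<phi> :: real^8 \<Rightarrow> complex \<Rightarrow> complex^4).
        hopen \<alpha> U \<and> F \<in> U \<and> open W \<and> (\<forall>k. hCk k \<alpha> \<phi> W)
        \<and> \<phi> ` W = S \<inter> U \<and> inj_on \<phi> W
        \<and> (\<forall>x\<in>W. \<exists>L. hderiv \<alpha> \<phi> L x \<and> inj L)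
        \<and> (\<forall>x\<in>W. \<forall>e>0. \<exists>d>0. \<forall>y\<in>W. hnorm \<alpha> (\<lambda>z. \<phi> y z - \<phi> x z) < d \<longrightarrow> norm (y - x) < e)"
      \<comment> \<open>One chart covers everything: \<open>U = V\<close> serves for every point of
        \<open>S\<close>.\<close>
      using openV W(1) smooth image inj immersion inverse
      by - (rule exI[of _ V], rule exI[of _ W], rule exI[of _ \<Phi>], intro conjI allI ballI impI, assumption+)
  qed
  then show ?thesis using openV f0V unfolding S_def by blast
qed

end
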